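(* Let the spectral density $f(\lambda)$ be known (fixed), let $P_2>0$ and $$\mathcal D_g=\left\{g(\lambda)\ \Big|\ \frac1{2\pi}\int_{-\pi}^{\pi}g(\lambda)d\lambda\le P_2\right\}.$$ Suppose that $g^0\in\mathcal D_g$, that $\int_{-\pi}^{\pi}\frac{d\lambda}{f(\lambda)+g^0(\lambda)}<\infty$, and that the function $$h_g(f,g^0)=\frac{\left|A(e^{i\lambda})f(\lambda)-\sum_{k=0}^\infty((\mathbf P^0)^{-1}\mathbf R^0\mathbf a)_ke^{i\lambda(k+1)}\right|}{f(\lambda)+g^0(\lambda)}$$ is bounded. If $g^0$ is of the form $$g^0(\lambda)=\max\left\{0,\ \frac{\left|A(e^{i\lambda})f(\lambda)-\sum_{k=0}^\infty((\mathbf P^0)^{-1}\mathbf R^0\mathbf a)_ke^{i\lambda(k+1)}\right|}{\alpha_2}-f(\lambda)\right\}$$ for a constant $\alpha_2>0$, and the pair $(f,g^0)$ is a solution of the optimization problem $$\max_{g\in\mathcal D_g}\left(\langle\mathbf R\mathbf a,\mathbf P^{-1}\mathbf R\mathbf a\rangle+\langle\mathbf Q\mathbf a,\mathbf a\rangle\right)=\langle\mathbf R^0\mathbf a,(\mathbf P^0)^{-1}\mathbf R^0\mathbf a\rangle+\langle\mathbf Q^0\mathbf a,\mathbf a\rangle$$ (with $\mathbf P,\mathbf R,\mathbf Q$ built from $(f,g)$), then $g^0$ is least favorable in the class $\mathcal D_g$ for the optimal linear filtering of $A\xi=\sum_{k=0}^\infty a(k)\xi(-k)$, and the function $h(f,g^0)$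 is the minimax-robust spectral characteristic of the optimal estimate of $A\xi$.
   Context: Setting: $\xi,\eta$ are zero-mean, mutually uncorrelated (wide-sense) stationary sequences with spectral densities $f,g\ge0$, integrable on $[-\pi,\pi)$, normalized by $\mathsf E\,\xi(m+k)\overline{\xi(m)}=\frac1{2\pi}\int e^{ik\lambda}f\,d\lambda$ (similarly $\eta,g$); $\xi(m)=\int e^{im\lambda}dZ_\xi(\lambda)$, $\eta(m)=\int e^{im\lambda}dZ_\eta(\lambda)$, $Z_{\xi+\eta}=Z_\xi+Z_\eta$. The functional $A\xi=\sum_{k\ge0}a(k)\xi(-k)$ is estimated by $\int h(\lambda)dZ_{\xi+\eta}(\lambda)$ from observations of $\xi(m)+\eta(m)$, $m=0,-1,-2,\ldots$. The coefficients satisfy $\sum|a(k)|<\infty$, $\sum(k+1)|a(k)|^2<\infty$; $\mathbf a=(a(0),a(1),\ldots)'$, $A(e^{i\lambda})=\sum_{k\ge0}a(k)e^{-i\lambda k}$. Operators: $\langle x,y\rangle=\sum_{k\ge0}x_k\overline{y_k}$ on $\ell_2$. For a pair $(f,g)$ with $\int\frac{d\lambda}{f+g}<\infty$, $\mathbf P,\mathbf R,\mathbf Q$ are the linear operators on $\ell_2$ with matrices ($l,k,m\ge0$) $$(\mathbf P)_{l,k}=\frac1{2\pi}\int_{-\pi}^{\pi}\frac{e^{i\lambda(k-l)}}{f+g}d\lambda,\quad(\mathbf R)_{l,m}=\frac1{2\pi}\int_{-\pi}^{\pi}e^{-i\lambda(l+1+m)}\frac{f}{f+g}d\lambda,\quad(\mathbf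 Q)_{l,k}=\frac1{2\pi}\int_{-\pi}^{\pi}e^{i\lambda(l-k)}\frac{fg}{f+g}d\lambda ;$$ $\mathbf P^0,\mathbf R^0,\mathbf Q^0$ are those built from $(f,g^0)$. Expressions involving these operators are considered for pairs with $\int\frac{d\lambda}{f+g}<\infty$ for which the matrices define operators on $\ell_2$ and $\mathbf P$ is invertible. Spectral characteristic and error: the optimal spectral characteristic for $(f,g)$ is $$h(f,g)(\lambda)=A(e^{i\lambda})\frac{f(\lambda)}{f(\lambda)+g(\lambda)}-\frac{\sum_{k\ge0}(\mathbf P^{-1}\mathbf R\mathbf a)_ke^{i\lambda(k+1)}}{f(\lambda)+g(\lambda)},$$ and $\Delta(h;f,g)=\frac1{2\pi}\int_{-\pi}^{\pi}|A(e^{i\lambda})-h(\lambda)|^2f(\lambda)d\lambda+\frac1{2\pi}\int_{-\pi}^{\pi}|h(\lambda)|^2g(\lambda)d\lambda$ is the mean-square error of the estimate with spectral characteristic $h$. Definitions (with $f$ fixed, i.e. for the class $\mathcal D=\{f\}\times\mathcal D_g$): $g^0\in\mathcal D_g$ is least favorable in $\mathcal D_g$ for the optimal linear filtering of $A\xi$ if $\Delta(h(f,g^0);f,g^0)=\max_{g\in\mathcal D_g}\Delta(h(f,g);f,g)$. A spectral characteristic $h^0$ is minimax-robust if $h^0\in H_{\mathcal D}=\bigcap_{g\in\mathcal D_g}L_2^0(f+g)$ and $\min_{h\in H_{\mathcal D}}\max_{g\in\mathcal D_g}\Delta(h;f,g)=\sup_{g\in\mathcal D_g}\Delta(h^0;f,g)$,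 where $L_2^0(f+g)$ is the closed subspace of $L_2(f+g)$ generated by $\{e^{im\lambda}:m=0,-1,-2,\ldots\}$. *)

theory Defs
  imports "HOL-Analysis.Analysis"
begin

abbreviation freq :: "real measure" where
  "freq \<equiv> lebesgue_on {-pi..pi}"

definition spectral_density :: "(real \<Rightarrow> real) \<Rightarrow> bool" where
  "spectral_density f \<longleftrightarrow> integrable freq f \<and> (\<forall>x\<in>{-pi..pi}. 0 \<le> f x)"

definition noise_class :: "real \<Rightarrow> (real \<Rightarrow> real) set" where
  "noise_class P\<^sub>2 = {g. spectral_density g \<and> 1 / (2 * pi) * (\<integral>x. g x \<partial>freq) \<le> P\<^sub>2}"


definition ell2 :: "(nat \<Rightarrow> complex) set" where
  "ell2 = {x. summable (\<lambda>k. (cmod (x k))\<^sup>2)}"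

definition l2norm :: "(nat \<Rightarrow> complex) \<Rightarrow> real" where
  "l2norm x = sqrt (\<Sum>k. (cmod (x k))\<^sup>2)"

definition l2inner :: "(nat \<Rightarrow> complex) \<Rightarrow> (nat \<Rightarrow> complex) \<Rightarrow> complex" where
  "l2inner x y = (\<Sum>k. x k * cnj (y k))"

definition mat_op :: "(nat \<Rightarrow> nat \<Rightarrow> complex) \<Rightarrow> (nat \<Rightarrow> complex) \<Rightarrow> nat \<Rightarrow> complex" where
  "mat_op M x = (\<lambda>l. \<Sum>k. M l k * x k)"

definition mat_inv :: "(nat \<Rightarrow> nat \<Rightarrow> complex) \<Rightarrow> (nat \<Rightarrow> complex) \<Rightarrow> nat \<Rightarrow> complex" where
  "mat_inv M = inv_into ell2 (mat_op M)"

text \<open>Operators are bounded and inverses are bounded. For an everywhere defined matrix operator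
  and for a bijective one both bounds are automatic (closed graph and bounded inverse theorems),
  so stating them excludes nothing.\<close>

definition l2_operator :: "(nat \<Rightarrow> nat \<Rightarrow> complex) \<Rightarrow> bool" where
  "l2_operator M \<longleftrightarrow>
     (\<forall>x\<in>ell2. (\<forall>l. summable (\<lambda>k. M l k * x k)) \<and> mat_op M x \<in> ell2) \<and>
     (\<exists>K. \<forall>x\<in>ell2. l2norm (mat_op M x) \<le> K * l2norm x)"

definition l2_invertible :: "(nat \<Rightarrow> nat \<Rightarrow> complex) \<Rightarrow> bool" where
  "l2_invertible M \<longleftrightarrow>
     l2_operator M \<and> bij_betw (mat_op M) ell2 ell2 \<and>
     (\<exists>K. \<forall>y\<in>ell2. l2norm (mat_inv M y) \<le> K * l2norm y)"


definition Pmat :: "(real \<Rightarrow> real) \<Rightarrow> (real \<Rightarrow> real) \<Rightarrow> nat \<Rightarrow> nat \<Rightarrow> complex" where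
  "Pmat f g l k = 1 / (2 * pi) *
     (\<integral>x. cis (x * (real k - real l)) / of_real (f x + g x) \<partial>freq)"

definition Rmat :: "(real \<Rightarrow> real) \<Rightarrow> (real \<Rightarrow> real) \<Rightarrow> nat \<Rightarrow> nat \<Rightarrow> complex" where
  "Rmat f g l m = 1 / (2 * pi) *
     (\<integral>x. cis (- x * (real l + 1 + real m)) * of_real (f x / (f x + g x)) \<partial>freq)"

definition Qmat :: "(real \<Rightarrow> real) \<Rightarrow> (real \<Rightarrow> real) \<Rightarrow> nat \<Rightarrow> nat \<Rightarrow> complex" where
  "Qmat f g l k = 1 / (2 * pi) *
     (\<integral>x. cis (x * (real l - real k)) * of_real (f x * g x / (f x + g x)) \<partial>freq)"

text \<open>The integral of \<open>1 / (f + g)\<close> is taken in \<^typ>\<open>ennreal\<close>, where \<open>1 / 0 = \<infinity>\<close>; its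
  finiteness therefore forces \<open>f + g > 0\<close> almost everywhere, and the real and complex
  divisions in the other definitions are genuine almost everywhere.\<close>

definition admissible_pair :: "(real \<Rightarrow> real) \<Rightarrow> (real \<Rightarrow> real) \<Rightarrow> bool" where
  "admissible_pair f g \<longleftrightarrow>
     (\<integral>\<^sup>+x. 1 / ennreal (f x + g x) \<partial>freq) < \<infinity> \<and>
     l2_operator (Pmat f g) \<and> l2_operator (Rmat f g) \<and> l2_operator (Qmat f g) \<and>
     l2_invertible (Pmat f g)"


definition transfer_fun :: "(nat \<Rightarrow> complex) \<Rightarrow> real \<Rightarrow> complex" where
  "transfer_fun a x = (\<Sum>k. a k * cis (- x * real k))"

text \<open>The series \<open>\<Sum>k. c k * e\<^bsup>i x (k + 1)\<^esup>\<close> of a square summable sequence converges in the mean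
  square; its sum is determined up to a null set, and a representative is chosen.\<close>

definition forward_series :: "(nat \<Rightarrow> complex) \<Rightarrow> real \<Rightarrow> complex" where
  "forward_series c = (SOME F. F \<in> borel_measurable freq \<and>
     (\<lambda>n. \<integral>\<^sup>+x. ennreal ((cmod (F x - (\<Sum>k<n. c k * cis (x * (real k + 1)))))\<^sup>2) \<partial>freq)
       \<longlonglongrightarrow> 0)"

definition correction_fun ::
  "(nat \<Rightarrow> complex) \<Rightarrow> (real \<Rightarrow> real) \<Rightarrow> (real \<Rightarrow> real) \<Rightarrow> real \<Rightarrow> complex" where
  "correction_fun a f g = forward_series (mat_inv (Pmat f g) (mat_op (Rmat f g) a))"

definition opt_char ::
  "(nat \<Rightarrow> complex) \<Rightarrow> (real \<Rightarrow> real) \<Rightarrow> (real \<Rightarrow> real) \<Rightarrow> real \<Rightarrow> complex" where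
  "opt_char a f g x =
     transfer_fun a x * of_real (f x / (f x + g x)) - correction_fun a f g x / of_real (f x + g x)"

definition mse ::
  "(nat \<Rightarrow> complex) \<Rightarrow> (real \<Rightarrow> complex) \<Rightarrow> (real \<Rightarrow> real) \<Rightarrow> (real \<Rightarrow> real) \<Rightarrow> ennreal" where
  "mse a h f g =
     ennreal (1 / (2 * pi)) *
       (\<integral>\<^sup>+x. ennreal ((cmod (transfer_fun a x - h x))\<^sup>2 * f x) \<partial>freq) +
     ennreal (1 / (2 * pi)) * (\<integral>\<^sup>+x. ennreal ((cmod (h x))\<^sup>2 * g x) \<partial>freq)"

text \<open>For an admissible pair both inner products are real, the operators \<open>P\<close> and \<open>Q\<close> being
  Hermitian; \<^const>\<open>Re\<close> only changes the type.\<close>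

definition extremal_functional ::
  "(nat \<Rightarrow> complex) \<Rightarrow> (real \<Rightarrow> real) \<Rightarrow> (real \<Rightarrow> real) \<Rightarrow> real" where
  "extremal_functional a f g =
     Re (l2inner (mat_op (Rmat f g) a) (mat_inv (Pmat f g) (mat_op (Rmat f g) a)) +
         l2inner (mat_op (Qmat f g) a) a)"


definition L2_past :: "(real \<Rightarrow> real) \<Rightarrow> (real \<Rightarrow> complex) set" where
  "L2_past w = {h \<in> borel_measurable freq.
     (\<integral>\<^sup>+x. ennreal ((cmod (h x))\<^sup>2 * w x) \<partial>freq) < \<infinity> \<and>
     (\<forall>\<epsilon>>0. \<exists>n b.
        (\<integral>\<^sup>+x. ennreal ((cmod (h x - (\<Sum>m\<le>n. b m * cis (- x * real m))))\<^sup>2 * w x) \<partial>freq)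
          < ennreal \<epsilon>)}"

definition robust_chars ::
  "(real \<Rightarrow> real) \<Rightarrow> (real \<Rightarrow> real) set \<Rightarrow> (real \<Rightarrow> complex) set" where
  "robust_chars f D = (\<Inter>g\<in>D. L2_past (\<lambda>x. f x + g x))"

text \<open>\<^const>\<open>opt_char\<close> and \<^const>\<open>extremal_functional\<close> have a meaning only for admissible pairs,
  so maxima of expressions containing them run over the admissible members of the class. The
  suprema of \<open>mse a h f g\<close> for a given \<open>h\<close> below run over the whole class.\<close>

definition solves_extremal_problem ::
  "(nat \<Rightarrow> complex) \<Rightarrow> (real \<Rightarrow> real) \<Rightarrow> (real \<Rightarrow> real) set \<Rightarrow> (real \<Rightarrow> real) \<Rightarrow> bool" where
  "solves_extremal_problem a f D g\<^sub>0 \<longleftrightarrow>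
     g\<^sub>0 \<in> D \<and> admissible_pair f g\<^sub>0 \<and>
     (\<forall>g\<in>D. admissible_pair f g \<longrightarrow> extremal_functional a f g \<le> extremal_functional a f g\<^sub>0)"

definition least_favorable ::
  "(nat \<Rightarrow> complex) \<Rightarrow> (real \<Rightarrow> real) \<Rightarrow> (real \<Rightarrow> real) set \<Rightarrow> (real \<Rightarrow> real) \<Rightarrow> bool" where
  "least_favorable a f D g\<^sub>0 \<longleftrightarrow>
     g\<^sub>0 \<in> D \<and> admissible_pair f g\<^sub>0 \<and>
     (\<forall>g\<in>D. admissible_pair f g \<longrightarrow>
        mse a (opt_char a f g) f g \<le> mse a (opt_char a f g\<^sub>0) f g\<^sub>0)"

definition minimax_robust ::
  "(nat \<Rightarrow> complex) \<Rightarrow> (real \<Rightarrow> real) \<Rightarrow> (real \<Rightarrow> real) set \<Rightarrow> (real \<Rightarrow> complex) \<Rightarrow> bool" where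
  "minimax_robust a f D h\<^sub>0 \<longleftrightarrow>
     h\<^sub>0 \<in> robust_chars f D \<and>
     (INF h\<in>robust_chars f D. SUP g\<in>D. mse a h f g) = (SUP g\<in>D. mse a h\<^sub>0 f g)"

end

theory Submission
  imports Defs
begin

text \<open>
  Write \<open>w = f + g\<^sub>0\<close>, let \<open>h\<^sub>0\<close> be the optimal characteristic for \<open>(f, g\<^sub>0)\<close>, \<open>A\<close> the transfer
  function and \<open>C\<close> the correction series. The theorem holds because \<open>(h\<^sub>0, g\<^sub>0)\<close> is a saddle
  point of the mean-square error: among the characteristics of linear estimates from the past
  \<open>h\<^sub>0\<close> has the least error at \<open>g\<^sub>0\<close>, and among the densities of the class \<open>g\<^sub>0\<close> gives
  \<open>h\<^sub>0\<close> the greatest error. With \<open>h\<^sub>0\<close> a member of \<^const>\<open>robust_chars\<close>, this is the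
  minimax property; that \<open>g\<^sub>0\<close> is least favorable is its extremality, because the
  least error is the extremal functional (\<open>mse_opt_char\<close>).

  The first inequality is a projection argument. One has \<open>C = A f - w h\<^sub>0\<close>, and \<open>C\<close> has only
  the frequencies \<open>1, 2, \<dots>\<close>. The equation \<open>P c = R a\<close> for its coefficients says exactly that
  \<open>h\<^sub>0\<close> has none of these frequencies. Hence \<open>C\<close> is orthogonal to \<open>h\<^sub>0\<close> and to every
  characteristic built on the past, and expanding the error gives a Pythagorean identity
  (\<open>mse_pythagoras\<close>) and the value of the least error (\<open>extremal_functional_eq\<close>). For these
  integrals to make sense \<open>1 / w\<close> has to be bounded above and away from zero. Both bounds come
  from the operator \<open>P\<close>: the quadratic form of a Toeplitz matrix at the coefficients of a
  polynomial \<open>X\<close> is an integral of \<open>\<bar>X\<bar>\<^sup>2\<close> against the symbol, the Fejer kernels are of the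
  form \<open>\<bar>X\<bar>\<^sup>2\<close>, and so inequalities between quadratic forms pass to the symbols
  (\<open>AE_nonneg_of_quadratic_form\<close>).

  For the second inequality, the error of \<open>h\<^sub>0\<close> at \<open>g\<close> depends on \<open>g\<close> only through the integral of
  \<open>\<bar>h\<^sub>0\<bar>\<^sup>2 g\<close>. The form of \<open>g\<^sub>0\<close> forces \<open>\<bar>h\<^sub>0\<bar> \<le> \<alpha>\<^sub>2\<close>, with equality where \<open>g\<^sub>0 \<noteq> 0\<close>
  (\<open>opt_char_modulus\<close>); this settles the case in which \<open>g\<^sub>0\<close> uses the whole power \<open>P\<^sub>2\<close>. If power
  is left, \<open>g\<^sub>0\<close> is compared with \<open>(1 + t) g\<^sub>0 + t f\<close> for a small \<open>t > 0\<close>. This perturbation multiplies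
  the total density \<open>w\<close> by \<open>1 + t\<close>, so that \<open>P\<close> and \<open>R\<close> change by a scalar factor only, the
  pair stays admissible, and the extremal functional can be computed exactly
  (\<open>extremal_functional_inflated\<close>). Its maximality at \<open>g\<^sub>0\<close> then says that the zero estimate is at
  least as good as \<open>h\<^sub>0\<close>. By the Pythagorean identity \<open>h\<^sub>0 = 0\<close> almost everywhere, and the
  error of \<open>h\<^sub>0\<close> does not depend on the noise at all.

  Finally \<open>h\<^sub>0\<close> lies in \<open>L2_past (f + g)\<close> for every \<open>g\<close> of the class: it is bounded and its
  spectrum is one-sided, so its Fejer means are polynomials in the past, are uniformly bounded,
  and converge almost everywhere along a subsequence; dominated convergence does not care which
  integrable density is the weight (\<open>bounded_in_L2_past\<close>).
\<close>

section \<open>Trigonometric polynomials on the circle\<close>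

abbreviation mode :: "int \<Rightarrow> real \<Rightarrow> complex" where
  "mode j x \<equiv> cis (x * real_of_int j)"

interpretation freq: finite_measure freq
  by (rule finite_measure_lebesgue_on) simp

lemma measure_freq: "measure freq {-pi..pi} = 2 * pi"
  by (simp add: measure_restrict_space)

lemma continuous_measurable_freq:
  fixes u :: "real \<Rightarrow> 'a::euclidean_space"
  shows "continuous_on {-pi..pi} u \<Longrightarrow> u \<in> borel_measurable freq"
  by (rule continuous_imp_measurable_on_sets_lebesgue) auto

lemma cis_measurable_freq [measurable]: "(\<lambda>x. cis (x * r)) \<in> borel_measurable freq"
  by (rule continuous_measurable_freq) (intro continuous_intros)

lemma integrable_mult_bounded:
  fixes \<psi> u :: "'b \<Rightarrow> complex"
  assumes "integrable M \<psi>" "u \<in> borel_measurable M" "AE x in M. cmod (u x) \<le> B"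
  shows "integrable M (\<lambda>x. \<psi> x * u x)"
proof (rule Bochner_Integration.integrable_bound)
  show "integrable M (\<lambda>x. B * cmod (\<psi> x))"
    using assms by auto
  show "(\<lambda>x. \<psi> x * u x) \<in> borel_measurable M"
    using assms by measurable
  show "AE x in M. norm (\<psi> x * u x) \<le> norm (B * cmod (\<psi> x))"
    using assms(3)
  proof eventually_elim
    case (elim x)
    then have "cmod (\<psi> x) * cmod (u x) \<le> cmod (\<psi> x) * B"
      by (intro mult_left_mono) auto
    then show ?case
      by (simp add: norm_mult abs_mult mult.commute)
         (smt (verit) elim mult.commute norm_ge_zero)
  qed
qed

lemma integrable_mult_cis:
  "integrable freq \<psi> \<Longrightarrow> integrable freq (\<lambda>x. \<psi> x * cis (x * r))"
  by (rule integrable_mult_bounded[where B = 1]) auto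

lemma integrable_cis [simp]: "integrable freq (\<lambda>x. cis (x * r))"
  using integrable_mult_cis[of "\<lambda>_. 1"] by simp

lemma integral_mode: "(\<integral>x. mode j x \<partial>freq) = (if j = 0 then of_real (2 * pi) else 0)"
proof (cases "j = 0")
  case True
  then show ?thesis
    using measure_freq by (simp add: scaleR_conv_of_real)
next
  case False
  have d: "((\<lambda>x. mode j x / (\<i> * of_int j)) has_vector_derivative mode j x) (at x within {-pi..pi})"
    for x
    unfolding has_vector_derivative_def
    using False by (auto intro!: derivative_eq_intros simp: scaleR_conv_of_real fun_eq_iff complex_eq_iff)
  have "(mode j has_integral (mode j pi / (\<i> * of_int j) - mode j (-pi) / (\<i> * of_int j))) {-pi..pi}"
    by (rule fundamental_theorem_of_calculus) (use d in auto)
  moreover have "mode j pi = mode j (-pi)"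
    by (simp add: complex_eq_iff sin_integer_2pi sin_times_pi_eq_0 mult.commute[of pi])
  ultimately have "(mode j has_integral 0) {-pi..pi}"
    by simp
  then show ?thesis
    using False by (simp add: lebesgue_integral_eq_integral integral_unique)
qed

text \<open>An inductive predicate, because products of trigonometric polynomials are needed only through
  the fact that they are again trigonometric polynomials.\<close>

inductive trig_poly :: "(real \<Rightarrow> complex) \<Rightarrow> bool" where
  mode: "trig_poly (\<lambda>x. c * mode j x)"
| add: "trig_poly p \<Longrightarrow> trig_poly q \<Longrightarrow> trig_poly (\<lambda>x. p x + q x)"

lemma trig_poly_const: "trig_poly (\<lambda>x. c)"
  using trig_poly.mode[of c 0] by simp

lemma trig_poly_mult:
  assumes "trig_poly p" "trig_poly q"
  shows "trig_poly (\<lambda>x. p x * q x)"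
  using assms
proof (induction p arbitrary: q rule: trig_poly.induct)
  case (mode c j q)
  from mode show ?case
  proof (induction q rule: trig_poly.induct)
    case (mode d k)
    have "(\<lambda>x. c * mode j x * (d * mode k x)) = (\<lambda>x. (c * d) * mode (j + k) x)"
      by (simp add: fun_eq_iff cis_mult [symmetric] distrib_left mult_ac)
    then show ?case
      by (simp add: trig_poly.mode del: of_int_add)
  next
    case (add p q)
    then show ?case
      by (simp add: distrib_left trig_poly.add)
  qed
next
  case (add p1 p2 q)
  then show ?case
    by (simp add: distrib_right trig_poly.add)
qed

lemma trig_poly_integrable: "trig_poly p \<Longrightarrow> integrable freq p"
  by (induction rule: trig_poly.induct) auto

text \<open>On the circle a real linear form is a combination of \<open>z\<close> and \<open>1 / z\<close>, so a real
  polynomial in the coordinates of \<open>z = e\<^bsup>i x\<^esup>\<close> is a trigonometric polynomial.\<close>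

lemma trig_poly_real_polynomial:
  assumes "real_polynomial_function q"
  shows "trig_poly (\<lambda>x. of_real (q (cis x)))"
  using assms
proof (induction q rule: real_polynomial_function.induct)
  case (linear q)
  interpret bounded_linear q by fact
  have "of_real (q (cis x)) =
      (of_real (q 1) - \<i> * of_real (q \<i>)) / 2 * mode 1 x + (of_real (q 1) + \<i> * of_real (q \<i>)) / 2 * mode (-1) x" for x
  proof -
    have "cis x = cos x *\<^sub>R 1 + sin x *\<^sub>R \<i>"
      by (simp add: complex_eq_iff)
    then have "q (cis x) = cos x * q 1 + sin x * q \<i>"
      by (metis add scaleR real_scaleR_def)
    then show ?thesis
      by (simp add: complex_eq_iff field_simps)
  qed
  then show ?case
    using trig_poly.intros by presburger
next
  case (const c)
  then show ?case by (simp add: trig_poly_const)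
next
  case (add f g)
  then show ?case by (simp add: trig_poly.add)
next
  case (mult f g)
  then show ?case by (simp add: trig_poly_mult)
qed

text \<open>The map \<^const>\<open>cis\<close> exhibits the circle as a quotient of the interval, so a continuous
  function with equal values at the end points is a continuous function on the circle, to which
  the Stone-Weierstrass theorem applies.\<close>

lemma trig_poly_dense_continuous:
  fixes G :: "real \<Rightarrow> complex"
  assumes G: "continuous_on {-pi..pi} G" "G (-pi) = G pi" and "0 < e"
  obtains p where "trig_poly p" "\<And>x. x \<in> {-pi..pi} \<Longrightarrow> cmod (G x - p x) < e"
proof -
  have "cis ` {-pi..pi} = sphere 0 1"
  proof
    show "sphere 0 1 \<subseteq> cis ` {-pi..pi}"
    proof
      fix z :: complex assume "z \<in> sphere 0 1"
      then have "z = cis (Arg z)"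
        using rcis_cmod_Arg[of z] by (simp add: rcis_def)
      moreover have "Arg z \<in> {-pi..pi}"
        using Arg_bounded[of z] by auto
      ultimately show "z \<in> cis ` {-pi..pi}" by blast
    qed
  qed auto
  then have q: "quotient_map (top_of_set {-pi..pi}) (top_of_set (sphere 0 1)) cis"
    by (intro T1_Spaces.continuous_imp_quotient_map)
       (auto simp: continuous_map_in_subtopology compact_space_subtopology
         Hausdorff_space_subtopology intro!: continuous_intros)
  have inj: "G x = G y" if "x \<in> {-pi..pi}" "y \<in> {-pi..pi}" "cis x = cis y" for x y
  proof -
    from that(3) obtain n :: int where n: "x = y + 2 * pi * n"
      using sin_cos_eq_iff[of x y] by (auto simp: complex_eq_iff)
    have "\<bar>2 * pi * n\<bar> \<le> 2 * pi"
      using n that by auto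
    then have "\<bar>n\<bar> \<le> 1"
      by (simp add: abs_mult flip: of_int_abs)
    then consider "n = 0" | "n = 1" | "n = -1"
      by linarith
    then show ?thesis
    proof cases
      case 2
      with n that have "x = pi" "y = -pi" by auto
      then show ?thesis using G(2) by simp
    next
      case 3
      with n that have "x = -pi" "y = pi" by auto
      then show ?thesis using G(2) by simp
    qed (use n in auto)
  qed
  obtain F where F: "continuous_on (sphere 0 1) F" "\<And>x. x \<in> {-pi..pi} \<Longrightarrow> F (cis x) = G x"
    using quotient_map_lift_exists[OF q, of euclidean G] G(1) inj
    by (metis (no_types, lifting) continuous_map_iff_continuous topspace_euclidean_subtopology)
  obtain P where P: "polynomial_function P" "\<And>z. z \<in> sphere 0 1 \<Longrightarrow> cmod (F z - P z) < e"
    using Stone_Weierstrass_polynomial_function[OF compact_sphere F(1) \<open>0 < e\<close>] by metis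
  have "trig_poly (\<lambda>x. of_real (Re (P (cis x))) + \<i> * of_real (Im (P (cis x))))"
    using P(1) bounded_linear_Re bounded_linear_Im unfolding polynomial_function_def
    by (intro trig_poly.add trig_poly_mult trig_poly_const)
       (auto intro!: trig_poly_real_polynomial simp: o_def)
  then have "trig_poly (\<lambda>x. P (cis x))"
    by (simp add: complex_eq[symmetric])
  then show thesis
  proof (rule that)
    fix x :: real assume "x \<in> {-pi..pi}"
    then show "cmod (G x - P (cis x)) < e"
      using P(2)[of "cis x"] F(2)[of x] by simp
  qed
qed

text \<open>A bounded measurable function is almost everywhere a limit of continuous functions. These are
  clipped to keep the bound, and damped near the end points to make them periodic.\<close>

lemma bounded_approx_continuous:
  fixes h :: "real \<Rightarrow> complex"
  assumes h: "h \<in> borel_measurable freq" and B: "\<And>x. x \<in> {-pi..pi} \<Longrightarrow> cmod (h x) \<le> B" "0 < B"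
  shows "\<exists>u. (\<forall>n. continuous_on {-pi..pi} (u n)) \<and> (\<forall>n. u n (-pi) = u n pi) \<and>
    (\<forall>n. \<forall>x\<in>{-pi..pi}. cmod (u n x) \<le> B) \<and> (AE x in freq. (\<lambda>n. u n x) \<longlonglongrightarrow> h x)"
proof -
  have "(\<lambda>x. if x \<in> {-pi..pi} then h x else 0) \<in> borel_measurable lebesgue"
    using h by (intro borel_measurable_if_I) auto
  then have "(\<lambda>x. if x \<in> {-pi..pi} then h x else 0) measurable_on UNIV"
    by (rule lebesgue_measurable_imp_measurable_on) simp
  then obtain N v where N: "negligible N" and v: "\<And>n. continuous_on UNIV (v n)"
    "\<And>x. x \<notin> N \<Longrightarrow> (\<lambda>n. v n x) \<longlonglongrightarrow> (if x \<in> {-pi..pi} then h x else 0)"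
    unfolding measurable_on_def by auto
  define clip where "clip z = (B / max B (cmod z)) *\<^sub>R z" for z :: complex
  define cutoff where "cutoff n x = min 1 (real n * abs (pi - abs x))" for n x
  define u where "u n x = cutoff n x *\<^sub>R clip (v n x)" for n x
  have clip_bound: "cmod (clip z) \<le> B" for z
    using B(2) by (auto simp: clip_def max_def abs_mult field_simps)
  have clip_cont: "continuous_on UNIV clip"
    unfolding clip_def using B(2) by (intro continuous_intros) (auto simp: max_def)
  show ?thesis
  proof (intro exI[of _ u] conjI allI ballI)
    fix n
    have "continuous_on UNIV (\<lambda>x. clip (v n x))"
      using continuous_on_compose2[OF clip_cont v(1)] by auto
    then show "continuous_on {-pi..pi} (u n)"
      unfolding u_def cutoff_def by (intro continuous_intros) (auto intro: continuous_on_subset)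
    show "u n (-pi) = u n pi"
      by (simp add: u_def cutoff_def)
  next
    fix n x
    have "\<bar>cutoff n x\<bar> \<le> 1"
      by (simp add: cutoff_def)
    then show "cmod (u n x) \<le> B"
      using mult_mono[OF _ clip_bound[of "v n x"], of "\<bar>cutoff n x\<bar>" 1] B(2) by (simp add: u_def)
  next
    have "negligible (N \<union> {-pi, pi})"
      using N by simp
    then have "AE x in lebesgue. x \<notin> N \<union> {-pi, pi}"
      by (intro AE_not_in) (simp add: negligible_iff_null_sets)
    then show "AE x in freq. (\<lambda>n. u n x) \<longlonglongrightarrow> h x"
    proof (subst AE_restrict_space_iff, simp, elim eventually_mono, intro impI)
      fix x assume x: "x \<notin> N \<union> {-pi, pi}" "x \<in> {-pi..pi}"
      then have lim: "(\<lambda>n. v n x) \<longlonglongrightarrow> h x"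
        using v(2)[of x] by simp
      have "isCont clip (h x)"
        using clip_cont continuous_on_eq_continuous_at by blast
      then have "(\<lambda>n. clip (v n x)) \<longlonglongrightarrow> clip (h x)"
        using lim isCont_tendsto_compose by blast
      also have "clip (h x) = h x"
        using B(1)[OF x(2)] B(2) by (simp add: clip_def max_def)
      finally have clip: "(\<lambda>n. clip (v n x)) \<longlonglongrightarrow> h x" .
      have pos: "0 < abs (pi - abs x)"
        using x by auto
      have "eventually (\<lambda>n. cutoff n x = 1) sequentially"
      proof -
        obtain m :: nat where m: "1 / abs (pi - abs x) < m"
          using reals_Archimedean2 by blast
        have "cutoff n x = 1" if "m \<le> n" for n
        proof -
          have "1 / abs (pi - abs x) \<le> n"
            using m that by (meson less_le_trans less_imp_le of_nat_le_iff)
          then show ?thesis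
            using pos by (simp add: cutoff_def field_simps min_def)
        qed
        then show ?thesis
          using eventually_sequentially by blast
      qed
      then have "(\<lambda>n. cutoff n x) \<longlonglongrightarrow> 1"
        by (rule tendsto_eventually)
      from tendsto_scaleR[OF this clip] show "(\<lambda>n. u n x) \<longlonglongrightarrow> h x"
        by (simp add: u_def)
    qed
  qed
qed

lemma integrable_bounded_freq:
  fixes u :: "real \<Rightarrow> complex"
  assumes "u \<in> borel_measurable freq" "\<And>x. x \<in> {-pi..pi} \<Longrightarrow> cmod (u x) \<le> B"
  shows "integrable freq u"
  by (rule freq.integrable_const_bound[where B = B]) (use assms in \<open>auto intro!: AE_I2\<close>)

lemma trig_poly_dense_bounded:
  fixes h :: "real \<Rightarrow> complex"
  assumes h: "h \<in> borel_measurable freq" and B: "\<And>x. x \<in> {-pi..pi} \<Longrightarrow> cmod (h x) \<le> B" "0 < B"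
    and e: "0 < e"
  obtains p where "trig_poly p" "(\<integral>x. cmod (h x - p x) \<partial>freq) < e"
proof -
  obtain u where "(\<forall>n. continuous_on {-pi..pi} (u n)) \<and> (\<forall>n. u n (-pi) = u n pi) \<and>
    (\<forall>n. \<forall>x\<in>{-pi..pi}. cmod (u n x) \<le> B) \<and> (AE x in freq. (\<lambda>n. u n x) \<longlonglongrightarrow> h x)"
    using bounded_approx_continuous[OF h B] ..
  then have u: "\<And>n. continuous_on {-pi..pi} (u n)" "\<And>n. u n (-pi) = u n pi"
    "\<And>n x. x \<in> {-pi..pi} \<Longrightarrow> cmod (u n x) \<le> B" "AE x in freq. (\<lambda>n. u n x) \<longlonglongrightarrow> h x"
    by auto
  note [measurable] = h continuous_measurable_freq[OF u(1)]
  have "(\<lambda>n. \<integral>x. cmod (h x - u n x) \<partial>freq) \<longlonglongrightarrow> (\<integral>x. 0 \<partial>freq)"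
  proof (rule integral_dominated_convergence[where w = "\<lambda>x. 2 * B"])
    show "AE x in freq. (\<lambda>n. cmod (h x - u n x)) \<longlonglongrightarrow> 0"
      using u(4)
    proof eventually_elim
      case (elim x)
      from tendsto_norm[OF tendsto_diff[OF tendsto_const[of "h x"] elim]] show ?case by simp
    qed
    fix n
    have "cmod (h x - u n x) \<le> 2 * B" if "x \<in> {-pi..pi}" for x
      using B(1)[OF that] u(3)[OF that, of n] norm_triangle_ineq4[of "h x" "u n x"] by linarith
    then show "AE x in freq. norm (cmod (h x - u n x)) \<le> 2 * B"
      by (intro AE_I2) auto
  qed auto
  then have "eventually (\<lambda>n. (\<integral>x. cmod (h x - u n x) \<partial>freq) < e / 2) sequentially"
    using e by (intro order_tendstoD(2)) auto
  then obtain n where n: "(\<integral>x. cmod (h x - u n x) \<partial>freq) < e / 2"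
    by (auto simp: eventually_sequentially)
  obtain p where p: "trig_poly p" "\<And>x. x \<in> {-pi..pi} \<Longrightarrow> cmod (u n x - p x) < e / (4 * pi)"
    using trig_poly_dense_continuous[OF u(1,2), of "e / (4 * pi)"] e by auto
  have int: "integrable freq (u n)" "integrable freq h" "integrable freq p"
    using integrable_bounded_freq[of "u n" B] integrable_bounded_freq[of h B] u(3) B(1)
      trig_poly_integrable[OF p(1)]
    by auto
  have "(\<integral>x. cmod (h x - p x) \<partial>freq) \<le> (\<integral>x. cmod (h x - u n x) + e / (4 * pi) \<partial>freq)"
  proof (rule integral_mono)
    fix x assume "x \<in> space freq"
    then show "cmod (h x - p x) \<le> cmod (h x - u n x) + e / (4 * pi)"
      using p(2)[of x] norm_triangle_ineq[of "h x - u n x" "u n x - p x"] by simp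
  qed (use int in auto)
  also have "\<dots> = (\<integral>x. cmod (h x - u n x) \<partial>freq) + e / 2"
    using int measure_freq by (subst Bochner_Integration.integral_add) auto
  finally show thesis
    using that p(1) n by auto
qed

lemma trig_poly_dense_L1:
  fixes \<psi> :: "real \<Rightarrow> complex"
  assumes \<psi>: "integrable freq \<psi>" and e: "0 < e"
  obtains p where "trig_poly p" "(\<integral>x. cmod (\<psi> x - p x) \<partial>freq) < e"
proof -
  define T where "T n x = (if cmod (\<psi> x) \<le> real n then \<psi> x else 0)" for n x
  have [measurable]: "\<psi> \<in> borel_measurable freq" using \<psi> by simp
  have [measurable]: "T n \<in> borel_measurable freq" for n
    unfolding T_def by measurable
  have "(\<lambda>n. \<integral>x. cmod (\<psi> x - T n x) \<partial>freq) \<longlonglongrightarrow> (\<integral>x. 0 \<partial>freq)"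
  proof (rule integral_dominated_convergence[where w = "\<lambda>x. cmod (\<psi> x)"])
    have "(\<lambda>n. cmod (\<psi> x - T n x)) \<longlonglongrightarrow> 0" for x
    proof (rule tendsto_eventually)
      obtain m :: nat where "cmod (\<psi> x) < m"
        using reals_Archimedean2 by blast
      then show "\<forall>\<^sub>F n in sequentially. cmod (\<psi> x - T n x) = 0"
        unfolding eventually_sequentially T_def by (intro exI[of _ m]) auto
    qed
    then show "AE x in freq. (\<lambda>n. cmod (\<psi> x - T n x)) \<longlonglongrightarrow> 0" by simp
  qed (use \<psi> in \<open>auto simp: T_def\<close>)
  then have "eventually (\<lambda>n. (\<integral>x. cmod (\<psi> x - T n x) \<partial>freq) < e / 2) sequentially"
    using e by (intro order_tendstoD(2)) auto
  then obtain n where n: "(\<integral>x. cmod (\<psi> x - T n x) \<partial>freq) < e / 2"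
    by (auto simp: eventually_sequentially)
  have bound: "cmod (T n x) \<le> real n + 1" for x
    by (simp add: T_def)
  obtain p where p: "trig_poly p" "(\<integral>x. cmod (T n x - p x) \<partial>freq) < e / 2"
    using trig_poly_dense_bounded[of "T n" "real n + 1" "e / 2"] e bound by auto
  have int: "integrable freq (T n)" "integrable freq p"
    using integrable_bounded_freq[of "T n" "real n + 1"] bound trig_poly_integrable[OF p(1)]
    by auto
  have "(\<integral>x. cmod (\<psi> x - p x) \<partial>freq) \<le> (\<integral>x. cmod (\<psi> x - T n x) + cmod (T n x - p x) \<partial>freq)"
  proof (rule integral_mono)
    fix x
    show "cmod (\<psi> x - p x) \<le> cmod (\<psi> x - T n x) + cmod (T n x - p x)"
      using norm_triangle_ineq[of "\<psi> x - T n x" "T n x - p x"] by simp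
  qed (use int \<psi> in auto)
  also have "\<dots> < e"
    using int \<psi> n p(2) by (subst Bochner_Integration.integral_add) auto
  finally show thesis
    using that p(1) by auto
qed

section \<open>Fejer means\<close>

definition fcoeff :: "(real \<Rightarrow> complex) \<Rightarrow> int \<Rightarrow> complex" where
  "fcoeff \<psi> j = 1 / (2 * pi) * (\<integral>x. \<psi> x * mode (- j) x \<partial>freq)"

definition fejer_kernel :: "nat \<Rightarrow> real \<Rightarrow> real" where
  "fejer_kernel N u = (cmod (\<Sum>k<N. cis (u * real k)))\<^sup>2 / real N"

text \<open>The average of the first \<open>N\<close> partial sums of the Fourier series, written as a double sum over
  the indices of the kernel \<open>\<bar>\<Sum>k<N. e\<^bsup>i k u\<^esup>\<bar>\<^sup>2 / N\<close>; in this form positivity and the passage to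
  kernels need no counting of multiplicities.\<close>

definition fejer_mean :: "nat \<Rightarrow> (real \<Rightarrow> complex) \<Rightarrow> real \<Rightarrow> complex" where
  "fejer_mean N \<psi> x =
     (\<Sum>j<N. \<Sum>k<N. fcoeff \<psi> (int j - int k) * mode (int j - int k) x) / of_nat N"

lemma fcoeff_add:
  assumes "integrable freq u" "integrable freq v"
  shows "fcoeff (\<lambda>x. u x + v x) j = fcoeff u j + fcoeff v j"
  unfolding fcoeff_def distrib_right
  by (subst Bochner_Integration.integral_add) (intro integrable_mult_cis assms | rule distrib_left)+

lemma fcoeff_diff:
  assumes "integrable freq u" "integrable freq v"
  shows "fcoeff (\<lambda>x. u x - v x) j = fcoeff u j - fcoeff v j"
  unfolding fcoeff_def left_diff_distrib
  by (subst Bochner_Integration.integral_diff) (intro integrable_mult_cis assms | rule right_diff_distrib)+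

lemma fcoeff_cmult: "fcoeff (\<lambda>x. c * u x) j = c * fcoeff u j"
  by (simp add: fcoeff_def mult.assoc)

lemma fcoeff_mode: "fcoeff (mode m) j = (if j = m then 1 else 0)"
proof -
  have "mode m x * mode (- j) x = mode (m - j) x" for x
    by (simp add: cis_mult algebra_simps)
  then show ?thesis
    using integral_mode[of "m - j"] by (simp add: fcoeff_def del: of_int_diff of_int_minus)
qed

lemma cmod_poly_squared:
  "complex_of_real ((cmod (\<Sum>k<N. c k * cis (x * real k)))\<^sup>2) =
     (\<Sum>j<N. \<Sum>k<N. c k * cnj (c j) * cis (x * (real k - real j)))"
proof -
  have "complex_of_real ((cmod z)\<^sup>2) = cnj z * z" for z
    using complex_norm_square[of z] by (simp add: mult.commute)
  then have "complex_of_real ((cmod (\<Sum>k<N. c k * cis (x * real k)))\<^sup>2) =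
      (\<Sum>j<N. cnj (c j) * cis (- (x * real j))) * (\<Sum>k<N. c k * cis (x * real k))"
    by (simp only: cnj_sum complex_cnj_mult cis_cnj)
  also have "\<dots> = (\<Sum>j<N. \<Sum>k<N. cnj (c j) * cis (- (x * real j)) * (c k * cis (x * real k)))"
    by (rule sum_product)
  also have "\<dots> = (\<Sum>j<N. \<Sum>k<N. c k * cnj (c j) * cis (x * (real k - real j)))"
  proof (intro sum.cong refl)
    fix j k
    have "cis (x * (real k - real j)) = cis (- (x * real j)) * cis (x * real k)"
      by (simp add: cis_mult right_diff_distrib)
    then show "cnj (c j) * cis (- (x * real j)) * (c k * cis (x * real k)) =
        c k * cnj (c j) * cis (x * (real k - real j))"
      by simp
  qed
  finally show ?thesis .
qed

lemma fejer_kernel_bound: "fejer_kernel N u \<le> real N"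
proof -
  have "cmod (\<Sum>k<N. cis (u * real k)) \<le> real N"
    using norm_sum[of "\<lambda>k. cis (u * real k)" "{..<N}"] by simp
  then have "(cmod (\<Sum>k<N. cis (u * real k)))\<^sup>2 \<le> real N * real N"
    unfolding power2_eq_square by (intro mult_mono) auto
  then show ?thesis
    by (cases "N = 0") (auto simp: fejer_kernel_def field_simps)
qed

lemma fejer_kernel_nonneg [simp]: "0 \<le> fejer_kernel N u"
  by (simp add: fejer_kernel_def)

lemma fejer_kernel_minus: "fejer_kernel N (- u) = fejer_kernel N u"
proof -
  have "(\<Sum>k<N. cis (- u * real k)) = cnj (\<Sum>k<N. cis (u * real k))"
    by (simp add: cis_cnj)
  then show ?thesis
    unfolding fejer_kernel_def by (metis complex_mod_cnj)
qed

lemma fejer_kernel_measurable [measurable]: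
  "(\<lambda>y. fejer_kernel N (x - y)) \<in> borel_measurable freq"
  unfolding fejer_kernel_def divide_inverse by (intro continuous_measurable_freq continuous_intros)

lemma fejer_mean_integral:
  fixes \<psi> :: "real \<Rightarrow> complex"
  assumes "integrable freq \<psi>"
  shows "fejer_mean N \<psi> x = 1 / (2 * pi) * (\<integral>y. \<psi> y * of_real (fejer_kernel N (x - y)) \<partial>freq)"
proof -
  have 1: "of_real (fejer_kernel N (x - y)) =
      (\<Sum>j<N. \<Sum>k<N. mode (int j - int k) x * mode (- (int j - int k)) y) / of_nat N" for y
  proof -
    have "cis ((x - y) * (real k - real j)) = mode (int k - int j) x * mode (- (int k - int j)) y" for j k
      by (simp add: cis_mult algebra_simps)
    then have "complex_of_real ((cmod (\<Sum>k<N. cis ((x - y) * real k)))\<^sup>2) =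
        (\<Sum>j<N. \<Sum>k<N. mode (int k - int j) x * mode (- (int k - int j)) y)"
      using cmod_poly_squared[of "\<lambda>_. 1" "x - y" N] by simp
    also have "\<dots> = (\<Sum>j<N. \<Sum>k<N. mode (int j - int k) x * mode (- (int j - int k)) y)"
      by (rule sum.swap)
    finally show ?thesis
      unfolding fejer_kernel_def of_real_divide of_real_of_nat_eq by (rule arg_cong)
  qed
  have ring: "a * b * c / d = a * (c / d * b)" for a b c d :: complex
    by simp
  have "(\<integral>y. \<psi> y * of_real (fejer_kernel N (x - y)) \<partial>freq) =
     (\<integral>y. (\<Sum>j<N. \<Sum>k<N. mode (int j - int k) x / of_nat N * (\<psi> y * mode (- (int j - int k)) y)) \<partial>freq)"
  proof (rule Bochner_Integration.integral_cong[OF refl])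
    fix y
    have "\<psi> y * (u * v) / n = u / n * (\<psi> y * v)" for u v n
      by simp
    then show "\<psi> y * of_real (fejer_kernel N (x - y)) =
        (\<Sum>j<N. \<Sum>k<N. mode (int j - int k) x / of_nat N * (\<psi> y * mode (- (int j - int k)) y))"
      unfolding 1 times_divide_eq_right sum_distrib_left sum_divide_distrib
      by (intro sum.cong refl)
  qed
  also have "\<dots> = (\<Sum>j<N. \<Sum>k<N. mode (int j - int k) x / of_nat N *
      (\<integral>y. \<psi> y * mode (- (int j - int k)) y \<partial>freq))"
  proof -
    have "integrable freq (\<lambda>y. c * (\<psi> y * cis (y * r)))" for c r
      using integrable_mult_cis[OF assms] by simp
    then show ?thesis
      by (simp only: Bochner_Integration.integral_sum Bochner_Integration.integrable_sum integral_mult_right_zero)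
  qed
  finally have eq: "(\<integral>y. \<psi> y * of_real (fejer_kernel N (x - y)) \<partial>freq) =
    (\<Sum>j<N. \<Sum>k<N. mode (int j - int k) x / of_nat N *
      (\<integral>y. \<psi> y * mode (- (int j - int k)) y \<partial>freq))" .
  show ?thesis
    unfolding fejer_mean_def fcoeff_def eq sum_distrib_left sum_divide_distrib
    by (intro sum.cong refl) (rule ring)
qed

lemma fejer_mean_mode:
  assumes "0 < N"
  shows "cmod (fejer_mean N (mode m) x - mode m x) \<le> real_of_int \<bar>m\<bar> / real N"
proof -
  \<comment> \<open>the indices \<open>k\<close> without a partner \<open>j = k + m\<close> below \<open>N\<close>; there are at most \<open>\<bar>m\<bar>\<close> of them\<close>
  define D where "D = {k \<in> {..<N}. \<not> (0 \<le> int k + m \<and> int k + m < int N)}"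
  have inner: "(\<Sum>j<N. fcoeff (mode m) (int j - int k) * mode (int j - int k) x) =
      (if k \<in> D then 0 else mode m x)" if "k < N" for k
  proof -
    have "(\<Sum>j<N. fcoeff (mode m) (int j - int k) * mode (int j - int k) x) =
        (\<Sum>j<N. if int j = int k + m then mode m x else 0)"
      by (intro sum.cong) (auto simp: fcoeff_mode simp del: of_int_diff)
    also have "\<dots> = (if k \<in> D then 0 else mode m x)"
    proof (cases "0 \<le> int k + m")
      case True
      have "int j = int k + m \<longleftrightarrow> nat (int k + m) = j" for j
        using True by auto
      then show ?thesis
        using True that by (auto simp: D_def)
    next
      case False
      then have "int j \<noteq> int k + m" for j
        by auto
      with False that show ?thesis
        by (auto simp: D_def)
    qed
    finally show ?thesis .
  qed
  have "fejer_mean N (mode m) x - mode m x = - (\<Sum>k<N. if k \<in> D then mode m x else 0) / of_nat N"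
  proof -
    have "fejer_mean N (mode m) x = (\<Sum>k<N. if k \<in> D then 0 else mode m x) / of_nat N"
      unfolding fejer_mean_def by (subst sum.swap) (simp add: inner del: of_int_diff)
    moreover have "mode m x = (\<Sum>k<N. mode m x) / of_nat N"
      using assms by simp
    ultimately have "fejer_mean N (mode m) x - mode m x =
        (\<Sum>k<N. (if k \<in> D then 0 else mode m x) - mode m x) / of_nat N"
      by (simp only: sum_subtractf diff_divide_distrib)
    also have "(\<Sum>k<N. (if k \<in> D then 0 else mode m x) - mode m x) =
        (\<Sum>k<N. - (if k \<in> D then mode m x else 0))"
      by (intro sum.cong) auto
    finally show ?thesis by (simp add: sum_negf)
  qed
  then have eq: "fejer_mean N (mode m) x - mode m x = - (of_nat (card D) * mode m x) / of_nat N"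
    by (simp add: sum.If_cases D_def Int_def)
  have "int (card D) \<le> \<bar>m\<bar>"
  proof (cases "0 \<le> m")
    case True
    then have "D \<subseteq> {N - nat m..<N}"
      by (auto simp: D_def)
    then have "card D \<le> N - (N - nat m)"
      using card_mono[of "{N - nat m..<N}" D] by simp
    then show ?thesis using True by linarith
  next
    case False
    then have "D \<subseteq> {..<nat (- m)}"
      by (auto simp: D_def)
    then have "card D \<le> nat (- m)"
      using card_mono[of "{..<nat (- m)}" D] by simp
    then show ?thesis using False by linarith
  qed
  then have "real (card D) \<le> real_of_int \<bar>m\<bar>"
    by linarith
  then show ?thesis
    unfolding eq using assms by (simp add: norm_divide norm_mult divide_right_mono)
qed

lemma fejer_kernel_mass:
  assumes "0 < N"
  shows "(\<integral>y. fejer_kernel N (x - y) \<partial>freq) = 2 * pi"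
proof -
  have "fejer_mean N (\<lambda>_. 1) x = 1"
    using fejer_mean_mode[OF assms, of 0 x] by simp
  then have "complex_of_real (\<integral>y. fejer_kernel N (x - y) \<partial>freq) = of_real (2 * pi)"
    using fejer_mean_integral[of "\<lambda>_. 1" N x] by (simp add: field_simps)
  then show ?thesis
    using of_real_eq_iff by blast
qed

lemma fejer_kernel_integrable [simp]: "integrable freq (\<lambda>y. fejer_kernel N (x - y))"
  by (rule freq.integrable_const_bound[where B = "real N"]) (auto simp: fejer_kernel_bound)

lemma fejer_mean_norm_le:
  assumes "integrable freq \<psi>"
  shows "cmod (fejer_mean N \<psi> x) \<le> 1 / (2 * pi) * (\<integral>y. cmod (\<psi> y) * fejer_kernel N (x - y) \<partial>freq)"
proof -
  have "cmod (\<integral>y. \<psi> y * of_real (fejer_kernel N (x - y)) \<partial>freq) \<le>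
      (\<integral>y. cmod (\<psi> y * of_real (fejer_kernel N (x - y))) \<partial>freq)"
    by (rule integral_norm_bound)
  then show ?thesis
    unfolding fejer_mean_integral[OF assms]
    by (simp add: norm_mult norm_divide divide_right_mono)
qed

lemma integrable_mult_fejer_kernel:
  assumes "integrable freq \<psi>"
  shows "integrable freq (\<lambda>y. cmod (\<psi> y) * fejer_kernel N (x - y))"
proof -
  have "integrable freq (\<lambda>y. \<psi> y * of_real (fejer_kernel N (x - y)))"
    using assms by (rule integrable_mult_bounded[where B = "real N"]) (auto simp: fejer_kernel_bound)
  from integrable_norm[OF this] show ?thesis
    by (simp add: norm_mult)
qed

lemma fejer_mean_bounded:
  assumes \<psi>: "integrable freq \<psi>" and B: "AE x in freq. cmod (\<psi> x) \<le> B" and N: "0 < N"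
  shows "cmod (fejer_mean N \<psi> x) \<le> B"
proof -
  have "(\<integral>y. cmod (\<psi> y) * fejer_kernel N (x - y) \<partial>freq) \<le> (\<integral>y. B * fejer_kernel N (x - y) \<partial>freq)"
    using B by (intro integral_mono_AE integrable_mult_fejer_kernel \<psi>)
      (auto elim!: eventually_mono intro!: mult_right_mono)
  then have "(\<integral>y. cmod (\<psi> y) * fejer_kernel N (x - y) \<partial>freq) \<le> B * (2 * pi)"
    by (simp add: fejer_kernel_mass[OF N])
  then show ?thesis
    using fejer_mean_norm_le[OF \<psi>, of N x] divide_right_mono[of _ "B * (2 * pi)" "2 * pi"]
    by (force intro: order_trans)
qed

lemma fejer_mean_integrable [simp]: "integrable freq (fejer_mean N \<psi>)"
  unfolding fejer_mean_def[abs_def] by (simp del: of_int_diff)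

text \<open>The kernel is nonnegative with mass \<open>2 \<pi>\<close> in either variable, so the bound is Fubini's theorem.\<close>

lemma fejer_mean_L1_contraction:
  assumes \<psi>: "integrable freq \<psi>" and N: "0 < N"
  shows "(\<integral>x. cmod (fejer_mean N \<psi> x) \<partial>freq) \<le> (\<integral>x. cmod (\<psi> x) \<partial>freq)"
proof -
  have [measurable]: "\<psi> \<in> borel_measurable freq" using \<psi> by simp
  interpret pair_sigma_finite freq freq ..
  have [measurable]: "(\<lambda>(x, y). fejer_kernel N (x - y)) \<in> borel_measurable (freq \<Otimes>\<^sub>M freq)"
  proof -
    have eq: "(\<lambda>(x, y). fejer_kernel N (x - y)) =
       (\<lambda>z. (cmod (\<Sum>k<N. cis (fst z * real k) * cis (snd z * - real k)))\<^sup>2 / real N)"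
      by (auto simp: fun_eq_iff fejer_kernel_def cis_mult algebra_simps)
    show ?thesis unfolding eq by measurable
  qed
  have "(\<integral>\<^sup>+x. ennreal (cmod (fejer_mean N \<psi> x)) \<partial>freq)
      \<le> (\<integral>\<^sup>+x. ennreal (1 / (2 * pi)) * (\<integral>\<^sup>+y. ennreal (cmod (\<psi> y) * fejer_kernel N (x - y)) \<partial>freq) \<partial>freq)"
  proof (rule nn_integral_mono)
    fix x
    have "ennreal (cmod (fejer_mean N \<psi> x)) \<le>
        ennreal (1 / (2 * pi) * (\<integral>y. cmod (\<psi> y) * fejer_kernel N (x - y) \<partial>freq))"
      using fejer_mean_norm_le[OF \<psi>] by (rule ennreal_leI)
    also have "\<dots> = ennreal (1 / (2 * pi)) * (\<integral>\<^sup>+y. ennreal (cmod (\<psi> y) * fejer_kernel N (x - y)) \<partial>freq)"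
      by (subst nn_integral_eq_integral[OF integrable_mult_fejer_kernel[OF \<psi>]])
         (auto simp flip: ennreal_mult')
    finally show "ennreal (cmod (fejer_mean N \<psi> x)) \<le>
       ennreal (1 / (2 * pi)) * (\<integral>\<^sup>+y. ennreal (cmod (\<psi> y) * fejer_kernel N (x - y)) \<partial>freq)" .
  qed
  also have "\<dots> = ennreal (1 / (2 * pi)) *
      (\<integral>\<^sup>+x. (\<integral>\<^sup>+y. ennreal (cmod (\<psi> y) * fejer_kernel N (x - y)) \<partial>freq) \<partial>freq)"
    by (rule nn_integral_cmult) measurable
  also have "(\<integral>\<^sup>+x. (\<integral>\<^sup>+y. ennreal (cmod (\<psi> y) * fejer_kernel N (x - y)) \<partial>freq) \<partial>freq) =
      (\<integral>\<^sup>+y. (\<integral>\<^sup>+x. ennreal (cmod (\<psi> y) * fejer_kernel N (x - y)) \<partial>freq) \<partial>freq)"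
    by (rule Fubini') measurable
  also have "\<dots> = (\<integral>\<^sup>+y. ennreal (cmod (\<psi> y)) * ennreal (2 * pi) \<partial>freq)"
  proof (rule nn_integral_cong)
    fix y
    have eq: "fejer_kernel N (x - y) = fejer_kernel N (y - x)" for x
      using fejer_kernel_minus[of N "y - x"] by simp
    have "(\<integral>\<^sup>+x. ennreal (fejer_kernel N (x - y)) \<partial>freq) = ennreal (2 * pi)"
      unfolding eq by (subst nn_integral_eq_integral) (auto simp: fejer_kernel_mass[OF N])
    then show "(\<integral>\<^sup>+x. ennreal (cmod (\<psi> y) * fejer_kernel N (x - y)) \<partial>freq) = ennreal (cmod (\<psi> y)) * ennreal (2 * pi)"
      by (simp add: ennreal_mult nn_integral_cmult eq)
  qed
  also have "ennreal (1 / (2 * pi)) * \<dots> = (\<integral>\<^sup>+y. ennreal (cmod (\<psi> y)) \<partial>freq)"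
    by (subst nn_integral_cmult[symmetric]) (auto simp: ennreal_mult[symmetric])
  finally have "ennreal (\<integral>x. cmod (fejer_mean N \<psi> x) \<partial>freq) \<le> ennreal (\<integral>x. cmod (\<psi> x) \<partial>freq)"
    using \<psi> by (simp add: nn_integral_eq_integral)
  then show ?thesis
    by simp
qed

lemma fejer_mean_add:
  "integrable freq u \<Longrightarrow> integrable freq v \<Longrightarrow>
     fejer_mean N (\<lambda>x. u x + v x) x = fejer_mean N u x + fejer_mean N v x"
  by (simp add: fejer_mean_def fcoeff_add distrib_right sum.distrib add_divide_distrib)

lemma fejer_mean_diff:
  "integrable freq u \<Longrightarrow> integrable freq v \<Longrightarrow>
     fejer_mean N (\<lambda>x. u x - v x) x = fejer_mean N u x - fejer_mean N v x"
  by (simp add: fejer_mean_def fcoeff_diff left_diff_distrib sum_subtractf diff_divide_distrib)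

lemma fejer_mean_cmult: "fejer_mean N (\<lambda>x. c * u x) x = c * fejer_mean N u x"
  by (simp add: fejer_mean_def fcoeff_cmult sum_distrib_left mult.assoc)

lemma fejer_mean_trig_poly:
  assumes "trig_poly p"
  shows "(\<lambda>N. \<integral>x. cmod (fejer_mean N p x - p x) \<partial>freq) \<longlonglongrightarrow> 0"
  using assms
proof (induction rule: trig_poly.induct)
  case (mode c m)
  show ?case
  proof (rule Lim_null_comparison)
    show "(\<lambda>N. (cmod c * real_of_int \<bar>m\<bar> * (2 * pi)) / real N) \<longlonglongrightarrow> 0"
      by (rule lim_const_over_n)
    show "\<forall>\<^sub>F N in sequentially. norm (\<integral>x. cmod (fejer_mean N (\<lambda>x. c * mode m x) x - c * mode m x) \<partial>freq)
       \<le> (cmod c * real_of_int \<bar>m\<bar> * (2 * pi)) / real N"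
      using eventually_gt_at_top[of 0]
    proof eventually_elim
      case (elim N)
      have "(\<integral>x. cmod (fejer_mean N (\<lambda>x. c * mode m x) x - c * mode m x) \<partial>freq) \<le>
         (\<integral>x. cmod c * real_of_int \<bar>m\<bar> / real N \<partial>freq)"
      proof (rule integral_mono)
        fix x
        have "cmod (fejer_mean N (\<lambda>x. c * mode m x) x - c * mode m x) =
            cmod c * cmod (fejer_mean N (mode m) x - mode m x)"
          unfolding fejer_mean_cmult right_diff_distrib[symmetric] norm_mult ..
        also have "\<dots> \<le> cmod c * (real_of_int \<bar>m\<bar> / real N)"
          by (intro mult_left_mono fejer_mean_mode elim) auto
        finally show "cmod (fejer_mean N (\<lambda>x. c * mode m x) x - c * mode m x)
            \<le> cmod c * real_of_int \<bar>m\<bar> / real N" by simp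
      qed auto
      then show ?case
        by (simp add: measure_freq mult_ac)
    qed
  qed
next
  case (add p q)
  note int = trig_poly_integrable[OF add.hyps(1)] trig_poly_integrable[OF add.hyps(2)]
  show ?case
  proof (rule Lim_null_comparison)
    show "(\<lambda>N. (\<integral>x. cmod (fejer_mean N p x - p x) \<partial>freq) + (\<integral>x. cmod (fejer_mean N q x - q x) \<partial>freq)) \<longlonglongrightarrow> 0"
      using tendsto_add[OF add.IH] by simp
    show "\<forall>\<^sub>F N in sequentially. norm (\<integral>x. cmod (fejer_mean N (\<lambda>x. p x + q x) x - (p x + q x)) \<partial>freq)
       \<le> (\<integral>x. cmod (fejer_mean N p x - p x) \<partial>freq) + (\<integral>x. cmod (fejer_mean N q x - q x) \<partial>freq)"
    proof (rule always_eventually, rule allI)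
      fix N
      have "(\<integral>x. cmod (fejer_mean N (\<lambda>x. p x + q x) x - (p x + q x)) \<partial>freq)
         \<le> (\<integral>x. cmod (fejer_mean N p x - p x) + cmod (fejer_mean N q x - q x) \<partial>freq)"
        by (rule integral_mono)
           (auto simp: fejer_mean_add int intro!: norm_diff_triangle_ineq)
      then show "norm (\<integral>x. cmod (fejer_mean N (\<lambda>x. p x + q x) x - (p x + q x)) \<partial>freq)
       \<le> (\<integral>x. cmod (fejer_mean N p x - p x) \<partial>freq) + (\<integral>x. cmod (fejer_mean N q x - q x) \<partial>freq)"
        using int by (simp add: Bochner_Integration.integral_add)
    qed
  qed
qed

text \<open>The means of a trigonometric polynomial converge by inspection; the contraction property
  carries this over to the closure of the trigonometric polynomials, which is everything.\<close>

lemma fejer_mean_L1: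
  assumes \<psi>: "integrable freq \<psi>"
  shows "(\<lambda>N. \<integral>x. cmod (fejer_mean N \<psi> x - \<psi> x) \<partial>freq) \<longlonglongrightarrow> 0"
proof (rule tendstoI)
  fix e :: real assume e: "0 < e"
  obtain p where p: "trig_poly p" "(\<integral>x. cmod (\<psi> x - p x) \<partial>freq) < e / 3"
    using trig_poly_dense_L1[OF \<psi>, of "e / 3"] e by auto
  note pint = trig_poly_integrable[OF p(1)]
  have "\<forall>\<^sub>F N in sequentially. (\<integral>x. cmod (fejer_mean N p x - p x) \<partial>freq) < e / 3"
    using e by (intro order_tendstoD(2)[OF fejer_mean_trig_poly[OF p(1)]]) auto
  then show "\<forall>\<^sub>F N in sequentially. dist (\<integral>x. cmod (fejer_mean N \<psi> x - \<psi> x) \<partial>freq) 0 < e"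
    using eventually_gt_at_top[of 0]
  proof eventually_elim
    case (elim N)
    have "(\<integral>x. cmod (fejer_mean N \<psi> x - \<psi> x) \<partial>freq) \<le>
       (\<integral>x. cmod (fejer_mean N (\<lambda>x. \<psi> x - p x) x) + cmod (fejer_mean N p x - p x) + cmod (\<psi> x - p x) \<partial>freq)"
    proof (rule integral_mono)
      fix x
      have eq: "fejer_mean N \<psi> x - \<psi> x =
         fejer_mean N (\<lambda>x. \<psi> x - p x) x + (fejer_mean N p x - p x) - (\<psi> x - p x)"
        using \<psi> pint by (simp add: fejer_mean_diff)
      show "cmod (fejer_mean N \<psi> x - \<psi> x) \<le> cmod (fejer_mean N (\<lambda>x. \<psi> x - p x) x)
          + cmod (fejer_mean N p x - p x) + cmod (\<psi> x - p x)"
        unfolding eq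
        using norm_triangle_ineq4[of "fejer_mean N (\<lambda>x. \<psi> x - p x) x + (fejer_mean N p x - p x)" "\<psi> x - p x"]
          norm_triangle_ineq[of "fejer_mean N (\<lambda>x. \<psi> x - p x) x" "fejer_mean N p x - p x"]
        by linarith
    qed (use \<psi> pint in auto)
    also have "\<dots> = (\<integral>x. cmod (fejer_mean N (\<lambda>x. \<psi> x - p x) x) \<partial>freq) +
        (\<integral>x. cmod (fejer_mean N p x - p x) \<partial>freq) + (\<integral>x. cmod (\<psi> x - p x) \<partial>freq)"
      using \<psi> pint by (simp add: Bochner_Integration.integral_add)
    also have "\<dots> < e"
      using fejer_mean_L1_contraction[of "\<lambda>x. \<psi> x - p x" N] elim p(2) \<psi> pint by simp
    finally show ?case by simp
  qed
qed

corollary fejer_mean_AE_subseq: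
  assumes "integrable freq \<psi>"
  obtains r :: "nat \<Rightarrow> nat" where "strict_mono r" "AE x in freq. (\<lambda>n. fejer_mean (r n) \<psi> x) \<longlonglongrightarrow> \<psi> x"
proof -
  obtain r :: "nat \<Rightarrow> nat" where r: "strict_mono r"
    "AE x in freq. (\<lambda>n. fejer_mean (r n) \<psi> x - \<psi> x) \<longlonglongrightarrow> 0"
    using tendsto_L1_AE_subseq[OF _ fejer_mean_L1[OF assms]] assms by auto
  then show thesis
    using that by (simp add: LIM_zero_iff)
qed

section \<open>Square integrable functions\<close>

text \<open>As a function of \<open>y\<close> the Fejer kernel \<open>K\<^sub>N (x - y)\<close> is the square of the modulus of an analytic
  polynomial. The hypothesis thus says that the Fejer means of \<open>\<psi>\<close> are nonnegative, and they
  approximate \<open>\<psi>\<close>.\<close>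

lemma AE_nonneg_of_quadratic_form:
  fixes \<psi> :: "real \<Rightarrow> real"
  assumes \<psi>: "integrable freq \<psi>"
    and pos: "\<And>N c. 0 \<le> (\<integral>x. \<psi> x * (cmod (\<Sum>k<N. c k * cis (x * real k)))\<^sup>2 \<partial>freq)"
  shows "AE x in freq. 0 \<le> \<psi> x"
proof -
  have Re_nonneg: "0 \<le> Re (fejer_mean N (\<lambda>x. of_real (\<psi> x)) x)" for N x
  proof -
    have eq: "fejer_kernel N (x - y) = (cmod (\<Sum>k<N. cis (- (x * real k)) * cis (y * real k)))\<^sup>2 / real N" for y
    proof -
      have "fejer_kernel N (x - y) = fejer_kernel N (y - x)"
        using fejer_kernel_minus[of N "y - x"] by simp
      then show ?thesis
        by (simp add: fejer_kernel_def cis_mult left_diff_distrib)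
    qed
    have "(\<integral>y. of_real (\<psi> y) * of_real (fejer_kernel N (x - y)) \<partial>freq) =
        complex_of_real (\<integral>y. \<psi> y * fejer_kernel N (x - y) \<partial>freq)"
      by (simp flip: of_real_mult)
    moreover have "(\<integral>y. \<psi> y * fejer_kernel N (x - y) \<partial>freq) =
        (\<integral>y. \<psi> y * (cmod (\<Sum>k<N. cis (- (x * real k)) * cis (y * real k)))\<^sup>2 \<partial>freq) / real N"
      unfolding eq by simp
    ultimately show ?thesis
      using \<psi> pos[of "\<lambda>k. cis (- (x * real k))" N] by (subst fejer_mean_integral) auto
  qed
  obtain r :: "nat \<Rightarrow> nat" where
    lim: "AE x in freq. (\<lambda>n. fejer_mean (r n) (\<lambda>x. of_real (\<psi> x)) x) \<longlonglongrightarrow> complex_of_real (\<psi> x)"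
    using \<psi> by (rule fejer_mean_AE_subseq[of "\<lambda>x. complex_of_real (\<psi> x)", OF integrable_of_real])
  from lim show ?thesis
  proof eventually_elim
    case (elim x)
    from tendsto_Re[OF elim] have "(\<lambda>n. Re (fejer_mean (r n) (\<lambda>x. of_real (\<psi> x)) x)) \<longlonglongrightarrow> \<psi> x"
      by simp
    then show ?case
      by (rule LIMSEQ_le_const) (use Re_nonneg in blast)
  qed
qed

definition square_integrable :: "(real \<Rightarrow> complex) \<Rightarrow> bool" where
  "square_integrable u \<longleftrightarrow> u \<in> borel_measurable freq \<and> integrable freq (\<lambda>x. (cmod (u x))\<^sup>2)"

lemma square_integrable_measurable: "square_integrable u \<Longrightarrow> u \<in> borel_measurable freq"
  by (simp add: square_integrable_def)

lemma square_integrable_norm: "square_integrable u \<Longrightarrow> integrable freq (\<lambda>x. (cmod (u x))\<^sup>2)"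
  by (simp add: square_integrable_def)

lemma square_integrable_mult:
  assumes "square_integrable u" "square_integrable v"
  shows "integrable freq (\<lambda>x. u x * v x)"
proof (rule Bochner_Integration.integrable_bound)
  show "integrable freq (\<lambda>x. (cmod (u x))\<^sup>2 + (cmod (v x))\<^sup>2)"
    using assms by (simp add: square_integrable_def)
  show "(\<lambda>x. u x * v x) \<in> borel_measurable freq"
    using assms[THEN square_integrable_measurable] by measurable
  have "cmod (u x * v x) \<le> (cmod (u x))\<^sup>2 + (cmod (v x))\<^sup>2" for x
  proof -
    have "0 \<le> cmod (u x) * cmod (v x)" "2 * (cmod (u x) * cmod (v x)) \<le> (cmod (u x))\<^sup>2 + (cmod (v x))\<^sup>2"
      using sum_squares_bound[of "cmod (u x)" "cmod (v x)"] by auto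
    then show ?thesis unfolding norm_mult by linarith
  qed
  then show "AE x in freq. norm (u x * v x) \<le> norm ((cmod (u x))\<^sup>2 + (cmod (v x))\<^sup>2)"
    by (intro AE_I2) (auto intro: order_trans[OF _ abs_ge_self])
qed

lemma square_integrable_cnj: "square_integrable u \<Longrightarrow> square_integrable (\<lambda>x. cnj (u x))"
  unfolding square_integrable_def complex_mod_cnj
  by (auto intro: borel_measurable_continuous_on[OF continuous_on_cnj[OF continuous_on_id]])

lemma square_integrable_add:
  assumes "square_integrable u" "square_integrable v"
  shows "square_integrable (\<lambda>x. u x + v x)"
  unfolding square_integrable_def
proof
  show m: "(\<lambda>x. u x + v x) \<in> borel_measurable freq"
    using assms[THEN square_integrable_measurable] by measurable
  show "integrable freq (\<lambda>x. (cmod (u x + v x))\<^sup>2)"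
  proof (rule Bochner_Integration.integrable_bound)
    show "integrable freq (\<lambda>x. 2 * (cmod (u x))\<^sup>2 + 2 * (cmod (v x))\<^sup>2)"
      using assms by (simp add: square_integrable_def)
    show "(\<lambda>x. (cmod (u x + v x))\<^sup>2) \<in> borel_measurable freq"
      using m by measurable
    have "(cmod (u x + v x))\<^sup>2 \<le> 2 * (cmod (u x))\<^sup>2 + 2 * (cmod (v x))\<^sup>2" for x
    proof -
      have "(cmod (u x + v x))\<^sup>2 \<le> (cmod (u x) + cmod (v x))\<^sup>2"
        by (intro power_mono norm_triangle_ineq) auto
      also have "\<dots> \<le> 2 * (cmod (u x))\<^sup>2 + 2 * (cmod (v x))\<^sup>2"
        using sum_squares_bound[of "cmod (u x)" "cmod (v x)"] by (simp add: power2_sum)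
      finally show ?thesis .
    qed
    then show "AE x in freq. norm ((cmod (u x + v x))\<^sup>2) \<le> norm (2 * (cmod (u x))\<^sup>2 + 2 * (cmod (v x))\<^sup>2)"
      by (intro AE_I2) (auto intro: order_trans[OF _ abs_ge_self])
  qed
qed

lemma square_integrable_mult_bounded:
  assumes "square_integrable u" "v \<in> borel_measurable freq" "AE x in freq. cmod (v x) \<le> B"
  shows "square_integrable (\<lambda>x. u x * v x)"
  unfolding square_integrable_def
proof
  show m: "(\<lambda>x. u x * v x) \<in> borel_measurable freq"
    using square_integrable_measurable[OF assms(1)] assms(2) by measurable
  show "integrable freq (\<lambda>x. (cmod (u x * v x))\<^sup>2)"
  proof (rule Bochner_Integration.integrable_bound)
    show "integrable freq (\<lambda>x. B\<^sup>2 * (cmod (u x))\<^sup>2)"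
      using assms by (simp add: square_integrable_def)
    show "(\<lambda>x. (cmod (u x * v x))\<^sup>2) \<in> borel_measurable freq"
      using m by measurable
    show "AE x in freq. norm ((cmod (u x * v x))\<^sup>2) \<le> norm (B\<^sup>2 * (cmod (u x))\<^sup>2)"
      using assms(3)
    proof eventually_elim
      case (elim x)
      then have "(cmod (v x))\<^sup>2 \<le> B\<^sup>2"
        by (intro power_mono) auto
      then show ?case
        using mult_left_mono[of "(cmod (v x))\<^sup>2" "B\<^sup>2" "(cmod (u x))\<^sup>2"]
        by (simp add: norm_mult power_mult_distrib mult.commute)
    qed
  qed
qed

lemma square_integrable_bounded:
  assumes "u \<in> borel_measurable freq" "AE x in freq. cmod (u x) \<le> B"
  shows "square_integrable u"
  using square_integrable_mult_bounded[of "\<lambda>_. 1" u B] assms by (simp add: square_integrable_def)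

lemma square_integrable_cmult: "square_integrable u \<Longrightarrow> square_integrable (\<lambda>x. c * u x)"
  by (auto simp: square_integrable_def norm_mult power_mult_distrib)

lemma square_integrable_diff:
  "square_integrable u \<Longrightarrow> square_integrable v \<Longrightarrow> square_integrable (\<lambda>x. u x - v x)"
  using square_integrable_add[of u "\<lambda>x. (-1) * v x"] square_integrable_cmult[of v "-1"] by simp

lemma square_integrable_integrable: "square_integrable u \<Longrightarrow> integrable freq u"
  using square_integrable_mult[of u "\<lambda>_. 1"] by (simp add: square_integrable_def)

lemma square_integrable_cis: "square_integrable (\<lambda>x. c * cis (x * r))"
  by (rule square_integrable_bounded[where B = "cmod c"]) (auto simp: norm_mult)

lemma square_integrable_sum_cis: "square_integrable (\<lambda>x. \<Sum>i\<in>I. c i * cis (x * r i))"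
proof (induction I rule: infinite_finite_induct)
  case (insert i I)
  then show ?case
    using square_integrable_add[OF square_integrable_cis insert.IH] by simp
qed (auto simp: square_integrable_def)

lemma Cauchy_Schwarz_integral:
  fixes u v :: "'b \<Rightarrow> real"
  assumes [measurable]: "u \<in> borel_measurable M" "v \<in> borel_measurable M"
    and u: "integrable M (\<lambda>x. (u x)\<^sup>2)" and v: "integrable M (\<lambda>x. (v x)\<^sup>2)"
  shows "(\<integral>x. \<bar>u x * v x\<bar> \<partial>M) \<le> sqrt (\<integral>x. (u x)\<^sup>2 \<partial>M) * sqrt (\<integral>x. (v x)\<^sup>2 \<partial>M)"
proof -
  have "(\<integral>\<^sup>+x. ennreal \<bar>u x\<bar> * ennreal \<bar>v x\<bar> \<partial>M)\<^sup>2 \<le>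
     (\<integral>\<^sup>+x. (ennreal \<bar>u x\<bar>)\<^sup>2 \<partial>M) * (\<integral>\<^sup>+x. (ennreal \<bar>v x\<bar>)\<^sup>2 \<partial>M)"
    by (rule Cauchy_Schwarz_nn_integral) auto
  also have "\<dots> = ennreal ((\<integral>x. (u x)\<^sup>2 \<partial>M) * (\<integral>x. (v x)\<^sup>2 \<partial>M))"
    using u v by (simp add: ennreal_power nn_integral_eq_integral ennreal_mult)
  finally have *: "(\<integral>\<^sup>+x. ennreal \<bar>u x * v x\<bar> \<partial>M)\<^sup>2 \<le> ennreal ((\<integral>x. (u x)\<^sup>2 \<partial>M) * (\<integral>x. (v x)\<^sup>2 \<partial>M))"
    by (simp add: abs_mult ennreal_mult)
  have "ennreal ((\<integral>x. \<bar>u x * v x\<bar> \<partial>M)\<^sup>2) \<le> ennreal ((\<integral>x. (u x)\<^sup>2 \<partial>M) * (\<integral>x. (v x)\<^sup>2 \<partial>M))"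
  proof (cases "integrable M (\<lambda>x. \<bar>u x * v x\<bar>)")
    case True
    then show ?thesis
      using * by (simp add: nn_integral_eq_integral ennreal_power)
  next
    case False
    then show ?thesis by (simp add: not_integrable_integral_eq)
  qed
  then have "(\<integral>x. \<bar>u x * v x\<bar> \<partial>M)\<^sup>2 \<le> (\<integral>x. (u x)\<^sup>2 \<partial>M) * (\<integral>x. (v x)\<^sup>2 \<partial>M)"
    by (subst (asm) ennreal_le_iff) auto
  then show ?thesis
    by (metis real_le_rsqrt real_sqrt_mult)
qed

lemma Cauchy_Schwarz_square_integrable:
  assumes "square_integrable u" "square_integrable v"
  shows "cmod (\<integral>x. u x * v x \<partial>freq) \<le>
    sqrt (\<integral>x. (cmod (u x))\<^sup>2 \<partial>freq) * sqrt (\<integral>x. (cmod (v x))\<^sup>2 \<partial>freq)"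
proof -
  have [measurable]: "u \<in> borel_measurable freq" "v \<in> borel_measurable freq"
    using assms by (auto simp: square_integrable_def)
  have "cmod (\<integral>x. u x * v x \<partial>freq) \<le> (\<integral>x. \<bar>cmod (u x) * cmod (v x)\<bar> \<partial>freq)"
    using integral_norm_bound[of freq "\<lambda>x. u x * v x"] by (simp add: norm_mult)
  also have "\<dots> \<le> sqrt (\<integral>x. (cmod (u x))\<^sup>2 \<partial>freq) * sqrt (\<integral>x. (cmod (v x))\<^sup>2 \<partial>freq)"
    using assms by (intro Cauchy_Schwarz_integral) (auto simp: square_integrable_def)
  finally show ?thesis .
qed

lemma cmod_diff_squared:
  "(cmod (u - v))\<^sup>2 = (cmod u)\<^sup>2 - 2 * Re (u * cnj v) + (cmod v)\<^sup>2"
  unfolding cmod_power2 by (simp add: power2_eq_square algebra_simps)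

lemma integral_cmod_diff_squared:
  assumes u: "square_integrable u" and v: "square_integrable v"
  shows "(\<integral>x. (cmod (u x - v x))\<^sup>2 \<partial>freq) =
    (\<integral>x. (cmod (u x))\<^sup>2 \<partial>freq) - 2 * Re (\<integral>x. u x * cnj (v x) \<partial>freq) + (\<integral>x. (cmod (v x))\<^sup>2 \<partial>freq)"
proof -
  define w where "w x = u x * cnj (v x)" for x
  have w: "integrable freq w"
    unfolding w_def using u v by (intro square_integrable_mult square_integrable_cnj)
  show ?thesis
    unfolding cmod_diff_squared w_def[symmetric]
    using w square_integrable_norm[OF u] square_integrable_norm[OF v] by simp
qed

lemma integral_inner_modes:
  assumes "integrable freq u" "finite I"
  shows "(\<integral>x. u x * cnj (\<Sum>i\<in>I. c i * mode (\<nu> i) x) \<partial>freq) = 2 * pi * (\<Sum>i\<in>I. cnj (c i) * fcoeff u (\<nu> i))"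
proof -
  have "(\<integral>x. u x * cnj (\<Sum>i\<in>I. c i * mode (\<nu> i) x) \<partial>freq) = (\<integral>x. (\<Sum>i\<in>I. cnj (c i) * (u x * mode (- \<nu> i) x)) \<partial>freq)"
    by (simp add: cis_cnj sum_distrib_left mult.left_commute)
  also have "\<dots> = (\<Sum>i\<in>I. cnj (c i) * (\<integral>x. u x * mode (- \<nu> i) x \<partial>freq))"
    using integrable_mult_cis[OF assms(1)]
    by (subst Bochner_Integration.integral_sum) (auto simp del: of_int_minus)
  finally show ?thesis
    by (simp add: fcoeff_def sum_distrib_left)
qed

lemma parseval_finite:
  assumes "finite I" "inj_on \<nu> I"
  shows "(\<integral>x. (cmod (\<Sum>i\<in>I. c i * mode (\<nu> i) x))\<^sup>2 \<partial>freq) = 2 * pi * (\<Sum>i\<in>I. (cmod (c i))\<^sup>2)"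
proof -
  define u where "u x = (\<Sum>i\<in>I. c i * mode (\<nu> i) x)" for x
  have u: "square_integrable u"
    unfolding u_def by (rule square_integrable_sum_cis)
  have coeff: "fcoeff u (\<nu> i) = c i" if "i \<in> I" for i
  proof -
    have "fcoeff u (\<nu> i) = (\<Sum>j\<in>I. c j * fcoeff (mode (\<nu> j)) (\<nu> i))"
      unfolding u_def
      using assms(1)
    proof (induction I rule: finite_induct)
      case (insert j J)
      then show ?case
        using fcoeff_add[of "\<lambda>x. c j * mode (\<nu> j) x" "\<lambda>x. \<Sum>i\<in>J. c i * mode (\<nu> i) x" "\<nu> i"]
          square_integrable_integrable[OF square_integrable_cis]
          square_integrable_integrable[OF square_integrable_sum_cis]
        by (simp add: fcoeff_cmult)
    qed (simp add: fcoeff_def)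
    also have "\<dots> = (\<Sum>j\<in>I. if j = i then c j else 0)"
      using assms(2) that by (intro sum.cong) (auto simp: fcoeff_mode inj_on_def)
    finally show ?thesis
      using assms(1) that by simp
  qed
  have "complex_of_real (\<integral>x. (cmod (u x))\<^sup>2 \<partial>freq) = (\<integral>x. u x * cnj (u x) \<partial>freq)"
    by (subst integral_complex_of_real[symmetric]) (simp only: complex_norm_square)
  also have "\<dots> = 2 * pi * (\<Sum>i\<in>I. cnj (c i) * fcoeff u (\<nu> i))"
    using integral_inner_modes[OF square_integrable_integrable[OF u] assms(1), of c \<nu>] by (simp add: u_def)
  also have "(\<Sum>i\<in>I. cnj (c i) * fcoeff u (\<nu> i)) = (\<Sum>i\<in>I. complex_of_real ((cmod (c i))\<^sup>2))"
    by (intro sum.cong refl) (simp only: coeff complex_norm_square mult.commute)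
  also have "2 * pi * \<dots> = complex_of_real (2 * pi * (\<Sum>i\<in>I. (cmod (c i))\<^sup>2))"
    by simp
  finally show ?thesis
    unfolding u_def of_real_eq_iff .
qed

lemma bessel:
  assumes u: "square_integrable u" and I: "finite I" "inj_on \<nu> I"
  shows "2 * pi * (\<Sum>i\<in>I. (cmod (fcoeff u (\<nu> i)))\<^sup>2) \<le> (\<integral>x. (cmod (u x))\<^sup>2 \<partial>freq)"
proof -
  define s where "s x = (\<Sum>i\<in>I. fcoeff u (\<nu> i) * mode (\<nu> i) x)" for x
  have s: "square_integrable s"
    unfolding s_def by (rule square_integrable_sum_cis)
  have "(\<integral>x. u x * cnj (s x) \<partial>freq) = 2 * pi * (\<Sum>i\<in>I. cnj (fcoeff u (\<nu> i)) * fcoeff u (\<nu> i))"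
    unfolding s_def by (rule integral_inner_modes[OF square_integrable_integrable[OF u] I(1)])
  also have "\<dots> = complex_of_real (2 * pi * (\<Sum>i\<in>I. (cmod (fcoeff u (\<nu> i)))\<^sup>2))"
    by (simp add: complex_norm_square mult.commute del: of_real_power)
  finally have 1: "(\<integral>x. u x * cnj (s x) \<partial>freq) = complex_of_real (2 * pi * (\<Sum>i\<in>I. (cmod (fcoeff u (\<nu> i)))\<^sup>2))" .
  have 2: "(\<integral>x. (cmod (s x))\<^sup>2 \<partial>freq) = 2 * pi * (\<Sum>i\<in>I. (cmod (fcoeff u (\<nu> i)))\<^sup>2)"
    unfolding s_def by (rule parseval_finite[OF I])
  have "0 \<le> (\<integral>x. (cmod (u x - s x))\<^sup>2 \<partial>freq)"
    by simp
  also have "\<dots> = (\<integral>x. (cmod (u x))\<^sup>2 \<partial>freq) - 2 * Re (\<integral>x. u x * cnj (s x) \<partial>freq) + (\<integral>x. (cmod (s x))\<^sup>2 \<partial>freq)"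
    by (rule integral_cmod_diff_squared[OF u s])
  finally show ?thesis
    unfolding 1 2 by simp
qed

section \<open>Square summable one-sided series\<close>

definition forward_sum :: "(nat \<Rightarrow> complex) \<Rightarrow> nat \<Rightarrow> real \<Rightarrow> complex" where
  "forward_sum c n x = (\<Sum>k<n. c k * cis (x * (real k + 1)))"

text \<open>The remainder \<open>\<Sum>k\<ge>n. \<bar>c\<^sub>k\<bar>\<^sup>2\<close> as a difference, which turns its convergence to zero into the
  convergence of the partial sums.\<close>

definition energy_tail :: "(nat \<Rightarrow> complex) \<Rightarrow> nat \<Rightarrow> real" where
  "energy_tail c n = (\<Sum>k. (cmod (c k))\<^sup>2) - (\<Sum>k<n. (cmod (c k))\<^sup>2)"

lemma square_integrable_forward_sum: "square_integrable (forward_sum c n)"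
  unfolding forward_sum_def by (rule square_integrable_sum_cis)

lemma forward_sum_measurable [measurable]: "forward_sum c n \<in> borel_measurable freq"
  by (rule square_integrable_measurable[OF square_integrable_forward_sum])

lemma ell2_summable: "c \<in> ell2 \<Longrightarrow> summable (\<lambda>k. (cmod (c k))\<^sup>2)"
  by (simp add: ell2_def)

lemma energy_tail_tendsto: "c \<in> ell2 \<Longrightarrow> energy_tail c \<longlonglongrightarrow> 0"
  using tendsto_diff[OF tendsto_const[of "\<Sum>k. (cmod (c k))\<^sup>2"] summable_LIMSEQ[OF ell2_summable[of c]]]
  unfolding energy_tail_def[abs_def] by simp

lemma integral_forward_sum_diff:
  assumes c: "c \<in> ell2" and "n \<le> m"
  shows "(\<integral>x. (cmod (forward_sum c m x - forward_sum c n x))\<^sup>2 \<partial>freq) \<le> 2 * pi * energy_tail c n"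
proof -
  have split: "(\<Sum>k<m. u k) - (\<Sum>k<n. u k) = (\<Sum>k\<in>{n..<m}. u k)" for u :: "nat \<Rightarrow> 'c::ab_group_add"
    using sum.atLeastLessThan_concat[of 0 n m u] assms(2) by (simp add: atLeast0LessThan algebra_simps)
  have "forward_sum c m x - forward_sum c n x = (\<Sum>k\<in>{n..<m}. c k * mode (int k + 1) x)" for x
    unfolding forward_sum_def by (simp add: split)
  then have "(\<integral>x. (cmod (forward_sum c m x - forward_sum c n x))\<^sup>2 \<partial>freq) = 2 * pi * (\<Sum>k\<in>{n..<m}. (cmod (c k))\<^sup>2)"
    using parseval_finite[of "{n..<m}" "\<lambda>k. int k + 1" c] by (simp add: inj_on_def)
  also have "(\<Sum>k\<in>{n..<m}. (cmod (c k))\<^sup>2) \<le> energy_tail c n"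
    unfolding energy_tail_def split[symmetric] using sum_le_suminf[OF ell2_summable[OF c], of "{..<m}"] by simp
  finally show ?thesis by simp
qed

text \<open>Along a subsequence of partial sums whose tails decrease geometrically the increments have a
  finite sum in the mean, so that this subsequence converges almost everywhere. Fatou's lemma
  bounds the distance of the limit to every partial sum.\<close>

lemma riesz_fischer:
  assumes c: "c \<in> ell2"
  shows "\<exists>F. F \<in> borel_measurable freq \<and>
    (\<forall>n. (\<integral>\<^sup>+x. ennreal ((cmod (F x - forward_sum c n x))\<^sup>2) \<partial>freq) \<le> ennreal (2 * pi * energy_tail c n))"
proof -
  have "\<exists>n>m. energy_tail c n < (1/4)^j" for m j
  proof -
    have "eventually (\<lambda>n. energy_tail c n < (1/4)^j) sequentially"
      by (rule order_tendstoD(2)[OF energy_tail_tendsto[OF c]]) simp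
    from eventually_conj[OF this eventually_gt_at_top[of m]] show ?thesis
      by (auto simp: eventually_sequentially)
  qed
  then have "\<exists>r. \<forall>j. energy_tail c (r j) < (1/4)^j \<and> r j < r (Suc j)"
    by (intro dependent_nat_choice) blast+
  then obtain r where r: "\<And>j. energy_tail c (r j) < (1/4)^j" "\<And>j. r j < r (Suc j)"
    by blast
  then have mono: "strict_mono r"
    by (simp add: strict_mono_Suc_iff)
  define S where "S j = forward_sum c (r j)" for j
  have S [measurable]: "S j \<in> borel_measurable freq" for j
    unfolding S_def by measurable
  have d: "(\<integral>x. cmod (S (Suc j) x - S j x) \<partial>freq) \<le> 2 * pi * (1/2)^j"
    and dint: "integrable freq (\<lambda>x. cmod (S (Suc j) x - S j x))" for j
  proof -
    have sq: "square_integrable (\<lambda>x. S (Suc j) x - S j x)"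
      unfolding S_def by (intro square_integrable_diff square_integrable_forward_sum)
    then show "integrable freq (\<lambda>x. cmod (S (Suc j) x - S j x))"
      by (intro integrable_norm square_integrable_integrable)
    have "(\<integral>x. \<bar>cmod (S (Suc j) x - S j x) * 1\<bar> \<partial>freq) \<le>
        sqrt (\<integral>x. (cmod (S (Suc j) x - S j x))\<^sup>2 \<partial>freq) * sqrt (\<integral>x. 1\<^sup>2 \<partial>freq)"
      using square_integrable_norm[OF sq] by (intro Cauchy_Schwarz_integral) auto
    also have "\<dots> \<le> sqrt (2 * pi * (1/4)^j) * sqrt (2 * pi)"
    proof -
      have "(\<integral>x. (cmod (S (Suc j) x - S j x))\<^sup>2 \<partial>freq) \<le> 2 * pi * energy_tail c (r j)"
        unfolding S_def using r(2)[of j] by (intro integral_forward_sum_diff[OF c]) simp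
      also have "\<dots> \<le> 2 * pi * (1/4)^j"
        using r(1)[of j] by simp
      finally show ?thesis
        by (intro mult_mono real_sqrt_le_mono) (auto simp: measure_freq)
    qed
    also have "\<dots> = 2 * pi * (1/2)^j"
    proof -
      have "(1/4::real)^j = ((1/2)^j)\<^sup>2"
        by (simp add: power2_eq_square flip: power_mult_distrib)
      then have "sqrt (2 * pi * (1/4)^j) = sqrt (2 * pi) * (1/2)^j"
        by (simp add: real_sqrt_mult)
      then show ?thesis by simp
    qed
    finally show "(\<integral>x. cmod (S (Suc j) x - S j x) \<partial>freq) \<le> 2 * pi * (1/2)^j" by simp
  qed
  have "(\<integral>\<^sup>+x. (\<Sum>j. ennreal (cmod (S (Suc j) x - S j x))) \<partial>freq) =
      (\<Sum>j. \<integral>\<^sup>+x. ennreal (cmod (S (Suc j) x - S j x)) \<partial>freq)"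
    by (rule nn_integral_suminf) measurable
  also have "\<dots> \<le> (\<Sum>j. ennreal (2 * pi * (1/2)^j))"
    using d dint by (intro suminf_le) (auto simp: nn_integral_eq_integral intro!: ennreal_leI)
  also have "\<dots> = ennreal (\<Sum>j. 2 * pi * (1/2)^j)"
    by (rule suminf_ennreal2) (auto intro!: summable_mult summable_geometric)
  also have "\<dots> < \<infinity>" by simp
  finally have "(\<integral>\<^sup>+x. (\<Sum>j. ennreal (cmod (S (Suc j) x - S j x))) \<partial>freq) \<noteq> \<infinity>"
    by simp
  then have "AE x in freq. (\<Sum>j. ennreal (cmod (S (Suc j) x - S j x))) \<noteq> \<infinity>"
    by (intro nn_integral_noteq_infinite) auto
  then have conv: "AE x in freq. convergent (\<lambda>j. S j x)"
  proof eventually_elim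
    case (elim x)
    then have "summable (\<lambda>j. cmod (S (Suc j) x - S j x))"
      by (intro summable_suminf_not_top) auto
    from summable_norm_cancel[OF this] have "convergent (\<lambda>n. \<Sum>j<n. S (Suc j) x - S j x)"
      by (simp only: summable_iff_convergent)
    then have "convergent (\<lambda>n. S n x - S 0 x)"
      by (simp only: sum_lessThan_telescope[of "\<lambda>j. S j x"])
    then show ?case
      by (simp add: convergent_diff_const_right_iff)
  qed
  define F where "F x = lim (\<lambda>j. S j x)" for x
  have F [measurable]: "F \<in> borel_measurable freq"
    unfolding F_def[abs_def] by (rule borel_measurable_lim_metric) measurable
  have "(\<integral>\<^sup>+x. ennreal ((cmod (F x - forward_sum c n x))\<^sup>2) \<partial>freq) \<le> ennreal (2 * pi * energy_tail c n)" for n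
  proof -
    have "(\<integral>\<^sup>+x. ennreal ((cmod (F x - forward_sum c n x))\<^sup>2) \<partial>freq) =
        (\<integral>\<^sup>+x. liminf (\<lambda>j. ennreal ((cmod (S j x - forward_sum c n x))\<^sup>2)) \<partial>freq)"
    proof (rule nn_integral_cong_AE)
      show "AE x in freq. ennreal ((cmod (F x - forward_sum c n x))\<^sup>2) =
         liminf (\<lambda>j. ennreal ((cmod (S j x - forward_sum c n x))\<^sup>2))"
        using conv
      proof eventually_elim
        case (elim x)
        then have "(\<lambda>j. S j x) \<longlonglongrightarrow> F x"
          unfolding F_def by (simp add: convergent_LIMSEQ_iff)
        then have "(\<lambda>j. ennreal ((cmod (S j x - forward_sum c n x))\<^sup>2)) \<longlonglongrightarrow> ennreal ((cmod (F x - forward_sum c n x))\<^sup>2)"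
          by (intro tendsto_intros)
        then show ?case
          by (rule lim_imp_Liminf[OF sequentially_bot, symmetric])
      qed
    qed
    also have "\<dots> \<le> liminf (\<lambda>j. \<integral>\<^sup>+x. ennreal ((cmod (S j x - forward_sum c n x))\<^sup>2) \<partial>freq)"
      by (rule nn_integral_liminf) measurable
    also have "\<dots> \<le> liminf (\<lambda>j. ennreal (2 * pi * energy_tail c n))"
    proof (rule Liminf_mono)
      show "\<forall>\<^sub>F j in sequentially. (\<integral>\<^sup>+x. ennreal ((cmod (S j x - forward_sum c n x))\<^sup>2) \<partial>freq) \<le> ennreal (2 * pi * energy_tail c n)"
        using eventually_ge_at_top[of n]
      proof eventually_elim
        case (elim j)
        then have "n \<le> r j"
          using seq_suble[OF mono, of j] by simp
        then have "(\<integral>x. (cmod (S j x - forward_sum c n x))\<^sup>2 \<partial>freq) \<le> 2 * pi * energy_tail c n"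
          unfolding S_def by (rule integral_forward_sum_diff[OF c])
        moreover have "integrable freq (\<lambda>x. (cmod (S j x - forward_sum c n x))\<^sup>2)"
          unfolding S_def
          by (intro square_integrable_norm square_integrable_diff square_integrable_forward_sum)
        ultimately show ?case
          by (simp add: nn_integral_eq_integral ennreal_leI)
      qed
    qed
    also have "\<dots> = ennreal (2 * pi * energy_tail c n)"
      by (rule Liminf_const) simp
    finally show ?thesis .
  qed
  with F show ?thesis by blast
qed

text \<open>The function chosen by \<^const>\<open>forward_series\<close> is known only through its defining property, which
  the Riesz-Fischer theorem shows to be satisfiable.\<close>

lemma forward_series:
  assumes c: "c \<in> ell2"
  shows "square_integrable (forward_series c)"
    and "(\<lambda>n. \<integral>x. (cmod (forward_series c x - forward_sum c n x))\<^sup>2 \<partial>freq) \<longlonglongrightarrow> 0"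
proof -
  define G where "G = forward_series c"
  have "\<exists>F. F \<in> borel_measurable freq \<and>
     (\<lambda>n. \<integral>\<^sup>+x. ennreal ((cmod (F x - forward_sum c n x))\<^sup>2) \<partial>freq) \<longlonglongrightarrow> 0"
  proof -
    obtain F where F: "F \<in> borel_measurable freq"
      "\<And>n. (\<integral>\<^sup>+x. ennreal ((cmod (F x - forward_sum c n x))\<^sup>2) \<partial>freq) \<le> ennreal (2 * pi * energy_tail c n)"
      using riesz_fischer[OF c] by blast
    have "(\<lambda>n. ennreal (2 * pi * energy_tail c n)) \<longlonglongrightarrow> ennreal (2 * pi * 0)"
      by (intro tendsto_ennrealI tendsto_mult tendsto_const energy_tail_tendsto c)
    then have lim: "(\<lambda>n. ennreal (2 * pi * energy_tail c n)) \<longlonglongrightarrow> 0"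
      by simp
    have "(\<lambda>n. \<integral>\<^sup>+x. ennreal ((cmod (F x - forward_sum c n x))\<^sup>2) \<partial>freq) \<longlonglongrightarrow> 0"
      by (rule tendsto_sandwich[OF _ _ tendsto_const lim]) (simp_all add: F(2))
    with F(1) show ?thesis by blast
  qed
  from someI_ex[OF this] have G: "G \<in> borel_measurable freq \<and>
     (\<lambda>n. \<integral>\<^sup>+x. ennreal ((cmod (G x - forward_sum c n x))\<^sup>2) \<partial>freq) \<longlonglongrightarrow> 0"
    unfolding G_def forward_series_def forward_sum_def .
  then have meas [measurable]: "G \<in> borel_measurable freq"
    and lim: "(\<lambda>n. \<integral>\<^sup>+x. ennreal ((cmod (G x - forward_sum c n x))\<^sup>2) \<partial>freq) \<longlonglongrightarrow> 0"
    using G by simp_all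
  have "\<forall>\<^sub>F n in sequentially. (\<integral>\<^sup>+x. ennreal ((cmod (G x - forward_sum c n x))\<^sup>2) \<partial>freq) < \<infinity>"
    by (rule order_tendstoD(2)[OF lim]) simp
  then obtain n where n: "(\<integral>\<^sup>+x. ennreal ((cmod (G x - forward_sum c n x))\<^sup>2) \<partial>freq) < \<infinity>"
    by (auto simp: eventually_sequentially)
  have "square_integrable (\<lambda>x. G x - forward_sum c n x)"
    unfolding square_integrable_def using n by (auto intro!: integrableI_bounded)
  from square_integrable_add[OF this square_integrable_forward_sum[of c n]]
  show sq: "square_integrable (forward_series c)"
    by (simp add: G_def)
  have "integrable freq (\<lambda>x. (cmod (G x - forward_sum c n x))\<^sup>2)" for n
    using sq unfolding G_def
    by (intro square_integrable_norm square_integrable_diff square_integrable_forward_sum)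
  with lim have "(\<lambda>n. ennreal (\<integral>x. (cmod (G x - forward_sum c n x))\<^sup>2 \<partial>freq)) \<longlonglongrightarrow> ennreal 0"
    by (simp add: nn_integral_eq_integral)
  then show "(\<lambda>n. \<integral>x. (cmod (forward_series c x - forward_sum c n x))\<^sup>2 \<partial>freq) \<longlonglongrightarrow> 0"
    unfolding G_def by (subst (asm) tendsto_ennreal_iff) auto
qed

lemma integral_mult_forward_series:
  assumes c: "c \<in> ell2" and v: "square_integrable v"
  shows "(\<lambda>n. \<integral>x. v x * cnj (forward_sum c n x) \<partial>freq) \<longlonglongrightarrow> (\<integral>x. v x * cnj (forward_series c x) \<partial>freq)"
proof -
  let ?D = "\<lambda>n. \<integral>x. (cmod (forward_series c x - forward_sum c n x))\<^sup>2 \<partial>freq"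
  have "(\<lambda>n. (\<integral>x. v x * cnj (forward_sum c n x) \<partial>freq) - (\<integral>x. v x * cnj (forward_series c x) \<partial>freq)) \<longlonglongrightarrow> 0"
  proof (rule Lim_null_comparison)
    have "(\<lambda>n. sqrt (\<integral>x. (cmod (v x))\<^sup>2 \<partial>freq) * sqrt (?D n)) \<longlonglongrightarrow> sqrt (\<integral>x. (cmod (v x))\<^sup>2 \<partial>freq) * sqrt 0"
      by (intro tendsto_mult tendsto_const tendsto_real_sqrt forward_series(2)[OF c])
    then show "(\<lambda>n. sqrt (\<integral>x. (cmod (v x))\<^sup>2 \<partial>freq) * sqrt (?D n)) \<longlonglongrightarrow> 0"
      by simp
    show "\<forall>\<^sub>F n in sequentially. norm ((\<integral>x. v x * cnj (forward_sum c n x) \<partial>freq) - (\<integral>x. v x * cnj (forward_series c x) \<partial>freq))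
        \<le> sqrt (\<integral>x. (cmod (v x))\<^sup>2 \<partial>freq) * sqrt (?D n)"
    proof (rule always_eventually, rule allI)
      fix n
      let ?d = "\<lambda>x. cnj (forward_series c x - forward_sum c n x)"
      have d: "square_integrable ?d"
        by (intro square_integrable_cnj square_integrable_diff forward_series(1)[OF c] square_integrable_forward_sum)
      have i: "integrable freq (\<lambda>x. v x * cnj (forward_sum c n x))" "integrable freq (\<lambda>x. v x * cnj (forward_series c x))"
        by (intro square_integrable_mult v square_integrable_cnj forward_series(1)[OF c] square_integrable_forward_sum)+
      have "(\<integral>x. v x * cnj (forward_series c x) \<partial>freq) - (\<integral>x. v x * cnj (forward_sum c n x) \<partial>freq) = (\<integral>x. v x * ?d x \<partial>freq)"
        by (simp only: Bochner_Integration.integral_diff[OF i(2,1), symmetric] complex_cnj_diff right_diff_distrib)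
      then show "norm ((\<integral>x. v x * cnj (forward_sum c n x) \<partial>freq) - (\<integral>x. v x * cnj (forward_series c x) \<partial>freq))
        \<le> sqrt (\<integral>x. (cmod (v x))\<^sup>2 \<partial>freq) * sqrt (?D n)"
        using Cauchy_Schwarz_square_integrable[OF v d] by (simp only: norm_minus_commute complex_mod_cnj)
    qed
  qed
  then show ?thesis
    by (rule LIM_zero_cancel)
qed

lemma integral_mult_forward_series_eq_0:
  assumes c: "c \<in> ell2" and v: "square_integrable v" and zero: "\<And>k. fcoeff v (int k + 1) = 0"
  shows "(\<integral>x. v x * cnj (forward_series c x) \<partial>freq) = 0"
proof -
  have "(\<integral>x. v x * cnj (forward_sum c n x) \<partial>freq) = 0" for n
  proof -
    have "forward_sum c n x = (\<Sum>k<n. c k * mode (int k + 1) x)" for x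
      by (simp add: forward_sum_def)
    then show ?thesis
      using integral_inner_modes[OF square_integrable_integrable[OF v], of "{..<n}" c "\<lambda>k. int k + 1"] zero by simp
  qed
  then show ?thesis
    using integral_mult_forward_series[OF c v] by (simp add: LIMSEQ_const_iff)
qed

section \<open>Toeplitz matrices and their symbols\<close>

lemma fcoeff_mult_modes:
  assumes u: "integrable freq u" and "finite I"
  shows "fcoeff (\<lambda>x. u x * (\<Sum>i\<in>I. c i * mode (\<nu> i) x)) j = (\<Sum>i\<in>I. c i * fcoeff u (j - \<nu> i))"
proof -
  have "u x * (\<Sum>i\<in>I. c i * mode (\<nu> i) x) * mode (- j) x = (\<Sum>i\<in>I. c i * (u x * mode (- (j - \<nu> i)) x))" for x
  proof -
    have "mode (- (j - \<nu> i)) x = mode (\<nu> i) x * mode (- j) x" for i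
      by (simp add: cis_mult right_diff_distrib)
    then show ?thesis
      by (simp add: sum_distrib_left sum_distrib_right mult_ac del: of_int_minus of_int_diff minus_diff_eq)
  qed
  then have "(\<integral>x. u x * (\<Sum>i\<in>I. c i * mode (\<nu> i) x) * mode (- j) x \<partial>freq) =
     (\<Sum>i\<in>I. c i * (\<integral>x. u x * mode (- (j - \<nu> i)) x \<partial>freq))"
    using integrable_mult_cis[OF u]
    by (simp del: of_int_minus of_int_diff minus_diff_eq)
  then show ?thesis
    by (simp add: fcoeff_def sum_distrib_left mult.left_commute del: of_int_minus of_int_diff minus_diff_eq)
qed

lemma analytic_poly_mode: "(\<Sum>k<N. c k * cis (x * real k)) = (\<Sum>k<N. c k * mode (int k) x)"
  by simp

lemma analytic_poly_parseval:
  "(\<integral>x. (cmod (\<Sum>k<N. c k * cis (x * real k)))\<^sup>2 \<partial>freq) = 2 * pi * (\<Sum>k<N. (cmod (c k))\<^sup>2)"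
  unfolding analytic_poly_mode by (rule parseval_finite) (auto simp: inj_on_def)

lemma analytic_poly_bounded: "cmod (\<Sum>k<N. c k * cis (x * r k)) \<le> (\<Sum>k<N. cmod (c k))"
  by (rule sum_norm_le) (simp add: norm_mult)

lemma integrable_mult_poly_squared:
  fixes \<psi> :: "real \<Rightarrow> real"
  assumes \<psi>: "integrable freq \<psi>"
  shows "integrable freq (\<lambda>x. \<psi> x * (cmod (\<Sum>k<N. c k * cis (x * real k)))\<^sup>2)"
proof (rule Bochner_Integration.integrable_bound)
  show "integrable freq (\<lambda>x. (\<Sum>k<N. cmod (c k))\<^sup>2 * \<psi> x)"
    using \<psi> by simp
  have [measurable]: "\<psi> \<in> borel_measurable freq"
    using \<psi> by simp
  show "(\<lambda>x. \<psi> x * (cmod (\<Sum>k<N. c k * cis (x * real k)))\<^sup>2) \<in> borel_measurable freq"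
    by measurable
  have "\<bar>\<psi> x\<bar> * (cmod (\<Sum>k<N. c k * cis (x * real k)))\<^sup>2 \<le> \<bar>\<psi> x\<bar> * (\<Sum>k<N. cmod (c k))\<^sup>2" for x
    by (intro mult_left_mono power_mono analytic_poly_bounded) auto
  then show "AE x in freq. norm (\<psi> x * (cmod (\<Sum>k<N. c k * cis (x * real k)))\<^sup>2) \<le> norm ((\<Sum>k<N. cmod (c k))\<^sup>2 * \<psi> x)"
    by (intro AE_I2) (simp add: abs_mult mult.commute)
qed

text \<open>Finite sections: the coefficients of an analytic polynomial as an element of \<^const>\<open>ell2\<close>.\<close>

definition truncate :: "nat \<Rightarrow> (nat \<Rightarrow> complex) \<Rightarrow> nat \<Rightarrow> complex" where
  "truncate N c k = (if k < N then c k else 0)"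

lemma truncate_sum: "(\<Sum>k. u k * truncate N c k) = (\<Sum>k<N. u k * c k)"
proof -
  have "(\<Sum>k. u k * truncate N c k) = (\<Sum>k<N. u k * truncate N c k)"
    by (rule suminf_finite) (auto simp: truncate_def)
  then show ?thesis by (simp add: truncate_def)
qed

lemma truncate_ell2: "truncate N c \<in> ell2"
  unfolding ell2_def mem_Collect_eq by (rule summable_finite[of "{..<N}"]) (auto simp: truncate_def)

lemma l2norm_nonneg: "x \<in> ell2 \<Longrightarrow> 0 \<le> l2norm x"
  by (simp add: l2norm_def suminf_nonneg ell2_def)

lemma l2norm_squared: "x \<in> ell2 \<Longrightarrow> (l2norm x)\<^sup>2 = (\<Sum>k. (cmod (x k))\<^sup>2)"
  by (simp add: l2norm_def suminf_nonneg ell2_def)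

lemma l2norm_partial: "x \<in> ell2 \<Longrightarrow> L2_set (\<lambda>k. cmod (x k)) {..<N} \<le> l2norm x"
  unfolding l2norm_def L2_set_def
  by (intro real_sqrt_le_mono sum_le_suminf) (auto simp: ell2_def)

lemma l2norm_truncate: "(l2norm (truncate N c))\<^sup>2 = (\<Sum>k<N. (cmod (c k))\<^sup>2)"
proof -
  have "(\<Sum>k. (cmod (truncate N c k))\<^sup>2) = (\<Sum>k<N. (cmod (truncate N c k))\<^sup>2)"
    by (rule suminf_finite) (auto simp: truncate_def)
  then show ?thesis
    by (simp add: l2norm_squared[OF truncate_ell2] truncate_def)
qed

abbreviation toeplitz :: "(real \<Rightarrow> real) \<Rightarrow> nat \<Rightarrow> nat \<Rightarrow> complex" where
  "toeplitz \<phi> l k \<equiv> fcoeff (\<lambda>x. complex_of_real (\<phi> x)) (int l - int k)"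

lemma toeplitz_truncate:
  assumes "integrable freq \<phi>"
  shows "mat_op (toeplitz \<phi>) (truncate N c) l =
    fcoeff (\<lambda>x. of_real (\<phi> x) * (\<Sum>k<N. c k * cis (x * real k))) (int l)"
  unfolding mat_op_def truncate_sum analytic_poly_mode
  using fcoeff_mult_modes[OF integrable_of_real[OF assms], of "{..<N}" c int "int l"]
  by (simp add: mult.commute)

text \<open>The form \<open>\<langle>P c, c\<rangle>\<close> is the integral of \<open>\<phi> \<bar>X\<bar>\<^sup>2\<close>, and it is at most \<open>K \<parallel>c\<parallel>\<^sup>2\<close>, which is the same
  integral with the constant symbol \<open>K\<close>.\<close>

lemma toeplitz_symbol_bounded:
  assumes \<phi>: "integrable freq \<phi>" and op: "l2_operator (toeplitz \<phi>)"
  shows "\<exists>K. AE x in freq. \<phi> x \<le> K"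
proof -
  obtain K0 where K0: "\<And>x. x \<in> ell2 \<Longrightarrow> l2norm (mat_op (toeplitz \<phi>) x) \<le> K0 * l2norm x"
    and in_ell2: "\<And>x. x \<in> ell2 \<Longrightarrow> mat_op (toeplitz \<phi>) x \<in> ell2"
    using op unfolding l2_operator_def by blast
  have "AE x in freq. 0 \<le> K0 - \<phi> x"
  proof (rule AE_nonneg_of_quadratic_form)
    show "integrable freq (\<lambda>x. K0 - \<phi> x)"
      using \<phi> by simp
    fix N c
    define X where "X x = (\<Sum>k<N. c k * cis (x * real k))" for x
    define y where "y = mat_op (toeplitz \<phi>) (truncate N c)"
    have int: "integrable freq (\<lambda>x. of_real (\<phi> x) * X x)"
      using \<phi> unfolding X_def
      by (intro integrable_mult_bounded[where B = "\<Sum>k<N. cmod (c k)"]) (auto intro: analytic_poly_bounded)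
    have "complex_of_real (\<integral>x. \<phi> x * (cmod (X x))\<^sup>2 \<partial>freq) = (\<integral>x. of_real (\<phi> x) * X x * cnj (X x) \<partial>freq)"
      by (subst integral_complex_of_real[symmetric]) (simp only: of_real_mult complex_norm_square mult.assoc)
    also have "\<dots> = 2 * pi * (\<Sum>l<N. cnj (c l) * y l)"
      unfolding y_def toeplitz_truncate[OF \<phi>] X_def[symmetric]
      using integral_inner_modes[OF int, of "{..<N}" c int] by (simp add: X_def)
    finally have "complex_of_real (\<integral>x. \<phi> x * (cmod (X x))\<^sup>2 \<partial>freq) = 2 * pi * (\<Sum>l<N. cnj (c l) * y l)" .
    from arg_cong[OF this, of cmod]
    have "\<bar>\<integral>x. \<phi> x * (cmod (X x))\<^sup>2 \<partial>freq\<bar> = cmod (2 * pi * (\<Sum>l<N. cnj (c l) * y l))"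
      by (simp only: norm_of_real)
    also have "\<dots> = 2 * pi * cmod (\<Sum>l<N. cnj (c l) * y l)"
      by (simp add: norm_mult)
    also have "cmod (\<Sum>l<N. cnj (c l) * y l) \<le> (\<Sum>l<N. \<bar>cmod (truncate N c l)\<bar> * \<bar>cmod (y l)\<bar>)"
      by (rule sum_norm_le) (simp add: norm_mult truncate_def)
    also have "\<dots> \<le> L2_set (\<lambda>l. cmod (truncate N c l)) {..<N} * L2_set (\<lambda>l. cmod (y l)) {..<N}"
      by (rule L2_set_mult_ineq)
    also have "\<dots> \<le> l2norm (truncate N c) * l2norm y"
      unfolding y_def
      by (intro mult_mono l2norm_partial truncate_ell2 in_ell2 l2norm_nonneg L2_set_nonneg)
    also have "\<dots> \<le> l2norm (truncate N c) * (K0 * l2norm (truncate N c))"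
      unfolding y_def by (intro mult_left_mono K0 truncate_ell2 l2norm_nonneg)
    also have "\<dots> = K0 * (\<Sum>k<N. (cmod (c k))\<^sup>2)"
      unfolding l2norm_truncate[symmetric] by (simp add: power2_eq_square)
    finally have "(\<integral>x. \<phi> x * (cmod (X x))\<^sup>2 \<partial>freq) \<le> K0 * (\<integral>x. (cmod (X x))\<^sup>2 \<partial>freq)"
      unfolding X_def analytic_poly_parseval by (simp add: mult.left_commute)
    moreover have "(\<integral>x. (K0 - \<phi> x) * (cmod (X x))\<^sup>2 \<partial>freq) =
        (\<integral>x. K0 * (cmod (X x))\<^sup>2 \<partial>freq) - (\<integral>x. \<phi> x * (cmod (X x))\<^sup>2 \<partial>freq)"
      unfolding left_diff_distrib X_def
      using integrable_mult_poly_squared[of "\<lambda>_. K0"] integrable_mult_poly_squared[OF \<phi>]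
      by (intro Bochner_Integration.integral_diff) auto
    ultimately show "0 \<le> (\<integral>x. (K0 - \<phi> x) * (cmod (\<Sum>k<N. c k * cis (x * real k)))\<^sup>2 \<partial>freq)"
      by (simp add: X_def)
  qed
  then have "AE x in freq. \<phi> x \<le> K0" by simp
  then show ?thesis ..
qed

lemma mat_inv_mat_op: "l2_invertible M \<Longrightarrow> x \<in> ell2 \<Longrightarrow> mat_inv M (mat_op M x) = x"
  unfolding l2_invertible_def mat_inv_def bij_betw_def by (simp add: inv_into_f_f)

lemma mat_op_mat_inv: "l2_invertible M \<Longrightarrow> y \<in> ell2 \<Longrightarrow> mat_op M (mat_inv M y) = y"
  unfolding l2_invertible_def mat_inv_def bij_betw_def by (simp add: f_inv_into_f)

lemma mat_inv_ell2: "l2_invertible M \<Longrightarrow> y \<in> ell2 \<Longrightarrow> mat_inv M y \<in> ell2"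
  unfolding l2_invertible_def mat_inv_def bij_betw_def by (metis inv_into_into)

text \<open>By Bessel's inequality \<open>\<parallel>P c\<parallel>\<^sup>2\<close> is at most the integral of \<open>\<phi>\<^sup>2 \<bar>X\<bar>\<^sup>2\<close>: applying \<open>P\<close> multiplies \<open>X\<close> by
  \<open>\<phi>\<close> and drops the negative frequencies. A bounded inverse bounds this below by a multiple
  of the integral of \<open>\<bar>X\<bar>\<^sup>2\<close>, hence \<open>\<phi>\<^sup>2\<close> is bounded below.\<close>

lemma toeplitz_symbol_bounded_below:
  assumes \<phi>: "\<phi> \<in> borel_measurable freq" "\<And>x. x \<in> {-pi..pi} \<Longrightarrow> 0 \<le> \<phi> x" "AE x in freq. \<phi> x \<le> B"
    and inv: "l2_invertible (toeplitz \<phi>)"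
  shows "\<exists>\<delta>>0. AE x in freq. \<delta> \<le> \<phi> x"
proof -
  note [measurable] = \<phi>(1)
  have \<phi>_abs: "AE x in freq. \<bar>\<phi> x\<bar> \<le> B"
    using \<phi>(3) AE_space[of freq] by eventually_elim (simp add: \<phi>(2))
  have \<phi>_int: "integrable freq \<phi>"
    using \<phi>_abs by (intro freq.integrable_const_bound[where B = B]) auto
  have \<phi>2_int: "integrable freq (\<lambda>x. (\<phi> x)\<^sup>2)"
  proof (rule freq.integrable_const_bound[where B = "B\<^sup>2"])
    show "AE x in freq. norm ((\<phi> x)\<^sup>2) \<le> B\<^sup>2"
      using \<phi>_abs
    proof eventually_elim
      case (elim x)
      from power_mono[OF this, of 2] show ?case by simp
    qed
  qed measurable
  obtain K0 where K0: "\<And>y. y \<in> ell2 \<Longrightarrow> l2norm (mat_inv (toeplitz \<phi>) y) \<le> K0 * l2norm y"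
    and in_ell2: "\<And>x. x \<in> ell2 \<Longrightarrow> mat_op (toeplitz \<phi>) x \<in> ell2"
    using inv unfolding l2_invertible_def l2_operator_def by blast
  \<comment> \<open>the bound of an inverse may be stated with a nonpositive constant; a positive one is divided by below\<close>
  define K where "K = max K0 1"
  have "AE x in freq. 0 \<le> K\<^sup>2 * (\<phi> x)\<^sup>2 - 1"
  proof (rule AE_nonneg_of_quadratic_form)
    show "integrable freq (\<lambda>x. K\<^sup>2 * (\<phi> x)\<^sup>2 - 1)"
      using \<phi>2_int by simp
    fix N c
    define X where "X x = (\<Sum>k<N. c k * cis (x * real k))" for x
    define y where "y = mat_op (toeplitz \<phi>) (truncate N c)"
    have y: "y \<in> ell2"
      unfolding y_def by (intro in_ell2 truncate_ell2)
    have sq: "square_integrable (\<lambda>x. X x * of_real (\<phi> x))"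
    proof (rule square_integrable_mult_bounded[where B = B])
      show "square_integrable X"
        unfolding X_def by (rule square_integrable_sum_cis)
      show "AE x in freq. cmod (of_real (\<phi> x)) \<le> B"
        using \<phi>_abs by simp
    qed measurable
    have "2 * pi * (\<Sum>l<n. (cmod (y l))\<^sup>2) \<le> (\<integral>x. (cmod (X x * of_real (\<phi> x)))\<^sup>2 \<partial>freq)" for n
      using bessel[OF sq, of "{..<n}" int] unfolding y_def toeplitz_truncate[OF \<phi>_int]
      by (simp add: X_def mult.commute inj_on_def)
    then have "(\<Sum>l<n. (cmod (y l))\<^sup>2) \<le> 1 / (2 * pi) * (\<integral>x. (\<phi> x)\<^sup>2 * (cmod (X x))\<^sup>2 \<partial>freq)" for n
      by (simp add: norm_mult power_mult_distrib field_simps)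
    then have "(\<Sum>l. (cmod (y l))\<^sup>2) \<le> 1 / (2 * pi) * (\<integral>x. (\<phi> x)\<^sup>2 * (cmod (X x))\<^sup>2 \<partial>freq)"
      using y by (intro suminf_le_const) (auto simp: ell2_def)
    then have y_norm: "2 * pi * (l2norm y)\<^sup>2 \<le> (\<integral>x. (\<phi> x)\<^sup>2 * (cmod (X x))\<^sup>2 \<partial>freq)"
      unfolding l2norm_squared[OF y] by (simp add: field_simps)
    have "l2norm (truncate N c) \<le> K0 * l2norm y"
      using K0[OF y] unfolding y_def mat_inv_mat_op[OF inv truncate_ell2] .
    also have "\<dots> \<le> K * l2norm y"
      using l2norm_nonneg[OF y] by (intro mult_right_mono) (auto simp: K_def)
    finally have "(l2norm (truncate N c))\<^sup>2 \<le> (K * l2norm y)\<^sup>2"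
      using l2norm_nonneg[OF truncate_ell2] by (intro power_mono)
    then have "2 * pi * (\<Sum>k<N. (cmod (c k))\<^sup>2) \<le> K\<^sup>2 * (2 * pi * (l2norm y)\<^sup>2)"
      unfolding l2norm_truncate by (simp add: power_mult_distrib)
    also have "\<dots> \<le> K\<^sup>2 * (\<integral>x. (\<phi> x)\<^sup>2 * (cmod (X x))\<^sup>2 \<partial>freq)"
      by (intro mult_left_mono y_norm) auto
    finally have le: "(\<integral>x. (cmod (X x))\<^sup>2 \<partial>freq) \<le> K\<^sup>2 * (\<integral>x. (\<phi> x)\<^sup>2 * (cmod (X x))\<^sup>2 \<partial>freq)"
      unfolding X_def analytic_poly_parseval .
    have "(\<integral>x. (K\<^sup>2 * (\<phi> x)\<^sup>2 - 1) * (cmod (X x))\<^sup>2 \<partial>freq) =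
        (\<integral>x. K\<^sup>2 * ((\<phi> x)\<^sup>2 * (cmod (X x))\<^sup>2) - (cmod (X x))\<^sup>2 \<partial>freq)"
      by (simp add: left_diff_distrib mult.assoc)
    also have "\<dots> = K\<^sup>2 * (\<integral>x. (\<phi> x)\<^sup>2 * (cmod (X x))\<^sup>2 \<partial>freq) - (\<integral>x. (cmod (X x))\<^sup>2 \<partial>freq)"
      using integrable_mult_poly_squared[OF \<phi>2_int, of c N] integrable_mult_poly_squared[of "\<lambda>_. 1" c N]
      unfolding X_def by simp
    finally show "0 \<le> (\<integral>x. (K\<^sup>2 * (\<phi> x)\<^sup>2 - 1) * (cmod (\<Sum>k<N. c k * cis (x * real k)))\<^sup>2 \<partial>freq)"
      using le by (simp add: X_def)
  qed
  then have "AE x in freq. 1 / K \<le> \<phi> x"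
    using AE_space[of freq]
  proof eventually_elim
    case (elim x)
    then have "1\<^sup>2 \<le> (K * \<phi> x)\<^sup>2"
      by (simp add: power_mult_distrib)
    moreover have "0 \<le> K * \<phi> x"
      using elim \<phi>(2) by (simp add: K_def)
    ultimately have "1 \<le> K * \<phi> x"
      using power2_le_imp_le by blast
    then show ?case
      by (simp add: K_def field_simps)
  qed
  then show ?thesis
    by (intro exI[of _ "1 / K"]) (simp add: K_def)
qed

text \<open>Multiplication by a bounded function, in coordinates; Bessel's inequality gives the bound. The
  orientation \<open>k - l\<close> of the indices is that of \<^const>\<open>Qmat\<close>.\<close>

lemma toeplitz_bounded_operator:
  assumes q: "q \<in> borel_measurable freq" "AE x in freq. \<bar>q x\<bar> \<le> B" "0 \<le> B"
  shows "l2_operator (\<lambda>l k. fcoeff (\<lambda>x. complex_of_real (q x)) (int k - int l))"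
    (is "l2_operator ?M")
proof -
  note [measurable] = q(1)
  have q_sq: "square_integrable (\<lambda>x. of_real (q x))"
    using q(2) by (intro square_integrable_bounded[where B = B]) auto
  have row: "summable (\<lambda>k. ?M l k * x k)" if x: "x \<in> ell2" for x l
  proof (rule summable_comparison_test')
    have "summable (\<lambda>k. (cmod (?M l k))\<^sup>2)"
    proof (rule summableI_nonneg_bounded)
      fix n
      show "(\<Sum>k<n. (cmod (?M l k))\<^sup>2) \<le> 1 / (2 * pi) * (\<integral>x. (cmod (of_real (q x)))\<^sup>2 \<partial>freq)"
        using bessel[OF q_sq, of "{..<n}" "\<lambda>k. int k - int l"] by (simp add: inj_on_def field_simps)
    qed simp
    then show "summable (\<lambda>k. (cmod (?M l k))\<^sup>2 + (cmod (x k))\<^sup>2)"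
      using x by (intro summable_add) (simp_all add: ell2_def)
    fix k
    have "2 * (cmod (?M l k) * cmod (x k)) \<le> (cmod (?M l k))\<^sup>2 + (cmod (x k))\<^sup>2" "0 \<le> cmod (?M l k) * cmod (x k)"
      using sum_squares_bound[of "cmod (?M l k)" "cmod (x k)"] by simp_all
    then show "norm (?M l k * x k) \<le> (cmod (?M l k))\<^sup>2 + (cmod (x k))\<^sup>2"
      unfolding norm_mult by linarith
  qed
  have partial: "(\<Sum>l<L. (cmod (mat_op ?M x l))\<^sup>2) \<le> (B * l2norm x)\<^sup>2" if x: "x \<in> ell2" for x L
  proof (rule LIMSEQ_le_const2)
    show "(\<lambda>n. \<Sum>l<L. (cmod (\<Sum>k<n. ?M l k * x k))\<^sup>2) \<longlonglongrightarrow> (\<Sum>l<L. (cmod (mat_op ?M x l))\<^sup>2)"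
      unfolding mat_op_def by (intro tendsto_sum tendsto_power tendsto_norm summable_LIMSEQ row x)
    have finite_section: "(\<Sum>l<L. (cmod (\<Sum>k<n. ?M l k * x k))\<^sup>2) \<le> (B * l2norm x)\<^sup>2" for n
    proof -
      define X where "X t = (\<Sum>k<n. x k * mode (- int k) t)" for t
      have X_sq: "square_integrable X"
        unfolding X_def by (rule square_integrable_sum_cis)
      have Xq_sq: "square_integrable (\<lambda>t. X t * of_real (q t))"
        using X_sq q by (intro square_integrable_mult_bounded[where B = B]) auto
      have "(\<Sum>k<n. ?M l k * x k) = fcoeff (\<lambda>t. X t * of_real (q t)) (- int l)" for l
        using fcoeff_mult_modes[OF square_integrable_integrable[OF q_sq], of "{..<n}" x "\<lambda>k. - int k" "- int l"]
        by (simp add: X_def mult.commute)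
      then have "2 * pi * (\<Sum>l<L. (cmod (\<Sum>k<n. ?M l k * x k))\<^sup>2) \<le> (\<integral>t. (cmod (X t * of_real (q t)))\<^sup>2 \<partial>freq)"
        using bessel[OF Xq_sq, of "{..<L}" "\<lambda>l. - int l"] by (simp add: inj_on_def)
      also have "\<dots> \<le> (\<integral>t. B\<^sup>2 * (cmod (X t))\<^sup>2 \<partial>freq)"
      proof (rule integral_mono_AE)
        show "AE t in freq. (cmod (X t * of_real (q t)))\<^sup>2 \<le> B\<^sup>2 * (cmod (X t))\<^sup>2"
          using q(2)
        proof eventually_elim
          case (elim t)
          then have "\<bar>q t\<bar>\<^sup>2 \<le> B\<^sup>2" by (intro power_mono) auto
          then show ?case
            using mult_left_mono[of "(q t)\<^sup>2" "B\<^sup>2" "(cmod (X t))\<^sup>2"] by (simp add: norm_mult power_mult_distrib mult.commute)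
        qed
      qed (use square_integrable_norm[OF Xq_sq] square_integrable_norm[OF X_sq] in auto)
      also have "\<dots> = B\<^sup>2 * (2 * pi * (\<Sum>k<n. (cmod (x k))\<^sup>2))"
        unfolding X_def by (subst integral_mult_right_zero, subst parseval_finite) (auto simp: inj_on_def)
      finally have "(\<Sum>l<L. (cmod (\<Sum>k<n. ?M l k * x k))\<^sup>2) \<le> B\<^sup>2 * (\<Sum>k<n. (cmod (x k))\<^sup>2)"
        by (simp add: mult.left_commute)
      also have "\<dots> \<le> B\<^sup>2 * (l2norm x)\<^sup>2"
        unfolding l2norm_squared[OF x] using x
        by (intro mult_left_mono sum_le_suminf) (auto simp: ell2_def)
      finally show ?thesis by (simp add: power_mult_distrib)
    qed
    show "\<exists>N. \<forall>n\<ge>N. (\<Sum>l<L. (cmod (\<Sum>k<n. ?M l k * x k))\<^sup>2) \<le> (B * l2norm x)\<^sup>2"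
      by (intro exI allI impI) (rule finite_section)
  qed
  have ell2: "mat_op ?M x \<in> ell2" if "x \<in> ell2" for x
    unfolding ell2_def mem_Collect_eq
    by (rule summableI_nonneg_bounded[OF _ partial[OF that]]) simp
  have norm: "l2norm (mat_op ?M x) \<le> B * l2norm x" if x: "x \<in> ell2" for x
  proof -
    have "(l2norm (mat_op ?M x))\<^sup>2 \<le> (B * l2norm x)\<^sup>2"
      unfolding l2norm_squared[OF ell2[OF x]] using ell2[OF x]
      by (intro suminf_le_const partial[OF x]) (simp add: ell2_def)
    then show ?thesis
      by (rule power2_le_imp_le) (intro mult_nonneg_nonneg l2norm_nonneg[OF x] q(3))
  qed
  show ?thesis
    unfolding l2_operator_def
    by (intro conjI ballI allI exI[of _ B] row ell2 norm)
qed

section \<open>Bounded functions with one-sided spectrum\<close>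

text \<open>The terms of the double sum with \<open>j > k\<close> carry positive frequencies and vanish; \<open>b m\<close>
  collects those with \<open>k - j = m\<close>.\<close>

lemma fejer_mean_past:
  assumes zero: "\<And>k. fcoeff h (int k + 1) = 0"
  shows "\<exists>b. fejer_mean N h = (\<lambda>x. \<Sum>m\<le>N. b m * cis (- x * real m))"
proof -
  define b where "b m = (\<Sum>j<N. \<Sum>k<N. if k = j + m then fcoeff h (- int m) / of_nat N else 0)" for m
  have summand: "fcoeff h (int j - int k) * mode (int j - int k) x / of_nat N =
      (\<Sum>m\<le>N. (if k = j + m then fcoeff h (- int m) / of_nat N else 0) * cis (- x * real m))"
    if "k < N" for j k x
  proof (cases "j \<le> k")
    case True
    then have "(\<Sum>m\<le>N. (if k = j + m then fcoeff h (- int m) / of_nat N else 0) * cis (- x * real m)) =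
       (\<Sum>m\<le>N. if k - j = m then fcoeff h (- int m) / of_nat N * cis (- x * real m) else 0)"
      by (intro sum.cong) auto
    also have "\<dots> = fcoeff h (- int (k - j)) / of_nat N * cis (- x * real (k - j))"
      using that by (subst sum.delta') auto
    finally show ?thesis
      using True by (simp add: of_nat_diff right_diff_distrib)
  next
    case False
    then have "fcoeff h (int j - int k) = 0"
      using zero[of "j - k - 1"] by (simp add: of_nat_diff)
    with False show ?thesis by simp
  qed
  have "fejer_mean N h x = (\<Sum>m\<le>N. b m * cis (- x * real m))" for x
  proof -
    have "fejer_mean N h x = (\<Sum>j<N. \<Sum>k<N. \<Sum>m\<le>N. (if k = j + m then fcoeff h (- int m) / of_nat N else 0) * cis (- x * real m))"
      unfolding fejer_mean_def sum_divide_distrib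
      by (intro sum.cong refl summand) simp
    also have "\<dots> = (\<Sum>m\<le>N. \<Sum>j<N. \<Sum>k<N. (if k = j + m then fcoeff h (- int m) / of_nat N else 0) * cis (- x * real m))"
      by (subst sum.swap[of _ "{..<N}" "{..N}"], subst sum.swap[of _ "{..<N}" "{..N}"]) (rule refl)
    also have "\<dots> = (\<Sum>m\<le>N. b m * cis (- x * real m))"
      unfolding b_def sum_distrib_right ..
    finally show ?thesis .
  qed
  then show ?thesis by blast
qed

text \<open>The Fejer means of \<open>h\<close> inherit its bound, so that their almost everywhere convergence is
  dominated for every integrable weight.\<close>

lemma bounded_in_L2_past:
  assumes h: "h \<in> borel_measurable freq" "AE x in freq. cmod (h x) \<le> B"
    and zero: "\<And>k. fcoeff h (int k + 1) = 0"
    and w: "integrable freq w" "\<And>x. x \<in> {-pi..pi} \<Longrightarrow> 0 \<le> w x"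
  shows "h \<in> L2_past w"
proof -
  note [measurable] = h(1) borel_measurable_integrable[OF w(1)]
  have h_int: "integrable freq h"
    by (rule freq.integrable_const_bound[OF h(2,1)])
  obtain r :: "nat \<Rightarrow> nat" where r: "strict_mono r" "AE x in freq. (\<lambda>n. fejer_mean (r n) h x) \<longlonglongrightarrow> h x"
    using fejer_mean_AE_subseq[OF h_int] by blast
  \<comment> \<open>the shift avoids the degenerate mean of index \<open>0\<close>\<close>
  define s where "s n = fejer_mean (r (Suc n)) h" for n
  have s_lim: "AE x in freq. (\<lambda>n. s n x) \<longlonglongrightarrow> h x"
    using r(2) unfolding s_def by eventually_elim (rule LIMSEQ_Suc)
  have s_bound: "cmod (s n x) \<le> B" for n x
    unfolding s_def using seq_suble[OF r(1), of "Suc n"]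
    by (intro fejer_mean_bounded[OF h_int h(2)]) simp
  have B: "0 \<le> B"
    using s_bound[of 0 0] norm_ge_zero order_trans by blast
  have s_int: "integrable freq (s n)" for n
    unfolding s_def by simp
  then have [measurable]: "s n \<in> borel_measurable freq" for n
    by simp
  have bound: "AE x in freq. norm ((cmod (h x - s n x))\<^sup>2 * w x) \<le> (2 * B)\<^sup>2 * w x" for n
    using h(2) AE_space[of freq]
  proof eventually_elim
    case (elim x)
    then have "cmod (h x - s n x) \<le> 2 * B"
      using norm_triangle_ineq4[of "h x" "s n x"] s_bound[of n x] by linarith
    then have "(cmod (h x - s n x))\<^sup>2 \<le> (2 * B)\<^sup>2"
      by (intro power_mono) auto
    then show ?case
      using elim w(2)[of x] by (simp add: abs_mult mult_right_mono)
  qed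
  have "(\<lambda>n. \<integral>x. (cmod (h x - s n x))\<^sup>2 * w x \<partial>freq) \<longlonglongrightarrow> (\<integral>x. 0 \<partial>freq)"
  proof (rule integral_dominated_convergence[OF _ _ _ _ bound])
    show "AE x in freq. (\<lambda>n. (cmod (h x - s n x))\<^sup>2 * w x) \<longlonglongrightarrow> 0"
      using s_lim
    proof eventually_elim
      case (elim x)
      have "(\<lambda>n. (cmod (h x - s n x))\<^sup>2 * w x) \<longlonglongrightarrow> (cmod (h x - h x))\<^sup>2 * w x"
        by (intro tendsto_intros elim)
      then show ?case by simp
    qed
  qed (use w in auto)
  then have lim: "(\<lambda>n. \<integral>x. (cmod (h x - s n x))\<^sup>2 * w x \<partial>freq) \<longlonglongrightarrow> 0"
    by simp
  have int: "integrable freq (\<lambda>x. (cmod (h x - s n x))\<^sup>2 * w x)" for n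
    by (rule Bochner_Integration.integrable_bound[of _ "\<lambda>x. (2 * B)\<^sup>2 * w x"])
       (use bound[of n] w in \<open>auto elim!: eventually_mono intro: order_trans[OF _ abs_ge_self]\<close>)
  show ?thesis
    unfolding L2_past_def mem_Collect_eq
  proof (intro conjI allI impI)
    show "h \<in> borel_measurable freq" by fact
    have "integrable freq (\<lambda>x. (cmod (h x))\<^sup>2 * w x)"
    proof (rule Bochner_Integration.integrable_bound[of _ "\<lambda>x. B\<^sup>2 * w x"])
      show "AE x in freq. norm ((cmod (h x))\<^sup>2 * w x) \<le> norm (B\<^sup>2 * w x)"
        using h(2) AE_space[of freq]
        by eventually_elim (auto simp: abs_mult w(2) intro!: mult_right_mono power_mono)
    qed (use w in auto)
    then show "(\<integral>\<^sup>+x. ennreal ((cmod (h x))\<^sup>2 * w x) \<partial>freq) < \<infinity>"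
      by (subst nn_integral_eq_integral) (auto intro!: AE_I2 mult_nonneg_nonneg w(2))
  next
    fix \<epsilon> :: real assume "0 < \<epsilon>"
    then have "\<forall>\<^sub>F n in sequentially. (\<integral>x. (cmod (h x - s n x))\<^sup>2 * w x \<partial>freq) < \<epsilon>"
      by (rule order_tendstoD(2)[OF lim])
    then obtain n where n: "(\<integral>x. (cmod (h x - s n x))\<^sup>2 * w x \<partial>freq) < \<epsilon>"
      by (auto simp: eventually_sequentially)
    obtain b where b: "s n = (\<lambda>x. \<Sum>m\<le>r (Suc n). b m * cis (- x * real m))"
      unfolding s_def using fejer_mean_past[OF zero] by blast
    have "(\<integral>\<^sup>+x. ennreal ((cmod (h x - s n x))\<^sup>2 * w x) \<partial>freq) = ennreal (\<integral>x. (cmod (h x - s n x))\<^sup>2 * w x \<partial>freq)"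
      by (rule nn_integral_eq_integral[OF int]) (auto intro!: AE_I2 mult_nonneg_nonneg w(2))
    also have "\<dots> < ennreal \<epsilon>"
      using n \<open>0 < \<epsilon>\<close> by (intro ennreal_lessI)
    finally show "\<exists>n b. (\<integral>\<^sup>+x. ennreal ((cmod (h x - (\<Sum>m\<le>n. b m * cis (- x * real m))))\<^sup>2 * w x) \<partial>freq) < ennreal \<epsilon>"
      unfolding b by blast
  qed
qed

section \<open>The transfer function of the functional\<close>

definition transfer_sum :: "(nat \<Rightarrow> complex) \<Rightarrow> nat \<Rightarrow> real \<Rightarrow> complex" where
  "transfer_sum a n x = (\<Sum>k<n. a k * mode (- int k) x)"

lemma transfer_sum_measurable [measurable]: "transfer_sum a n \<in> borel_measurable freq"
  unfolding transfer_sum_def[abs_def] by measurable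

lemma transfer_sum_tendsto:
  assumes "summable (\<lambda>k. cmod (a k))"
  shows "(\<lambda>n. transfer_sum a n x) \<longlonglongrightarrow> transfer_fun a x"
proof -
  have "summable (\<lambda>k. a k * cis (- x * real k))"
    by (rule summable_norm_cancel) (simp add: norm_mult assms)
  then show ?thesis
    unfolding transfer_sum_def transfer_fun_def by (auto dest: summable_LIMSEQ)
qed

lemma transfer_sum_bound:
  assumes "summable (\<lambda>k. cmod (a k))"
  shows "cmod (transfer_sum a n x) \<le> (\<Sum>k. cmod (a k))"
proof -
  have "cmod (transfer_sum a n x) \<le> (\<Sum>k<n. cmod (a k))"
    unfolding transfer_sum_def by (rule sum_norm_le) (simp add: norm_mult)
  also have "\<dots> \<le> (\<Sum>k. cmod (a k))"
    by (rule sum_le_suminf[OF assms]) auto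
  finally show ?thesis .
qed

lemma transfer_fun_bound:
  assumes "summable (\<lambda>k. cmod (a k))"
  shows "cmod (transfer_fun a x) \<le> (\<Sum>k. cmod (a k))"
  by (rule LIMSEQ_le_const2[OF tendsto_norm[OF transfer_sum_tendsto[OF assms]]])
     (intro exI allI impI transfer_sum_bound[OF assms])

lemma transfer_fun_measurable:
  assumes "summable (\<lambda>k. cmod (a k))"
  shows "transfer_fun a \<in> borel_measurable freq"
  by (rule borel_measurable_LIMSEQ_metric[OF transfer_sum_measurable transfer_sum_tendsto[OF assms]])

lemma integral_bounded_limit:
  fixes u v :: "real \<Rightarrow> complex"
  assumes u: "integrable freq u" and s: "\<And>n. s n \<in> borel_measurable freq" "v \<in> borel_measurable freq"
    and bound: "\<And>n x. cmod (s n x) \<le> B" and lim: "\<And>x. (\<lambda>n. s n x) \<longlonglongrightarrow> v x"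
  shows "(\<lambda>n. \<integral>x. u x * s n x \<partial>freq) \<longlonglongrightarrow> (\<integral>x. u x * v x \<partial>freq)"
proof (rule integral_dominated_convergence)
  note [measurable] = s borel_measurable_integrable[OF u]
  show "(\<lambda>x. u x * v x) \<in> borel_measurable freq" "(\<lambda>x. u x * s n x) \<in> borel_measurable freq" for n
    by measurable
  show "integrable freq (\<lambda>x. cmod (u x) * B)"
    using u by simp
  show "AE x in freq. (\<lambda>n. u x * s n x) \<longlonglongrightarrow> u x * v x"
    by (intro AE_I2 tendsto_mult tendsto_const lim)
  show "AE x in freq. norm (u x * s n x) \<le> cmod (u x) * B" for n
    unfolding norm_mult by (intro AE_I2 mult_left_mono bound norm_ge_zero)
qed

lemma fcoeff_mult_transfer:
  assumes a: "summable (\<lambda>k. cmod (a k))" and u: "integrable freq u"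
  shows "(\<lambda>m. fcoeff u (j + int m) * a m) sums fcoeff (\<lambda>x. u x * transfer_fun a x) j"
proof -
  have "(\<lambda>n. \<integral>x. u x * mode (- j) x * transfer_sum a n x \<partial>freq) \<longlonglongrightarrow> (\<integral>x. u x * mode (- j) x * transfer_fun a x \<partial>freq)"
    by (rule integral_bounded_limit[OF integrable_mult_cis[OF u] transfer_sum_measurable transfer_fun_measurable[OF a]
        transfer_sum_bound[OF a] transfer_sum_tendsto[OF a]])
  then have "(\<lambda>n. 1 / (2 * pi) * (\<integral>x. u x * mode (- j) x * transfer_sum a n x \<partial>freq)) \<longlonglongrightarrow>
     1 / (2 * pi) * (\<integral>x. u x * mode (- j) x * transfer_fun a x \<partial>freq)"
    by (intro tendsto_mult tendsto_const)
  moreover have "1 / (2 * pi) * (\<integral>x. u x * mode (- j) x * transfer_sum a n x \<partial>freq) = (\<Sum>m<n. fcoeff u (j + int m) * a m)" for n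
    using fcoeff_mult_modes[OF u, of "{..<n}" a "\<lambda>k. - int k" j]
    by (simp add: fcoeff_def transfer_sum_def mult_ac)
  moreover have "1 / (2 * pi) * (\<integral>x. u x * mode (- j) x * transfer_fun a x \<partial>freq) = fcoeff (\<lambda>x. u x * transfer_fun a x) j"
    by (simp add: fcoeff_def mult_ac)
  ultimately show ?thesis
    unfolding sums_def by simp
qed

lemma integral_mult_cnj_transfer:
  assumes a: "summable (\<lambda>k. cmod (a k))" and u: "integrable freq u"
  shows "(\<lambda>l. fcoeff u (- int l) * cnj (a l)) sums (1 / (2 * pi) * (\<integral>x. u x * cnj (transfer_fun a x) \<partial>freq))"
proof -
  note [measurable] = transfer_fun_measurable[OF a]
  have "(\<lambda>n. \<integral>x. u x * cnj (transfer_sum a n x) \<partial>freq) \<longlonglongrightarrow> (\<integral>x. u x * cnj (transfer_fun a x) \<partial>freq)"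
  proof (rule integral_bounded_limit[OF u])
    have cnj_meas: "cnj \<in> borel_measurable borel"
      by (intro borel_measurable_continuous_onI continuous_intros)
    show "(\<lambda>x. cnj (transfer_sum a n x)) \<in> borel_measurable freq" for n
      by (rule measurable_compose[OF transfer_sum_measurable cnj_meas])
    show "(\<lambda>x. cnj (transfer_fun a x)) \<in> borel_measurable freq"
      by (rule measurable_compose[OF transfer_fun_measurable[OF a] cnj_meas])
    show "cmod (cnj (transfer_sum a n x)) \<le> (\<Sum>k. cmod (a k))" for n x
      unfolding complex_mod_cnj by (rule transfer_sum_bound[OF a])
    show "(\<lambda>n. cnj (transfer_sum a n x)) \<longlonglongrightarrow> cnj (transfer_fun a x)" for x
      by (intro tendsto_cnj transfer_sum_tendsto a)
  qed
  then have "(\<lambda>n. 1 / (2 * pi) * (\<integral>x. u x * cnj (transfer_sum a n x) \<partial>freq)) \<longlonglongrightarrow>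
     1 / (2 * pi) * (\<integral>x. u x * cnj (transfer_fun a x) \<partial>freq)"
    by (intro tendsto_mult tendsto_const)
  moreover have "1 / (2 * pi) * (\<integral>x. u x * cnj (transfer_sum a n x) \<partial>freq) = (\<Sum>l<n. fcoeff u (- int l) * cnj (a l))" for n
    unfolding transfer_sum_def
    by (subst integral_inner_modes[OF u]) (simp_all add: mult.commute)
  ultimately show ?thesis
    unfolding sums_def by simp
qed

lemma summable_ell2:
  assumes "summable (\<lambda>k. cmod (a k))"
  shows "a \<in> ell2"
  unfolding ell2_def mem_Collect_eq
proof (rule summable_comparison_test')
  show "summable (\<lambda>k. (\<Sum>k. cmod (a k)) * cmod (a k))"
    by (intro summable_mult assms)
  fix n
  have "cmod (a n) \<le> (\<Sum>k. cmod (a k))"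
    using sum_le_suminf[OF assms, of "{n}"] by simp
  then show "norm ((cmod (a n))\<^sup>2) \<le> (\<Sum>k. cmod (a k)) * cmod (a n)"
    by (simp add: power2_eq_square mult_right_mono)
qed

text \<open>\<open>Q\<close> is the Toeplitz operator of \<open>f g / (f + g)\<close> in the basis of the functions \<open>e\<^bsup>- i k x\<^esup>\<close>, in which
  \<open>A\<close> has the coordinates \<open>a\<close>.\<close>

lemma Qmat_inner:
  assumes a: "summable (\<lambda>k. cmod (a k))" and q: "integrable freq (\<lambda>x. f x * g x / (f x + g x))"
  shows "l2inner (mat_op (Qmat f g) a) a =
    of_real (1 / (2 * pi) * (\<integral>x. (cmod (transfer_fun a x))\<^sup>2 * (f x * g x / (f x + g x)) \<partial>freq))"
proof -
  define q where "q x = f x * g x / (f x + g x)" for x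
  define A where "A = transfer_fun a"
  have q': "integrable freq (\<lambda>x. complex_of_real (q x))"
    unfolding q_def by (rule integrable_of_real[OF q])
  have Q: "Qmat f g l k = fcoeff (\<lambda>x. complex_of_real (q x)) (- int l + int k)" for l k
  proof -
    have "cis (x * (real l - real k)) * z = z * mode (- (- int l + int k)) x" for x z
      by simp
    then show ?thesis
      unfolding Qmat_def fcoeff_def q_def by presburger
  qed
  have Qa: "mat_op (Qmat f g) a l = fcoeff (\<lambda>x. complex_of_real (q x) * A x) (- int l)" for l
    unfolding mat_op_def Q A_def using fcoeff_mult_transfer[OF a q', of "- int l"] by (rule sums_unique[symmetric])
  have "integrable freq (\<lambda>x. complex_of_real (q x) * A x)"
    unfolding A_def using q' by (rule integrable_mult_bounded[OF _ transfer_fun_measurable[OF a] AE_I2[OF transfer_fun_bound[OF a]]])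
  from integral_mult_cnj_transfer[OF a this]
  have "l2inner (mat_op (Qmat f g) a) a = 1 / (2 * pi) * (\<integral>x. complex_of_real (q x) * A x * cnj (A x) \<partial>freq)"
    unfolding l2inner_def Qa A_def by (rule sums_unique[symmetric])
  also have "(\<integral>x. complex_of_real (q x) * A x * cnj (A x) \<partial>freq) = (\<integral>x. complex_of_real ((cmod (A x))\<^sup>2 * q x) \<partial>freq)"
    by (simp only: of_real_mult complex_norm_square mult_ac)
  finally show ?thesis
    unfolding integral_complex_of_real q_def A_def by simp
qed

section \<open>The optimal spectral characteristic\<close>

text \<open>The error density and its change under a perturbation \<open>d\<close> of \<open>h\<close>, for one real component. The
  linear term is \<open>d\<close> times the residual \<open>c\<close>, which is the component of the correction
  series.\<close>

lemma density_pythagoras: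
  fixes A c d f g h :: real
  assumes "c = A * f - (f + g) * h"
  shows "(A - (h + d))\<^sup>2 * f + (h + d)\<^sup>2 * g = (A - h)\<^sup>2 * f + h\<^sup>2 * g + d\<^sup>2 * (f + g) - 2 * (d * c)"
  unfolding assms by (simp add: power2_eq_square algebra_simps)

text \<open>The error density at the optimum, for one real component, in terms of the two integrands that
  make up the extremal functional; the product \<open>c h\<close> integrates to zero.\<close>

lemma density_split:
  fixes A c f g h :: real
  assumes "c = A * f - (f + g) * h" "f + g \<noteq> 0"
  shows "(A - h)\<^sup>2 * f + h\<^sup>2 * g = A\<^sup>2 * (f * g / (f + g)) + A * (f / (f + g)) * c - c * h"
proof -
  define w where "w = f + g"
  have g: "g = w - f" and w: "w \<noteq> 0"
    using assms(2) by (auto simp: w_def)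
  show ?thesis
    unfolding assms(1) w_def[symmetric] unfolding g using w
    by (simp add: power2_eq_square field_simps)
qed

text \<open>Here \<open>w\<close> is the density of the observations, \<open>c\<close> the coefficient sequence of the correction
  series \<open>C\<close>, and \<open>u = A f / w\<close> the optimal characteristic before the correction.\<close>

locale filtering_pair =
  fixes a :: "nat \<Rightarrow> complex" and f g :: "real \<Rightarrow> real"
  assumes a: "summable (\<lambda>k. cmod (a k))"
    and f: "spectral_density f" and g: "spectral_density g"
    and admissible: "admissible_pair f g"
begin

definition w :: "real \<Rightarrow> real" where "w x = f x + g x"

definition c :: "nat \<Rightarrow> complex" where "c = mat_inv (Pmat f g) (mat_op (Rmat f g) a)"

abbreviation A :: "real \<Rightarrow> complex" where "A \<equiv> transfer_fun a"

abbreviation C :: "real \<Rightarrow> complex" where "C \<equiv> correction_fun a f g"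

abbreviation h :: "real \<Rightarrow> complex" where "h \<equiv> opt_char a f g"

lemma f_integrable: "integrable freq f" and g_integrable: "integrable freq g"
  using f g by (simp_all add: spectral_density_def)

lemma f_nonneg: "x \<in> {-pi..pi} \<Longrightarrow> 0 \<le> f x" and g_nonneg: "x \<in> {-pi..pi} \<Longrightarrow> 0 \<le> g x"
  using f g by (simp_all add: spectral_density_def)

lemma f_measurable [measurable]: "f \<in> borel_measurable freq"
  using f_integrable by simp

lemma g_measurable [measurable]: "g \<in> borel_measurable freq"
  using g_integrable by simp

lemma w_measurable [measurable]: "w \<in> borel_measurable freq"
  unfolding w_def[abs_def] by measurable

lemma A_measurable [measurable]: "A \<in> borel_measurable freq"
  by (rule transfer_fun_measurable[OF a])

lemma w_nonneg: "x \<in> {-pi..pi} \<Longrightarrow> 0 \<le> w x"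
  using f_nonneg g_nonneg by (simp add: w_def)

lemma w_pos: "AE x in freq. 0 < w x"
proof -
  have "(\<integral>\<^sup>+x. 1 / ennreal (w x) \<partial>freq) \<noteq> \<infinity>"
    using admissible by (auto simp: admissible_pair_def w_def)
  then have "AE x in freq. 1 / ennreal (w x) \<noteq> \<infinity>"
    by (intro nn_integral_noteq_infinite) measurable
  then show ?thesis
  proof eventually_elim
    case (elim x)
    then have "ennreal (w x) \<noteq> 0"
      by (auto simp: ennreal_divide_eq_top_iff)
    then show ?case by (simp add: ennreal_eq_0_iff)
  qed
qed

lemma inverse_w_integrable: "integrable freq (\<lambda>x. 1 / w x)"
proof (rule integrableI_bounded)
  show "(\<lambda>x. 1 / w x) \<in> borel_measurable freq" by measurable
  have "(\<integral>\<^sup>+x. ennreal (norm (1 / w x)) \<partial>freq) = (\<integral>\<^sup>+x. 1 / ennreal (w x) \<partial>freq)"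
  proof (rule nn_integral_cong_AE)
    show "AE x in freq. ennreal (norm (1 / w x)) = 1 / ennreal (w x)"
      using w_pos
    proof eventually_elim
      case (elim x)
      then show ?case
        using divide_ennreal[of 1 "w x"] by simp
    qed
  qed
  also have "\<dots> < \<infinity>"
    using admissible by (simp add: admissible_pair_def w_def)
  finally show "(\<integral>\<^sup>+x. ennreal (norm (1 / w x)) \<partial>freq) < \<infinity>" .
qed

lemma Pmat_toeplitz: "Pmat f g = toeplitz (\<lambda>x. 1 / w x)"
proof (intro ext)
  fix l k
  have "cis (x * (real k - real l)) / of_real (f x + g x) =
      complex_of_real (1 / w x) * mode (- (int l - int k)) x" for x
    by (simp add: w_def)
  then show "Pmat f g l k = toeplitz (\<lambda>x. 1 / w x) l k"
    unfolding Pmat_def fcoeff_def by presburger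
qed

lemma inverse_w_bounded: "\<exists>K. AE x in freq. 1 / w x \<le> K"
  using admissible unfolding admissible_pair_def Pmat_toeplitz
  by (intro toeplitz_symbol_bounded inverse_w_integrable) simp

lemma inverse_w_abs_bounded: "\<exists>K. AE x in freq. cmod (of_real (1 / w x)) \<le> K"
proof -
  obtain K where K: "AE x in freq. 1 / w x \<le> K"
    using inverse_w_bounded ..
  have "AE x in freq. cmod (of_real (1 / w x)) \<le> K"
    using K w_pos by eventually_elim (simp only: norm_of_real, simp)
  then show ?thesis ..
qed

text \<open>Since \<open>P\<close> is the Toeplitz operator of \<open>1 / w\<close>, its invertibility bounds \<open>w\<close> above. In
  particular the fixed density \<open>f\<close> is bounded.\<close>

lemma w_bounded: "\<exists>K. AE x in freq. w x \<le> K"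
proof -
  obtain K where K: "AE x in freq. 1 / w x \<le> K"
    using inverse_w_bounded ..
  have "l2_invertible (toeplitz (\<lambda>x. 1 / w x))"
    using admissible unfolding admissible_pair_def Pmat_toeplitz by simp
  then have "\<exists>\<delta>>0. AE x in freq. \<delta> \<le> 1 / w x"
    by (rule toeplitz_symbol_bounded_below[OF _ _ K, rotated 2]) (auto simp: w_nonneg)
  then obtain \<delta> where \<delta>: "0 < \<delta>" "AE x in freq. \<delta> \<le> 1 / w x"
    by auto
  have "AE x in freq. w x \<le> 1 / \<delta>"
    using \<delta>(2) w_pos by eventually_elim (use \<delta>(1) in \<open>simp add: field_simps\<close>)
  then show ?thesis ..
qed

lemma Ra_ell2: "mat_op (Rmat f g) a \<in> ell2"
  using admissible summable_ell2[OF a] unfolding admissible_pair_def l2_operator_def by simp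

lemma c_ell2: "c \<in> ell2"
  unfolding c_def using admissible Ra_ell2 by (intro mat_inv_ell2) (simp_all add: admissible_pair_def)

lemma Pc_eq_Ra: "mat_op (Pmat f g) c = mat_op (Rmat f g) a"
  unfolding c_def using admissible Ra_ell2 by (intro mat_op_mat_inv) (simp_all add: admissible_pair_def)

lemma C_eq: "C = forward_series c"
  by (simp add: correction_fun_def c_def)

lemma C_square_integrable: "square_integrable C"
  unfolding C_eq by (rule forward_series(1)[OF c_ell2])

lemma C_measurable [measurable]: "C \<in> borel_measurable freq"
  by (rule square_integrable_measurable[OF C_square_integrable])

lemma C_div_w_square_integrable: "square_integrable (\<lambda>x. C x * of_real (1 / w x))"
proof -
  obtain K where K: "AE x in freq. cmod (of_real (1 / w x)) \<le> K"
    using inverse_w_abs_bounded ..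
  show ?thesis
    by (rule square_integrable_mult_bounded[OF C_square_integrable _ K]) measurable
qed

definition u :: "real \<Rightarrow> complex" where "u x = of_real (f x / w x) * A x"

lemma ratio_bound: "x \<in> {-pi..pi} \<Longrightarrow> \<bar>f x / w x\<bar> \<le> 1"
  using f_nonneg[of x] g_nonneg[of x] by (auto simp: w_def divide_le_eq)

lemma ratio_integrable: "integrable freq (\<lambda>x. complex_of_real (f x / w x))"
  by (rule integrable_bounded_freq[where B = 1]) (measurable, simp only: norm_of_real ratio_bound)

lemma u_square_integrable: "square_integrable u"
proof (rule square_integrable_bounded[where B = "\<Sum>k. cmod (a k)"])
  show "u \<in> borel_measurable freq"
    unfolding u_def[abs_def] by measurable
  have "cmod (u x) \<le> (\<Sum>k. cmod (a k))" if "x \<in> {-pi..pi}" for x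
  proof -
    have "cmod (u x) = \<bar>f x / w x\<bar> * cmod (A x)"
      by (simp only: u_def norm_mult norm_of_real)
    also have "\<dots> \<le> 1 * (\<Sum>k. cmod (a k))"
      by (intro mult_mono ratio_bound that transfer_fun_bound[OF a]) auto
    finally show ?thesis by simp
  qed
  then show "AE x in freq. cmod (u x) \<le> (\<Sum>k. cmod (a k))"
    by (intro AE_I2) simp
qed

lemma h_eq: "h x = u x - C x * of_real (1 / w x)"
  by (simp add: opt_char_def u_def w_def)

lemma h_square_integrable: "square_integrable h"
proof -
  have "square_integrable (\<lambda>x. u x - C x * of_real (1 / w x))"
    by (intro square_integrable_diff u_square_integrable C_div_w_square_integrable)
  then show ?thesis
    by (simp only: h_eq[symmetric])
qed

lemma h_measurable [measurable]: "h \<in> borel_measurable freq"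
  by (rule square_integrable_measurable[OF h_square_integrable])

lemma fcoeff_u: "fcoeff u (int l + 1) = mat_op (Rmat f g) a l"
proof -
  have R: "Rmat f g l m = fcoeff (\<lambda>x. complex_of_real (f x / w x)) (int l + 1 + int m)" for m
  proof -
    have "cis (- x * (real l + 1 + real m)) * of_real (f x / (f x + g x)) =
        complex_of_real (f x / w x) * mode (- (int l + 1 + int m)) x" for x
    proof -
      have "- x * (real l + 1 + real m) = x * real_of_int (- (int l + 1 + int m))"
        by (simp add: algebra_simps)
      then show ?thesis
        by (simp only: w_def mult.commute)
    qed
    then show ?thesis
      unfolding Rmat_def fcoeff_def by presburger
  qed
  show ?thesis
    unfolding mat_op_def R u_def[abs_def]
    by (rule sums_unique[OF fcoeff_mult_transfer[OF a ratio_integrable]])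
qed

text \<open>Convergence in the mean of the correction series survives the product with the bounded
  function \<open>1 / w\<close>, so that coefficients may be computed term by term.\<close>

lemma fcoeff_C_div_w: "fcoeff (\<lambda>x. C x * of_real (1 / w x)) (int l + 1) = mat_op (Pmat f g) c l"
proof -
  define \<phi> where "\<phi> x = complex_of_real (1 / w x)" for x
  have cnj_\<phi>: "cnj (\<phi> x) = \<phi> x" for x
    by (simp add: \<phi>_def)
  have \<phi>_int: "integrable freq \<phi>"
    unfolding \<phi>_def by (rule integrable_of_real[OF inverse_w_integrable])
  obtain K where K: "AE x in freq. cmod (\<phi> x) \<le> K"
    unfolding \<phi>_def using inverse_w_abs_bounded ..
  define z where "z x = \<phi> x * mode (int l + 1) x" for x
  have cnj_z: "cnj (z x) = \<phi> x * mode (- (int l + 1)) x" for x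
    by (simp add: z_def cnj_\<phi> cis_cnj algebra_simps)
  have "square_integrable z"
    unfolding z_def[abs_def]
  proof (rule square_integrable_mult_bounded[where B = 1])
    show "square_integrable \<phi>"
      by (rule square_integrable_bounded[OF borel_measurable_integrable[OF \<phi>_int] K])
  qed auto
  from integral_mult_forward_series[OF c_ell2 this]
  have "(\<lambda>n. 1 / (2 * pi) * cnj (\<integral>x. z x * cnj (forward_sum c n x) \<partial>freq)) \<longlonglongrightarrow>
     1 / (2 * pi) * cnj (\<integral>x. z x * cnj (C x) \<partial>freq)"
    unfolding C_eq by (intro tendsto_mult tendsto_const tendsto_cnj)
  moreover have "1 / (2 * pi) * cnj (\<integral>x. z x * cnj (C x) \<partial>freq) = fcoeff (\<lambda>x. C x * \<phi> x) (int l + 1)"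
    by (simp only: Bochner_Integration.integral_cnj[symmetric] complex_cnj_mult complex_cnj_cnj cnj_z fcoeff_def mult_ac)
  moreover have "1 / (2 * pi) * cnj (\<integral>x. z x * cnj (forward_sum c n x) \<partial>freq) = (\<Sum>k<n. Pmat f g l k * c k)" for n
  proof -
    have fs: "forward_sum c n x = (\<Sum>k<n. c k * mode (int k + 1) x)" for x
      by (simp add: forward_sum_def)
    have "1 / (2 * pi) * cnj (\<integral>x. z x * cnj (forward_sum c n x) \<partial>freq) = fcoeff (\<lambda>x. \<phi> x * forward_sum c n x) (int l + 1)"
      by (simp only: Bochner_Integration.integral_cnj[symmetric] complex_cnj_mult complex_cnj_cnj cnj_z fcoeff_def mult_ac)
    also have "\<dots> = (\<Sum>k<n. c k * fcoeff \<phi> (int l + 1 - (int k + 1)))"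
      unfolding fs by (rule fcoeff_mult_modes[OF \<phi>_int]) simp
    finally show ?thesis
      unfolding Pmat_toeplitz by (simp add: \<phi>_def[abs_def] mult.commute)
  qed
  ultimately have "(\<lambda>n. \<Sum>k<n. Pmat f g l k * c k) \<longlonglongrightarrow> fcoeff (\<lambda>x. C x * \<phi> x) (int l + 1)"
    by simp
  then show ?thesis
    unfolding mat_op_def \<phi>_def[symmetric] by (intro sums_unique) (simp add: sums_def)
qed

text \<open>This is the equation \<open>P c = R a\<close>, read as a statement about frequencies.\<close>

lemma fcoeff_h: "fcoeff h (int l + 1) = 0"
proof -
  have "fcoeff h (int l + 1) = fcoeff (\<lambda>x. u x - C x * of_real (1 / w x)) (int l + 1)"
    by (simp only: h_eq[symmetric])
  also have "\<dots> = fcoeff u (int l + 1) - fcoeff (\<lambda>x. C x * of_real (1 / w x)) (int l + 1)"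
    by (intro fcoeff_diff square_integrable_integrable u_square_integrable C_div_w_square_integrable)
  finally show ?thesis
    by (simp only: fcoeff_u fcoeff_C_div_w Pc_eq_Ra diff_self)
qed

lemma h_orthogonal: "(\<integral>x. h x * cnj (C x) \<partial>freq) = 0"
  unfolding C_eq by (rule integral_mult_forward_series_eq_0[OF c_ell2 h_square_integrable fcoeff_h])

lemma h_weighted: "AE x in freq. C x = A x * of_real (f x) - of_real (w x) * h x"
  using w_pos by eventually_elim (simp add: h_eq u_def field_simps)

lemma L2_past_w:
  assumes "h' \<in> L2_past w"
  shows "h' \<in> borel_measurable freq" "integrable freq (\<lambda>x. (cmod (h' x))\<^sup>2 * w x)"
proof -
  show m [measurable]: "h' \<in> borel_measurable freq"
    using assms by (simp add: L2_past_def)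
  have "(\<integral>\<^sup>+x. ennreal (norm ((cmod (h' x))\<^sup>2 * w x)) \<partial>freq) = (\<integral>\<^sup>+x. ennreal ((cmod (h' x))\<^sup>2 * w x) \<partial>freq)"
    by (intro nn_integral_cong) (simp add: w_nonneg)
  also have "\<dots> < \<infinity>"
    using assms by (simp add: L2_past_def)
  finally show "integrable freq (\<lambda>x. (cmod (h' x))\<^sup>2 * w x)"
    by (intro integrableI_bounded) measurable
qed

text \<open>\<close>

text \<open>The pairing of \<open>L\<^sub>2(w)\<close> with \<open>L\<^sub>2(1 / w)\<close>, to which \<open>C\<close> belongs because \<open>1 / w\<close> is
  bounded.\<close>

lemma weighted_product:
  assumes m: "v \<in> borel_measurable freq" and i: "integrable freq (\<lambda>x. (cmod (v x))\<^sup>2 * w x)"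
  shows "integrable freq (\<lambda>x. v x * cnj (C x))"
    and "cmod (\<integral>x. v x * cnj (C x) \<partial>freq) \<le>
      sqrt (\<integral>x. (cmod (v x))\<^sup>2 * w x \<partial>freq) * sqrt (\<integral>x. (cmod (cnj (C x) * of_real (sqrt (1 / w x))))\<^sup>2 \<partial>freq)"
proof -
  note [measurable] = m
  \<comment> \<open>the weight is distributed as \<open>sqrt w * sqrt (1 / w) = 1\<close> to reduce to the unweighted inequality\<close>
  define U where "U x = v x * of_real (sqrt (w x))" for x
  define V where "V x = cnj (C x) * of_real (sqrt (1 / w x))" for x
  have U2: "(cmod (U x))\<^sup>2 = (cmod (v x))\<^sup>2 * w x" if "x \<in> {-pi..pi}" for x
    using w_nonneg[OF that] by (simp add: U_def norm_mult power_mult_distrib)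
  have [measurable]: "U \<in> borel_measurable freq"
    unfolding U_def[abs_def] by measurable
  have U: "square_integrable U"
    unfolding square_integrable_def
  proof
    show "integrable freq (\<lambda>x. (cmod (U x))\<^sup>2)"
      using i by (rule Bochner_Integration.integrable_cong[THEN iffD1, rotated 2]) (simp_all add: U2)
  qed measurable
  obtain K where K: "AE x in freq. 1 / w x \<le> K"
    using inverse_w_bounded ..
  have V: "square_integrable V"
    unfolding V_def
  proof (rule square_integrable_mult_bounded[where B = "sqrt K"])
    show "square_integrable (\<lambda>x. cnj (C x))"
      by (rule square_integrable_cnj[OF C_square_integrable])
    show "AE x in freq. cmod (of_real (sqrt (1 / w x))) \<le> sqrt K"
      using K w_pos by eventually_elim (simp only: norm_of_real, simp)
  qed measurable
  have UV: "AE x in freq. U x * V x = v x * cnj (C x)"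
    using w_pos
  proof eventually_elim
    case (elim x)
    then have "sqrt (w x) * sqrt (1 / w x) = 1"
      by (simp flip: real_sqrt_mult)
    then have "complex_of_real (sqrt (w x)) * of_real (sqrt (1 / w x)) = 1"
      by (simp only: of_real_mult[symmetric] of_real_1)
    moreover have "U x * V x = v x * cnj (C x) * (complex_of_real (sqrt (w x)) * of_real (sqrt (1 / w x)))"
      by (simp only: U_def V_def mult_ac)
    ultimately show ?case by simp
  qed
  have cm: "(\<lambda>x. cnj (C x)) \<in> borel_measurable freq"
    by (rule square_integrable_measurable[OF square_integrable_cnj[OF C_square_integrable]])
  have int: "integrable freq (\<lambda>x. U x * V x)"
    by (rule square_integrable_mult[OF U V])
  show "integrable freq (\<lambda>x. v x * cnj (C x))"
    by (rule integrable_cong_AE_imp[OF int _ UV]) (intro borel_measurable_times m cm)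
  have "(\<integral>x. v x * cnj (C x) \<partial>freq) = (\<integral>x. U x * V x \<partial>freq)"
    by (rule integral_cong_AE) (use UV cm m int in \<open>auto intro!: borel_measurable_times elim!: eventually_mono\<close>)
  also have "cmod \<dots> \<le> sqrt (\<integral>x. (cmod (U x))\<^sup>2 \<partial>freq) * sqrt (\<integral>x. (cmod (V x))\<^sup>2 \<partial>freq)"
    by (rule Cauchy_Schwarz_square_integrable[OF U V])
  also have "(\<integral>x. (cmod (U x))\<^sup>2 \<partial>freq) = (\<integral>x. (cmod (v x))\<^sup>2 * w x \<partial>freq)"
    by (rule Bochner_Integration.integral_cong) (simp_all add: U2)
  finally show "cmod (\<integral>x. v x * cnj (C x) \<partial>freq) \<le>
      sqrt (\<integral>x. (cmod (v x))\<^sup>2 * w x \<partial>freq) * sqrt (\<integral>x. (cmod (cnj (C x) * of_real (sqrt (1 / w x))))\<^sup>2 \<partial>freq)"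
    unfolding V_def .
qed

text \<open>A polynomial in the past shares no frequency with \<open>C\<close>; the pairing is continuous in the norm of
  \<open>L\<^sub>2(w)\<close>, in which \<open>h'\<close> is a limit of such polynomials.\<close>

lemma past_orthogonal:
  assumes h': "h' \<in> L2_past w"
  shows "(\<integral>x. h' x * cnj (C x) \<partial>freq) = 0"
proof (rule ccontr)
  assume ne: "(\<integral>x. h' x * cnj (C x) \<partial>freq) \<noteq> 0"
  define I where "I = cmod (\<integral>x. h' x * cnj (C x) \<partial>freq)"
  define D where "D = sqrt (\<integral>x. (cmod (cnj (C x) * of_real (sqrt (1 / w x))))\<^sup>2 \<partial>freq)"
  have I: "0 < I" using ne by (simp add: I_def)
  have D: "0 \<le> D" by (simp add: D_def)
  \<comment> \<open>chosen such that \<open>sqrt \<epsilon> * D < I\<close>, also when \<open>D = 0\<close>\<close>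
  define \<epsilon> where "\<epsilon> = (I / (D + 1))\<^sup>2"
  have "0 < \<epsilon>"
    using I D by (simp add: \<epsilon>_def)
  then obtain n b where nb: "(\<integral>\<^sup>+x. ennreal ((cmod (h' x - (\<Sum>m\<le>n. b m * cis (- x * real m))))\<^sup>2 * w x) \<partial>freq) < ennreal \<epsilon>"
    using h' unfolding L2_past_def mem_Collect_eq by meson
  define p where "p x = (\<Sum>m\<in>{..n}. b m * mode (- int m) x)" for x
  have p_alt: "p x = (\<Sum>m\<le>n. b m * cis (- x * real m))" for x
    by (simp add: p_def)
  have p_sq: "square_integrable p"
    unfolding p_def[abs_def] by (rule square_integrable_sum_cis)
  note [measurable] = L2_past_w(1)[OF h'] square_integrable_measurable[OF p_sq]
  have d_int: "integrable freq (\<lambda>x. (cmod (h' x - p x))\<^sup>2 * w x)"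
  proof (rule integrableI_bounded)
    have "(\<integral>\<^sup>+x. ennreal (norm ((cmod (h' x - p x))\<^sup>2 * w x)) \<partial>freq) = (\<integral>\<^sup>+x. ennreal ((cmod (h' x - p x))\<^sup>2 * w x) \<partial>freq)"
      by (intro nn_integral_cong) (simp add: w_nonneg)
    also have "\<dots> < ennreal \<epsilon>"
      using nb unfolding p_alt .
    also have "ennreal \<epsilon> < \<infinity>" by simp
    finally show "(\<integral>\<^sup>+x. ennreal (norm ((cmod (h' x - p x))\<^sup>2 * w x)) \<partial>freq) < \<infinity>" .
  qed measurable
  have "ennreal (\<integral>x. (cmod (h' x - p x))\<^sup>2 * w x \<partial>freq) < ennreal \<epsilon>"
    using nb unfolding p_alt[symmetric]
    by (subst (asm) nn_integral_eq_integral[OF d_int]) (auto intro!: AE_I2 mult_nonneg_nonneg w_nonneg)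
  then have small: "(\<integral>x. (cmod (h' x - p x))\<^sup>2 * w x \<partial>freq) < \<epsilon>"
    by (subst (asm) ennreal_less_iff) (auto intro!: Bochner_Integration.integral_nonneg simp: w_nonneg)
  have "fcoeff p (int k + 1) = 0" for k
  proof -
    have "fcoeff p (int k + 1) = (\<Sum>m\<in>{..n}. b m * fcoeff (mode 0) (int k + 1 - - int m))"
      using fcoeff_mult_modes[of "mode 0" "{..n}" b "\<lambda>m. - int m" "int k + 1"] by (simp add: p_def[abs_def])
    then show ?thesis
      by (simp only: fcoeff_mode) simp
  qed
  then have p0: "(\<integral>x. p x * cnj (C x) \<partial>freq) = 0"
    unfolding C_eq by (intro integral_mult_forward_series_eq_0[OF c_ell2 p_sq])
  have p_int: "integrable freq (\<lambda>x. p x * cnj (C x))"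
    by (intro square_integrable_mult p_sq square_integrable_cnj C_square_integrable)
  have "(\<integral>x. (h' x - p x) * cnj (C x) \<partial>freq) = (\<integral>x. h' x * cnj (C x) \<partial>freq)"
    unfolding left_diff_distrib
    by (subst Bochner_Integration.integral_diff[OF weighted_product(1)[OF L2_past_w[OF h']] p_int]) (simp add: p0)
  then have "I \<le> sqrt (\<integral>x. (cmod (h' x - p x))\<^sup>2 * w x \<partial>freq) * D"
    using weighted_product(2)[OF _ d_int] unfolding I_def D_def by simp
  also have "\<dots> \<le> sqrt \<epsilon> * D"
    using small D by (intro mult_right_mono real_sqrt_le_mono) auto
  also have "\<dots> = I * (D / (D + 1))"
    using I D by (simp add: \<epsilon>_def real_sqrt_abs)
  also have "\<dots> < I * 1"
    using I D by (intro mult_strict_left_mono) auto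
  finally show False by simp
qed

text \<open>The integrand of \<^const>\<open>mse\<close>, up to the factor \<open>1 / (2 \<pi>)\<close>.\<close>

definition error_density :: "(real \<Rightarrow> complex) \<Rightarrow> real \<Rightarrow> real" where
  "error_density h' x = (cmod (A x - h' x))\<^sup>2 * f x + (cmod (h' x))\<^sup>2 * g x"

lemma A_f_integrable: "integrable freq (\<lambda>x. (cmod (A x))\<^sup>2 * f x)"
proof (rule Bochner_Integration.integrable_bound)
  show "integrable freq (\<lambda>x. (\<Sum>k. cmod (a k))\<^sup>2 * f x)"
    using f_integrable by simp
  show "AE x in freq. norm ((cmod (A x))\<^sup>2 * f x) \<le> norm ((\<Sum>k. cmod (a k))\<^sup>2 * f x)"
  proof (rule AE_I2)
    fix x
    have "(cmod (A x))\<^sup>2 * \<bar>f x\<bar> \<le> (\<Sum>k. cmod (a k))\<^sup>2 * \<bar>f x\<bar>"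
      by (intro mult_right_mono power_mono transfer_fun_bound[OF a]) auto
    then show "norm ((cmod (A x))\<^sup>2 * f x) \<le> norm ((\<Sum>k. cmod (a k))\<^sup>2 * f x)"
      by (simp add: abs_mult)
  qed
qed measurable

lemma mse_error_density:
  assumes [measurable]: "h' \<in> borel_measurable freq" and i: "integrable freq (\<lambda>x. (cmod (h' x))\<^sup>2 * w x)"
  shows "integrable freq (error_density h')"
    and "mse a h' f g = ennreal (1 / (2 * pi) * (\<integral>x. error_density h' x \<partial>freq))"
proof -
  have 1: "integrable freq (\<lambda>x. (cmod (h' x))\<^sup>2 * g x)"
    by (rule Bochner_Integration.integrable_bound[OF i])
       (measurable, intro AE_I2, simp add: abs_mult w_nonneg g_nonneg, simp add: w_def f_nonneg mult_left_mono)
  have 2: "integrable freq (\<lambda>x. (cmod (A x - h' x))\<^sup>2 * f x)"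
  proof (rule Bochner_Integration.integrable_bound)
    show "integrable freq (\<lambda>x. 2 * ((cmod (A x))\<^sup>2 * f x) + 2 * ((cmod (h' x))\<^sup>2 * w x))"
      using i A_f_integrable by simp
    show "AE x in freq. norm ((cmod (A x - h' x))\<^sup>2 * f x) \<le> norm (2 * ((cmod (A x))\<^sup>2 * f x) + 2 * ((cmod (h' x))\<^sup>2 * w x))"
    proof (rule AE_I2)
      fix x assume "x \<in> space freq"
      then have x: "x \<in> {-pi..pi}" by simp
      have "(cmod (A x - h' x))\<^sup>2 \<le> (cmod (A x) + cmod (h' x))\<^sup>2"
        by (intro power_mono norm_triangle_ineq4) auto
      also have "\<dots> \<le> 2 * (cmod (A x))\<^sup>2 + 2 * (cmod (h' x))\<^sup>2"
        using sum_squares_bound[of "cmod (A x)" "cmod (h' x)"] by (simp add: power2_sum)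
      finally have "(cmod (A x - h' x))\<^sup>2 * f x \<le> (2 * (cmod (A x))\<^sup>2 + 2 * (cmod (h' x))\<^sup>2) * f x"
        by (rule mult_right_mono[OF _ f_nonneg[OF x]])
      moreover have "(cmod (h' x))\<^sup>2 * f x \<le> (cmod (h' x))\<^sup>2 * w x"
        by (intro mult_left_mono) (simp_all add: w_def g_nonneg[OF x])
      ultimately have "(cmod (A x - h' x))\<^sup>2 * f x \<le> 2 * ((cmod (A x))\<^sup>2 * f x) + 2 * ((cmod (h' x))\<^sup>2 * w x)"
        unfolding distrib_right by linarith
      then show "norm ((cmod (A x - h' x))\<^sup>2 * f x) \<le> norm (2 * ((cmod (A x))\<^sup>2 * f x) + 2 * ((cmod (h' x))\<^sup>2 * w x))"
        using f_nonneg[OF x] unfolding real_norm_def abs_mult by (intro order_trans[OF _ abs_ge_self]) simp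
    qed
  qed measurable
  show "integrable freq (error_density h')"
    unfolding error_density_def[abs_def] by (intro Bochner_Integration.integrable_add 1 2)
  have "mse a h' f g = ennreal (1 / (2 * pi)) * ennreal (\<integral>x. (cmod (A x - h' x))\<^sup>2 * f x \<partial>freq) +
      ennreal (1 / (2 * pi)) * ennreal (\<integral>x. (cmod (h' x))\<^sup>2 * g x \<partial>freq)"
    unfolding mse_def
    by (subst nn_integral_eq_integral[OF 1], force intro!: AE_I2 mult_nonneg_nonneg g_nonneg,
        subst nn_integral_eq_integral[OF 2], force intro!: AE_I2 mult_nonneg_nonneg f_nonneg, rule refl)
  also have "\<dots> = ennreal (1 / (2 * pi) * ((\<integral>x. (cmod (A x - h' x))\<^sup>2 * f x \<partial>freq) + (\<integral>x. (cmod (h' x))\<^sup>2 * g x \<partial>freq)))"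
  proof -
    have "0 \<le> (\<integral>x. (cmod (A x - h' x))\<^sup>2 * f x \<partial>freq)" "0 \<le> (\<integral>x. (cmod (h' x))\<^sup>2 * g x \<partial>freq)"
      by (intro Bochner_Integration.integral_nonneg mult_nonneg_nonneg; simp add: f_nonneg g_nonneg)+
    then show ?thesis
      by (simp only: distrib_left ennreal_mult[symmetric] ennreal_plus[symmetric] mult_nonneg_nonneg
          zero_le_divide_1_iff pi_ge_zero zero_le_numeral mult_nonneg_nonneg)
  qed
  also have "(\<integral>x. (cmod (A x - h' x))\<^sup>2 * f x \<partial>freq) + (\<integral>x. (cmod (h' x))\<^sup>2 * g x \<partial>freq) = (\<integral>x. error_density h' x \<partial>freq)"
    unfolding error_density_def by (rule Bochner_Integration.integral_add[OF 2 1, symmetric])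
  finally show "mse a h' f g = ennreal (1 / (2 * pi) * (\<integral>x. error_density h' x \<partial>freq))" .
qed

lemma h_weighted_integrable: "integrable freq (\<lambda>x. (cmod (h x))\<^sup>2 * w x)"
proof -
  obtain K where K: "AE x in freq. w x \<le> K"
    using w_bounded ..
  show ?thesis
  proof (rule Bochner_Integration.integrable_bound)
    show "integrable freq (\<lambda>x. K * (cmod (h x))\<^sup>2)"
      using square_integrable_norm[OF h_square_integrable] by simp
    show "AE x in freq. norm ((cmod (h x))\<^sup>2 * w x) \<le> norm (K * (cmod (h x))\<^sup>2)"
      using K w_pos
    proof eventually_elim
      case (elim x)
      then have "(cmod (h x))\<^sup>2 * w x \<le> (cmod (h x))\<^sup>2 * K"
        by (intro mult_left_mono) auto
      then show ?case
        using elim by (simp add: abs_mult mult.commute)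
    qed
  qed measurable
qed

lemma error_density_pythagoras:
  "AE x in freq. error_density h' x = error_density h x + (cmod (h' x - h x))\<^sup>2 * w x
     - 2 * Re ((h' x - h x) * cnj (C x))"
  using h_weighted
proof eventually_elim
  case (elim x)
  define d where "d = h' x - h x"
  have h': "h' x = h x + d" by (simp add: d_def)
  have "Re (C x) = Re (A x) * f x - (f x + g x) * Re (h x)"
    "Im (C x) = Im (A x) * f x - (f x + g x) * Im (h x)"
    unfolding elim by (simp_all add: w_def)
  from this[THEN density_pythagoras, of "Re d"] this[THEN density_pythagoras, of "Im d"]
  show ?case
    unfolding error_density_def h' cmod_power2 d_def[symmetric]
    by (simp add: w_def algebra_simps)
qed

text \<open>The cross term is the pairing of \<open>h' - h\<close> with \<open>C\<close>. Both \<open>h'\<close> and \<open>h\<close> are orthogonal to \<open>C\<close>, the first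
  as a limit of polynomials in the past and the second by its missing frequencies.\<close>

theorem mse_pythagoras:
  assumes h': "h' \<in> L2_past w"
  shows "(\<integral>x. error_density h' x \<partial>freq) =
      (\<integral>x. error_density h x \<partial>freq) + (\<integral>x. (cmod (h' x - h x))\<^sup>2 * w x \<partial>freq)"
proof -
  note [measurable] = L2_past_w(1)[OF h']
  have J: "integrable freq (error_density h')" "integrable freq (error_density h)"
    by (rule mse_error_density(1)[OF L2_past_w[OF h']], rule mse_error_density(1)[OF h_measurable h_weighted_integrable])
  have hC: "integrable freq (\<lambda>x. h' x * cnj (C x))" "integrable freq (\<lambda>x. h x * cnj (C x))"
    by (rule weighted_product(1)[OF L2_past_w[OF h']], rule weighted_product(1)[OF h_measurable h_weighted_integrable])
  define R where "R x = (h' x - h x) * cnj (C x)" for x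
  have R: "integrable freq R"
    unfolding R_def[abs_def] left_diff_distrib by (intro Bochner_Integration.integrable_diff hC)
  have R0: "(\<integral>x. R x \<partial>freq) = 0"
    unfolding R_def left_diff_distrib
    by (simp only: Bochner_Integration.integral_diff[OF hC] past_orthogonal[OF h'] h_orthogonal diff_self)
  have int: "integrable freq (\<lambda>x. error_density h' x - error_density h x + 2 * Re (R x))"
    using J R by simp
  have eq: "AE x in freq. error_density h' x - error_density h x + 2 * Re (R x) = (cmod (h' x - h x))\<^sup>2 * w x"
    using error_density_pythagoras[of h'] unfolding R_def by eventually_elim linarith
  have "(\<integral>x. (cmod (h' x - h x))\<^sup>2 * w x \<partial>freq) = (\<integral>x. error_density h' x - error_density h x + 2 * Re (R x) \<partial>freq)"
    by (rule integral_cong_AE) (use eq int in \<open>auto elim!: eventually_mono\<close>)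
  also have "\<dots> = (\<integral>x. error_density h' x \<partial>freq) - (\<integral>x. error_density h x \<partial>freq) + 2 * Re (\<integral>x. R x \<partial>freq)"
    using J R by simp
  finally show "(\<integral>x. error_density h' x \<partial>freq) =
      (\<integral>x. error_density h x \<partial>freq) + (\<integral>x. (cmod (h' x - h x))\<^sup>2 * w x \<partial>freq)"
    by (simp add: R0)
qed

lemma harmonic_integrable: "integrable freq (\<lambda>x. f x * g x / (f x + g x))"
proof (rule Bochner_Integration.integrable_bound[OF g_integrable])
  show "AE x in freq. norm (f x * g x / (f x + g x)) \<le> norm (g x)"
  proof (rule AE_I2)
    fix x assume "x \<in> space freq"
    then have "\<bar>f x / w x\<bar> * \<bar>g x\<bar> \<le> 1 * \<bar>g x\<bar>"
      by (intro mult_right_mono ratio_bound) auto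
    then show "norm (f x * g x / (f x + g x)) \<le> norm (g x)"
      by (simp add: w_def abs_mult)
  qed
qed measurable

lemma A_harmonic_integrable: "integrable freq (\<lambda>x. (cmod (A x))\<^sup>2 * (f x * g x / (f x + g x)))"
proof (rule Bochner_Integration.integrable_bound[OF A_f_integrable])
  show "AE x in freq. norm ((cmod (A x))\<^sup>2 * (f x * g x / (f x + g x))) \<le> norm ((cmod (A x))\<^sup>2 * f x)"
  proof (rule AE_I2)
    fix x assume "x \<in> space freq"
    then have nn: "0 \<le> f x" "0 \<le> g x"
      using f_nonneg[of x] g_nonneg[of x] by simp_all
    have "f x * (g x / (f x + g x)) \<le> f x * 1"
      using nn by (intro mult_left_mono) (simp_all add: divide_le_eq)
    then have "(cmod (A x))\<^sup>2 * (f x * g x / (f x + g x)) \<le> (cmod (A x))\<^sup>2 * f x"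
      by (intro mult_left_mono) simp_all
    then show "norm ((cmod (A x))\<^sup>2 * (f x * g x / (f x + g x))) \<le> norm ((cmod (A x))\<^sup>2 * f x)"
      using nn by simp
  qed
qed measurable

lemma Ra_inner_c: "l2inner (mat_op (Rmat f g) a) c = 1 / (2 * pi) * (\<integral>x. u x * cnj (C x) \<partial>freq)"
proof -
  have "(\<lambda>n. 1 / (2 * pi) * (\<integral>x. u x * cnj (forward_sum c n x) \<partial>freq)) \<longlonglongrightarrow> 1 / (2 * pi) * (\<integral>x. u x * cnj (C x) \<partial>freq)"
    unfolding C_eq
    by (intro tendsto_mult tendsto_const integral_mult_forward_series c_ell2 u_square_integrable)
  moreover have "1 / (2 * pi) * (\<integral>x. u x * cnj (forward_sum c n x) \<partial>freq) = (\<Sum>k<n. mat_op (Rmat f g) a k * cnj (c k))" for n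
  proof -
    have fs: "forward_sum c n x = (\<Sum>k<n. c k * mode (int k + 1) x)" for x
      by (simp add: forward_sum_def)
    show ?thesis
      unfolding fs
      by (subst integral_inner_modes[OF square_integrable_integrable[OF u_square_integrable]])
         (simp_all add: fcoeff_u mult.commute)
  qed
  ultimately have "(\<lambda>k. mat_op (Rmat f g) a k * cnj (c k)) sums (1 / (2 * pi) * (\<integral>x. u x * cnj (C x) \<partial>freq))"
    unfolding sums_def by simp
  then show ?thesis
    unfolding l2inner_def by (rule sums_unique[symmetric])
qed

text \<open>Integrating the split density, the first integrand gives \<open>\<langle>Q a, a\<rangle>\<close>, the second gives
  \<open>\<langle>R a, P\<^sup>-\<^sup>1 R a\<rangle>\<close> by expanding \<open>C\<close>, and the third vanishes by orthogonality.\<close>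

theorem extremal_functional_eq:
  "extremal_functional a f g = 1 / (2 * pi) * (\<integral>x. error_density h x \<partial>freq)"
proof -
  define q where "q x = f x * g x / (f x + g x)" for x
  define U where "U x = u x * cnj (C x)" for x
  define V where "V x = h x * cnj (C x)" for x
  have U: "integrable freq U"
    unfolding U_def[abs_def]
    by (intro square_integrable_mult square_integrable_cnj u_square_integrable C_square_integrable)
  have V: "integrable freq V"
    unfolding V_def[abs_def]
    by (intro square_integrable_mult square_integrable_cnj h_square_integrable C_square_integrable)
  have Aq: "integrable freq (\<lambda>x. (cmod (A x))\<^sup>2 * q x)"
    unfolding q_def by (rule A_harmonic_integrable)
  have int: "integrable freq (\<lambda>x. (cmod (A x))\<^sup>2 * q x + Re (U x) - Re (V x))"
    using Aq U V by simp
  have eq: "AE x in freq. error_density h x = (cmod (A x))\<^sup>2 * q x + Re (U x) - Re (V x)"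
    using h_weighted w_pos
  proof eventually_elim
    case (elim x)
    have "Re (C x) = Re (A x) * f x - (f x + g x) * Re (h x)"
      "Im (C x) = Im (A x) * f x - (f x + g x) * Im (h x)" and ne: "f x + g x \<noteq> 0"
      using elim(2) unfolding elim(1) by (simp_all add: w_def)
    note parts = this(1)[THEN density_split, OF ne] this(2)[THEN density_split, OF ne]
    have U': "Re (U x) = Re (A x) * (f x / (f x + g x)) * Re (C x) + Im (A x) * (f x / (f x + g x)) * Im (C x)"
    proof -
      have "Re (complex_of_real r * z * cnj y) = Re z * r * Re y + Im z * r * Im y" for r z y
        by (simp add: algebra_simps)
      then show ?thesis
        unfolding U_def u_def w_def .
    qed
    have V': "Re (V x) = Re (C x) * Re (h x) + Im (C x) * Im (h x)"
      unfolding V_def by simp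
    show ?case
      unfolding error_density_def cmod_power2 U' V' q_def
      using parts by (simp only: minus_complex.sel distrib_right) 
  qed
  have "(\<integral>x. error_density h x \<partial>freq) = (\<integral>x. (cmod (A x))\<^sup>2 * q x + Re (U x) - Re (V x) \<partial>freq)"
    by (rule integral_cong_AE)
       (use eq int mse_error_density(1)[OF h_measurable h_weighted_integrable] in auto)
  also have "\<dots> = (\<integral>x. (cmod (A x))\<^sup>2 * q x \<partial>freq) + Re (\<integral>x. U x \<partial>freq) - Re (\<integral>x. V x \<partial>freq)"
    using Aq U V by simp
  also have "(\<integral>x. V x \<partial>freq) = 0"
    unfolding V_def by (rule h_orthogonal)
  finally have J: "(\<integral>x. error_density h x \<partial>freq) = (\<integral>x. (cmod (A x))\<^sup>2 * q x \<partial>freq) + Re (\<integral>x. U x \<partial>freq)"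
    by simp
  have "Re (complex_of_real (1 / (2 * pi)) * z) = 1 / (2 * pi) * Re z" for z
    by (simp only: times_complex.sel Re_complex_of_real Im_complex_of_real mult_zero_left diff_zero)
  then have "extremal_functional a f g = 1 / (2 * pi) * Re (\<integral>x. U x \<partial>freq) + 1 / (2 * pi) * (\<integral>x. (cmod (A x))\<^sup>2 * q x \<partial>freq)"
    unfolding extremal_functional_def c_def[symmetric] Ra_inner_c Qmat_inner[OF a harmonic_integrable] q_def U_def
    by (simp only: plus_complex.sel Re_complex_of_real)
  then show ?thesis
    unfolding J by (simp only: distrib_left add.commute)
qed

corollary mse_opt_char: "mse a h f g = ennreal (extremal_functional a f g)"
  unfolding extremal_functional_eq by (rule mse_error_density(2)[OF h_measurable h_weighted_integrable])

corollary mse_opt_char_le: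
  assumes h': "h' \<in> L2_past w"
  shows "mse a h f g \<le> mse a h' f g"
proof -
  have "0 \<le> (\<integral>x. (cmod (h' x - h x))\<^sup>2 * w x \<partial>freq)"
    by (rule Bochner_Integration.integral_nonneg) (simp add: w_nonneg)
  then show ?thesis
    unfolding mse_error_density(2)[OF L2_past_w[OF h']] mse_error_density(2)[OF h_measurable h_weighted_integrable]
      mse_pythagoras[OF h']
    by (intro ennreal_leI mult_left_mono) auto
qed

end

section \<open>Scaling the total spectral density\<close>

lemma mat_op_scale:
  assumes "l2_operator M" "x \<in> ell2"
  shows "mat_op (\<lambda>l k. s * M l k) x = (\<lambda>l. s * mat_op M x l)"
  using assms unfolding mat_op_def l2_operator_def by (simp add: mult.assoc suminf_mult)

lemma ell2_scale: "x \<in> ell2 \<Longrightarrow> (\<lambda>l. s * x l) \<in> ell2"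
  by (simp add: ell2_def norm_mult power_mult_distrib summable_mult)

lemma l2norm_scale:
  assumes "x \<in> ell2"
  shows "l2norm (\<lambda>l. s * x l) = cmod s * l2norm x"
  using assms unfolding l2norm_def ell2_def
  by (simp add: norm_mult power_mult_distrib suminf_mult real_sqrt_mult)

lemma l2_operator_scale:
  assumes M: "l2_operator M"
  shows "l2_operator (\<lambda>l k. s * M l k)"
  unfolding l2_operator_def
proof (intro conjI ballI allI)
  obtain K where K: "\<And>x. x \<in> ell2 \<Longrightarrow> l2norm (mat_op M x) \<le> K * l2norm x"
    using M unfolding l2_operator_def by auto
  have ran: "mat_op M x \<in> ell2" if "x \<in> ell2" for x
    using M that unfolding l2_operator_def by simp
  show "\<exists>K. \<forall>x\<in>ell2. l2norm (mat_op (\<lambda>l k. s * M l k) x) \<le> K * l2norm x"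
  proof (intro exI ballI)
    fix x :: "nat \<Rightarrow> complex" assume x: "x \<in> ell2"
    show "l2norm (mat_op (\<lambda>l k. s * M l k) x) \<le> (cmod s * K) * l2norm x"
      unfolding mat_op_scale[OF M x] l2norm_scale[OF ran[OF x]] mult.assoc
      by (intro mult_left_mono K x norm_ge_zero)
  qed
  fix x :: "nat \<Rightarrow> complex" assume x: "x \<in> ell2"
  show "mat_op (\<lambda>l k. s * M l k) x \<in> ell2"
    unfolding mat_op_scale[OF M x] by (rule ell2_scale[OF ran[OF x]])
  show "summable (\<lambda>k. s * M l k * x k)" for l
    using M x unfolding l2_operator_def by (simp add: mult.assoc summable_mult)
qed

lemma scale_bij_ell2:
  assumes M: "l2_invertible M" and s: "s \<noteq> 0"
  shows "bij_betw (mat_op (\<lambda>l k. s * M l k)) ell2 ell2"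
proof -
  have op: "l2_operator M"
    using M by (simp add: l2_invertible_def)
  have "bij_betw (\<lambda>x l. s * x l) ell2 (ell2 :: (nat \<Rightarrow> complex) set)"
    by (rule bij_betw_byWitness[where f' = "\<lambda>x l. (1 / s) * x l"]) (use s in \<open>auto intro: ell2_scale[of _ s] ell2_scale[of _ "1 / s", simplified]\<close>)
  with M have "bij_betw ((\<lambda>x l. s * x l) \<circ> mat_op M) ell2 ell2"
    unfolding l2_invertible_def by (auto intro: bij_betw_trans)
  then show ?thesis
    by (rule bij_betw_cong[THEN iffD1, rotated]) (simp add: mat_op_scale[OF op])
qed

lemma mat_inv_scale:
  assumes M: "l2_invertible M" and s: "s \<noteq> 0" and y: "y \<in> ell2"
  shows "mat_inv (\<lambda>l k. s * M l k) (\<lambda>l. s * y l) = mat_inv M y"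
proof -
  have op: "l2_operator M"
    using M by (simp add: l2_invertible_def)
  have "mat_op (\<lambda>l k. s * M l k) (mat_inv M y) = (\<lambda>l. s * y l)"
    using mat_op_scale[OF op mat_inv_ell2[OF M y]] mat_op_mat_inv[OF M y] by simp
  then show ?thesis
    using bij_betw_imp_inj_on[OF scale_bij_ell2[OF M s]] mat_inv_ell2[OF M y]
    unfolding mat_inv_def[of "\<lambda>l k. s * M l k"] by (simp add: inv_into_f_eq)
qed

lemma l2_invertible_scale:
  assumes M: "l2_invertible M" and s: "s \<noteq> 0"
  shows "l2_invertible (\<lambda>l k. s * M l k)"
  unfolding l2_invertible_def
proof (intro conjI)
  show "l2_operator (\<lambda>l k. s * M l k)"
    using M by (intro l2_operator_scale) (simp add: l2_invertible_def)
  show "bij_betw (mat_op (\<lambda>l k. s * M l k)) ell2 ell2"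
    by (rule scale_bij_ell2[OF M s])
  obtain K where K: "\<And>y. y \<in> ell2 \<Longrightarrow> l2norm (mat_inv M y) \<le> K * l2norm y"
    using M unfolding l2_invertible_def by auto
  show "\<exists>K. \<forall>y\<in>ell2. l2norm (mat_inv (\<lambda>l k. s * M l k) y) \<le> K * l2norm y"
  proof (intro exI ballI)
    fix y :: "nat \<Rightarrow> complex" assume y: "y \<in> ell2"
    have "mat_inv (\<lambda>l k. s * M l k) y = mat_inv M (\<lambda>l. 1 / s * y l)"
      using mat_inv_scale[OF M s ell2_scale[OF y, of "1 / s"]] s by simp
    then show "l2norm (mat_inv (\<lambda>l k. s * M l k) y) \<le> (K * cmod (1 / s)) * l2norm y"
      using K[OF ell2_scale[OF y, of "1 / s"]] l2norm_scale[OF y, of "1 / s"] by (simp only: mult.assoc)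
  qed
qed

lemma harmonic_inflated:
  fixes F G t :: real
  assumes "0 < t" "0 < F + G"
  shows "F * ((1 + t) * G + t * F) / ((1 + t) * (F + G)) =
    1 / (1 + t) * (F * G / (F + G)) + (1 - 1 / (1 + t)) * F"
proof -
  define W r where "W = F + G" and "r = 1 + t"
  have ne: "W \<noteq> 0" "r \<noteq> 0"
    using assms by (auto simp: W_def r_def)
  have "F * (r * W - F) / (r * W) = 1 / r * (F * (W - F) / W) + (1 - 1 / r) * F"
    using ne by (simp add: field_simps)
  moreover have "(1 + t) * G + t * F = r * W - F" "G = W - F"
    by (simp_all add: W_def r_def algebra_simps)
  ultimately show ?thesis
    unfolding W_def r_def by simp
qed

context filtering_pair
begin

text \<open>The direction of perturbation: adding \<open>t f\<close> as well makes the total density proportional to \<open>w\<close>.\<close>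

definition inflated :: "real \<Rightarrow> real \<Rightarrow> real" where
  "inflated t x = (1 + t) * g x + t * f x"

lemma f_plus_inflated: "f x + inflated t x = (1 + t) * w x"
  by (simp add: inflated_def w_def algebra_simps)

lemma inflated_spectral_density:
  assumes "0 < t"
  shows "spectral_density (inflated t)"
  unfolding spectral_density_def inflated_def[abs_def]
  using assms f_integrable g_integrable f_nonneg g_nonneg by auto

lemma Pmat_inflated: "Pmat f (inflated t) = (\<lambda>l k. of_real (1 / (1 + t)) * Pmat f g l k)"
proof (intro ext)
  fix l k
  have "cis (x * (real k - real l)) / complex_of_real (f x + inflated t x) =
      of_real (1 / (1 + t)) * (cis (x * (real k - real l)) / complex_of_real (f x + g x))" for x
    unfolding f_plus_inflated w_def by simp
  then show "Pmat f (inflated t) l k = of_real (1 / (1 + t)) * Pmat f g l k"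
    unfolding Pmat_def by (simp only: integral_mult_right_zero mult.left_commute)
qed

lemma Rmat_inflated: "Rmat f (inflated t) = (\<lambda>l k. of_real (1 / (1 + t)) * Rmat f g l k)"
proof (intro ext)
  fix l k
  have "cis (- x * (real l + 1 + real k)) * complex_of_real (f x / (f x + inflated t x)) =
      of_real (1 / (1 + t)) * (cis (- x * (real l + 1 + real k)) * complex_of_real (f x / (f x + g x)))" for x
    unfolding f_plus_inflated w_def by simp
  then show "Rmat f (inflated t) l k = of_real (1 / (1 + t)) * Rmat f g l k"
    unfolding Rmat_def by (simp only: integral_mult_right_zero mult.left_commute)
qed

lemma f_bounded: "\<exists>B. AE x in freq. f x \<le> B"
proof -
  obtain B where B: "AE x in freq. w x \<le> B"
    using w_bounded ..
  have "AE x in freq. f x \<le> B"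
    using B AE_space[of freq] by eventually_elim (use g_nonneg in \<open>auto simp: w_def intro: order_trans[rotated]\<close>)
  then show ?thesis ..
qed

text \<open>\<open>P\<close> and \<open>R\<close> are rescaled. The new \<open>Q\<close> is not a multiple of the old one, but its symbol is at most
  \<open>f\<close>, which is bounded.\<close>

lemma admissible_inflated:
  assumes t: "0 < t"
  shows "admissible_pair f (inflated t)"
  unfolding admissible_pair_def
proof (intro conjI)
  have s: "complex_of_real (1 / (1 + t)) \<noteq> 0"
    unfolding of_real_eq_0_iff using t by simp
  have "(\<integral>\<^sup>+x. 1 / ennreal (f x + inflated t x) \<partial>freq) \<le> (\<integral>\<^sup>+x. 1 / ennreal (f x + g x) \<partial>freq)"
  proof (rule nn_integral_mono_AE)
    show "AE x in freq. 1 / ennreal (f x + inflated t x) \<le> 1 / ennreal (f x + g x)"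
      using w_pos
    proof eventually_elim
      case (elim x)
      then have le: "1 / ((1 + t) * w x) \<le> 1 / w x" and pos: "0 < (1 + t) * w x"
        using t by (simp_all add: divide_simps)
      have "1 / ennreal r = ennreal (1 / r)" if "0 < r" for r
        using divide_ennreal[of 1 r] that by simp
      then show ?case
        unfolding f_plus_inflated w_def[symmetric] using le pos elim by (simp add: ennreal_leI)
    qed
  qed
  also have "\<dots> < \<infinity>"
    using admissible by (simp add: admissible_pair_def)
  finally show "(\<integral>\<^sup>+x. 1 / ennreal (f x + inflated t x) \<partial>freq) < \<infinity>" .
  show "l2_operator (Pmat f (inflated t))" "l2_operator (Rmat f (inflated t))"
    unfolding Pmat_inflated Rmat_inflated
    using admissible by (intro l2_operator_scale; simp add: admissible_pair_def)+
  show "l2_invertible (Pmat f (inflated t))"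
    unfolding Pmat_inflated using admissible by (intro l2_invertible_scale s) (simp add: admissible_pair_def)
  define q where "q x = f x * inflated t x / (f x + inflated t x)" for x
  have Q: "Qmat f (inflated t) = (\<lambda>l k. fcoeff (\<lambda>x. complex_of_real (q x)) (int k - int l))"
  proof (intro ext)
    fix l k
    have "cis (x * (real l - real k)) * z = z * mode (- (int k - int l)) x" for x z
      by simp
    then show "Qmat f (inflated t) l k = fcoeff (\<lambda>x. complex_of_real (q x)) (int k - int l)"
      unfolding Qmat_def fcoeff_def q_def by presburger
  qed
  obtain B where B: "AE x in freq. f x \<le> B"
    using f_bounded ..
  have "AE x in freq. \<bar>q x\<bar> \<le> max B 0"
    using B AE_space[of freq]
  proof eventually_elim
    case (elim x)
    then have nn: "0 \<le> f x" "0 \<le> inflated t x"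
      using t f_nonneg[of x] g_nonneg[of x] by (simp_all add: inflated_def)
    then have "inflated t x / (f x + inflated t x) \<le> 1"
      by (simp add: divide_le_eq)
    then have "f x * (inflated t x / (f x + inflated t x)) \<le> f x * 1"
      using nn by (intro mult_left_mono)
    then have "q x \<le> f x"
      by (simp add: q_def)
    moreover have "0 \<le> q x"
      using nn by (simp add: q_def)
    ultimately show ?case
      using elim by linarith
  qed
  moreover have "q \<in> borel_measurable freq"
    unfolding q_def[abs_def] inflated_def[abs_def] by measurable
  ultimately show "l2_operator (Qmat f (inflated t))"
    unfolding Q by (intro toeplitz_bounded_operator[where B = "max B 0"]) auto
qed

text \<open>The factor \<open>1 / (1 + t)\<close> of \<open>R\<close> cancels in \<open>P\<^sup>-\<^sup>1 R a\<close>, so the first inner product is scaled by it; the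
  symbol of the new \<open>Q\<close> is the convex combination of the old symbol and \<open>f\<close> with weights
  \<open>1 / (1 + t)\<close> and \<open>t / (1 + t)\<close>.\<close>

lemma extremal_functional_inflated:
  assumes t: "0 < t"
  shows "(1 + t) * extremal_functional a f (inflated t) =
    extremal_functional a f g + t * (1 / (2 * pi) * (\<integral>x. (cmod (A x))\<^sup>2 * f x \<partial>freq))"
proof -
  interpret inf: filtering_pair a f "inflated t"
    by unfold_locales (intro a f inflated_spectral_density admissible_inflated t)+
  define s where "s = 1 / (1 + t)"
  define r where "r = Re (l2inner (mat_op (Rmat f g) a) c)"
  have s: "complex_of_real s \<noteq> 0" "(1 + t) * s = 1"
    unfolding of_real_eq_0_iff using t by (simp_all add: s_def)
  have P: "l2_invertible (Pmat f g)" and R: "l2_operator (Rmat f g)"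
    using admissible by (simp_all add: admissible_pair_def)
  have Ra: "mat_op (Rmat f (inflated t)) a = (\<lambda>l. of_real s * mat_op (Rmat f g) a l)"
    unfolding Rmat_inflated s_def by (rule mat_op_scale[OF R summable_ell2[OF a]])
  have c': "mat_inv (Pmat f (inflated t)) (mat_op (Rmat f (inflated t)) a) = c"
    unfolding Ra unfolding Pmat_inflated s_def[symmetric] c_def by (rule mat_inv_scale[OF P s(1) Ra_ell2])
  have "summable (\<lambda>k. mat_op (Rmat f g) a k * cnj (c k))"
  proof (rule summable_comparison_test')
    show "summable (\<lambda>k. (cmod (mat_op (Rmat f g) a k))\<^sup>2 + (cmod (c k))\<^sup>2)"
      using Ra_ell2 c_ell2 by (intro summable_add) (simp_all add: ell2_def)
    fix k
    have "2 * (cmod (mat_op (Rmat f g) a k) * cmod (c k)) \<le> (cmod (mat_op (Rmat f g) a k))\<^sup>2 + (cmod (c k))\<^sup>2"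
      "0 \<le> cmod (mat_op (Rmat f g) a k) * cmod (c k)"
      using sum_squares_bound[of "cmod (mat_op (Rmat f g) a k)" "cmod (c k)"] by simp_all
    then show "norm (mat_op (Rmat f g) a k * cnj (c k)) \<le> (cmod (mat_op (Rmat f g) a k))\<^sup>2 + (cmod (c k))\<^sup>2"
      unfolding norm_mult complex_mod_cnj by linarith
  qed
  then have inner: "l2inner (mat_op (Rmat f (inflated t)) a) c = of_real s * l2inner (mat_op (Rmat f g) a) c"
    unfolding Ra l2inner_def by (simp only: mult.assoc suminf_mult)
  define Qg where "Qg = (\<integral>x. (cmod (A x))\<^sup>2 * (f x * g x / (f x + g x)) \<partial>freq)"
  define Qf where "Qf = (\<integral>x. (cmod (A x))\<^sup>2 * f x \<partial>freq)"
  have "(\<integral>x. (cmod (A x))\<^sup>2 * (f x * inflated t x / (f x + inflated t x)) \<partial>freq) =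
      (\<integral>x. s * ((cmod (A x))\<^sup>2 * (f x * g x / (f x + g x))) + (1 - s) * ((cmod (A x))\<^sup>2 * f x) \<partial>freq)"
  proof (rule integral_cong_AE)
    show "AE x in freq. (cmod (A x))\<^sup>2 * (f x * inflated t x / (f x + inflated t x)) =
        s * ((cmod (A x))\<^sup>2 * (f x * g x / (f x + g x))) + (1 - s) * ((cmod (A x))\<^sup>2 * f x)"
      using w_pos
    proof eventually_elim
      case (elim x)
      have "f x * inflated t x / (f x + inflated t x) = s * (f x * g x / (f x + g x)) + (1 - s) * f x"
        using harmonic_inflated[OF t elim[unfolded w_def]]
        unfolding f_plus_inflated unfolding inflated_def s_def w_def .
      then show ?case by (simp only: distrib_left mult.left_commute)
    qed
  qed (use t in \<open>simp_all add: inflated_def\<close>)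
  also have "\<dots> = s * Qg + (1 - s) * Qf"
    unfolding Qg_def Qf_def
    by (simp only: Bochner_Integration.integral_add[OF integrable_mult_right[OF A_harmonic_integrable] integrable_mult_right[OF A_f_integrable]]
        integral_mult_right_zero)
  finally have Q: "(\<integral>x. (cmod (A x))\<^sup>2 * (f x * inflated t x / (f x + inflated t x)) \<partial>freq) = s * Qg + (1 - s) * Qf" .
  have "extremal_functional a f (inflated t) = s * r + 1 / (2 * pi) * (s * Qg + (1 - s) * Qf)"
    unfolding extremal_functional_def c' inner Qmat_inner[OF a inf.harmonic_integrable] Q r_def
    by simp
  moreover have "extremal_functional a f g = r + 1 / (2 * pi) * Qg"
    unfolding extremal_functional_def c_def[symmetric] Qmat_inner[OF a harmonic_integrable] Qg_def r_def by simp
  moreover have "(1 + t) * (s * r + 1 / (2 * pi) * (s * Qg + (1 - s) * Qf)) =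
      ((1 + t) * s) * (r + 1 / (2 * pi) * Qg) + ((1 + t) - (1 + t) * s) * (1 / (2 * pi) * Qf)"
    by (simp add: algebra_simps add_divide_distrib)
  ultimately show ?thesis
    unfolding s(2) Qf_def[symmetric] by simp
qed

text \<open>The value of the functional at the inflated density is a convex combination of its value at \<open>g\<close> and
  the error of the zero estimate. If it does not exceed the value at \<open>g\<close>, then the zero
  estimate is optimal too, and the optimum is unique.\<close>

lemma opt_char_eq_0:
  assumes t: "0 < t" and le: "extremal_functional a f (inflated t) \<le> extremal_functional a f g"
  shows "AE x in freq. h x = 0"
proof -
  define I where "I = (\<integral>x. (cmod (A x))\<^sup>2 * f x \<partial>freq)"
  have "(1 + t) * extremal_functional a f (inflated t) \<le> (1 + t) * extremal_functional a f g"
    using t le by simp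
  then have "t * (1 / (2 * pi) * I) \<le> t * extremal_functional a f g"
    unfolding extremal_functional_inflated[OF t] I_def by (simp add: distrib_right)
  then have I_le: "I \<le> (\<integral>x. error_density h x \<partial>freq)"
    using t by (simp add: extremal_functional_eq field_simps)
  have zero: "(\<lambda>_. 0) \<in> L2_past w"
    unfolding L2_past_def by (auto intro!: exI[of _ "\<lambda>_. 0"])
  have "I = (\<integral>x. error_density (\<lambda>_. 0) x \<partial>freq)"
    by (simp add: I_def error_density_def)
  also have "\<dots> = (\<integral>x. error_density h x \<partial>freq) + (\<integral>x. (cmod (0 - h x))\<^sup>2 * w x \<partial>freq)"
    by (rule mse_pythagoras[OF zero])
  finally have "(\<integral>x. (cmod (h x))\<^sup>2 * w x \<partial>freq) \<le> 0"
    using I_le by simp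
  moreover have "0 \<le> (\<integral>x. (cmod (h x))\<^sup>2 * w x \<partial>freq)"
    by (rule Bochner_Integration.integral_nonneg) (simp add: w_nonneg)
  ultimately have "(\<integral>x. (cmod (h x))\<^sup>2 * w x \<partial>freq) = 0"
    by simp
  then have "AE x in freq. (cmod (h x))\<^sup>2 * w x = 0"
    by (subst (asm) integral_nonneg_eq_0_iff_AE[OF h_weighted_integrable]) (auto intro!: AE_I2 simp: w_nonneg)
  then show ?thesis
    using w_pos by eventually_elim auto
qed

text \<open>Almost everywhere \<open>A f - C = w h\<close>, so the hypothesis reads
  \<open>g = max 0 (w \<bar>h\<bar> / \<alpha> - f)\<close> with \<open>w = f + g\<close>.\<close>

lemma opt_char_modulus:
  assumes \<alpha>: "0 < \<alpha>"
    and form: "AE x in freq. g x = max 0 (cmod (A x * of_real (f x) - C x) / \<alpha> - f x)"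
  shows "AE x in freq. cmod (h x) \<le> \<alpha> \<and> (g x \<noteq> 0 \<longrightarrow> cmod (h x) = \<alpha>)"
  using form h_weighted w_pos AE_space[of freq]
proof eventually_elim
  case (elim x)
  have "A x * of_real (f x) - C x = of_real (w x) * h x"
    unfolding elim(2) by simp
  then have "cmod (A x * of_real (f x) - C x) = w x * cmod (h x)"
    using elim(3) by (simp add: norm_mult)
  with elim(1) have g: "g x = max 0 (w x * cmod (h x) / \<alpha> - f x)"
    by simp
  then have "w x * cmod (h x) / \<alpha> \<le> w x * 1"
    by (simp add: w_def)
  then have "w x * cmod (h x) \<le> w x * \<alpha>"
    using \<alpha> by (simp add: field_simps)
  then have le: "cmod (h x) \<le> \<alpha>"
    using elim(3) by simp
  moreover have "cmod (h x) = \<alpha>" if "g x \<noteq> 0"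
  proof -
    have "w x * cmod (h x) / \<alpha> = w x"
      using g that by (simp add: w_def max_def split: if_splits)
    then have "w x * cmod (h x) = w x * \<alpha>"
      using \<alpha> by (simp add: field_simps)
    then show ?thesis using elim(3) by simp
  qed
  ultimately show ?case by simp
qed

end

section \<open>The saddle point\<close>

lemma mse_noise_mono:
  assumes "(\<integral>\<^sup>+x. ennreal ((cmod (h x))\<^sup>2 * g x) \<partial>freq) \<le> (\<integral>\<^sup>+x. ennreal ((cmod (h x))\<^sup>2 * g' x) \<partial>freq)"
  shows "mse a h f g \<le> mse a h f g'"
  unfolding mse_def by (intro add_left_mono mult_left_mono assms) simp

theorem theorem5:
  fixes a :: "nat \<Rightarrow> complex" and f g\<^sub>0 :: "real \<Rightarrow> real" and P\<^sub>2 \<alpha>\<^sub>2 :: real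
  assumes "summable (\<lambda>k. cmod (a k))"
    and "summable (\<lambda>k. (real k + 1) * (cmod (a k))\<^sup>2)"
    and "spectral_density f"
    and "P\<^sub>2 > 0"
    and "g\<^sub>0 \<in> noise_class P\<^sub>2"
    and "admissible_pair f g\<^sub>0"
    and "\<exists>B. AE x in freq.
           cmod (transfer_fun a x * of_real (f x) - correction_fun a f g\<^sub>0 x) / (f x + g\<^sub>0 x) \<le> B"
    and "\<alpha>\<^sub>2 > 0"
    and "AE x in freq. g\<^sub>0 x =
           max 0 (cmod (transfer_fun a x * of_real (f x) - correction_fun a f g\<^sub>0 x) / \<alpha>\<^sub>2 - f x)"
    and "solves_extremal_problem a f (noise_class P\<^sub>2) g\<^sub>0"
  shows "least_favorable a f (noise_class P\<^sub>2) g\<^sub>0 \<and>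
         minimax_robust a f (noise_class P\<^sub>2) (opt_char a f g\<^sub>0)"
proof -
  let ?D = "noise_class P\<^sub>2"
  have g0: "spectral_density g\<^sub>0" "1 / (2 * pi) * (\<integral>x. g\<^sub>0 x \<partial>freq) \<le> P\<^sub>2"
    using assms(5) by (simp_all add: noise_class_def)
  interpret filtering_pair a f g\<^sub>0
    by unfold_locales (fact assms(1) assms(3) g0(1) assms(6))+
  have modulus: "AE x in freq. cmod (h x) \<le> \<alpha>\<^sub>2 \<and> (g\<^sub>0 x \<noteq> 0 \<longrightarrow> cmod (h x) = \<alpha>\<^sub>2)"
    by (rule opt_char_modulus[OF assms(8,9)])
  have noise_le: "(\<integral>\<^sup>+x. ennreal ((cmod (h x))\<^sup>2 * g x) \<partial>freq) \<le> (\<integral>\<^sup>+x. ennreal ((cmod (h x))\<^sup>2 * g\<^sub>0 x) \<partial>freq)"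
    if "g \<in> ?D" for g
  proof -
    have g: "spectral_density g" "1 / (2 * pi) * (\<integral>x. g x \<partial>freq) \<le> P\<^sub>2"
      using that by (simp_all add: noise_class_def)
    have g_int: "integrable freq g" and g_nn: "\<And>x. x \<in> {-pi..pi} \<Longrightarrow> 0 \<le> g x"
      using g(1) by (simp_all add: spectral_density_def)
    show ?thesis
    proof (cases "1 / (2 * pi) * (\<integral>x. g\<^sub>0 x \<partial>freq) = P\<^sub>2")
      case True
      have "(\<integral>\<^sup>+x. ennreal ((cmod (h x))\<^sup>2 * g x) \<partial>freq) \<le> (\<integral>\<^sup>+x. ennreal (\<alpha>\<^sub>2\<^sup>2 * g x) \<partial>freq)"
      proof (rule nn_integral_mono_AE)
        show "AE x in freq. ennreal ((cmod (h x))\<^sup>2 * g x) \<le> ennreal (\<alpha>\<^sub>2\<^sup>2 * g x)"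
          using modulus AE_space[of freq]
          by eventually_elim (auto intro!: ennreal_leI mult_right_mono power_mono g_nn)
      qed
      also have "\<dots> = ennreal (\<alpha>\<^sub>2\<^sup>2 * (\<integral>x. g x \<partial>freq))"
        using g_int g_nn by (subst nn_integral_eq_integral) (auto intro!: AE_I2)
      also have "\<dots> \<le> ennreal (\<alpha>\<^sub>2\<^sup>2 * (\<integral>x. g\<^sub>0 x \<partial>freq))"
        using g(2) unfolding True[symmetric] by (intro ennreal_leI mult_left_mono) (simp_all add: field_simps)
      also have "\<dots> = (\<integral>\<^sup>+x. ennreal (\<alpha>\<^sub>2\<^sup>2 * g\<^sub>0 x) \<partial>freq)"
        using g_integrable g_nonneg by (subst nn_integral_eq_integral) (auto intro!: AE_I2)
      also have "\<dots> = (\<integral>\<^sup>+x. ennreal ((cmod (h x))\<^sup>2 * g\<^sub>0 x) \<partial>freq)"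
        by (rule nn_integral_cong_AE) (use modulus in \<open>eventually_elim, auto\<close>)
      finally show ?thesis .
    next
      case False
      define G F where "G = (\<integral>x. g\<^sub>0 x \<partial>freq)" and "F = (\<integral>x. f x \<partial>freq)"
      have GF: "0 \<le> G" "0 \<le> F"
        unfolding G_def F_def by (intro Bochner_Integration.integral_nonneg; simp add: g_nonneg f_nonneg)+
      \<comment> \<open>small enough for the inflated density to respect the power constraint\<close>
      define t where "t = (2 * pi * P\<^sub>2 - G) / (G + F + 1)"
      have slack: "G < 2 * pi * P\<^sub>2"
        using False g0(2) unfolding G_def by (simp add: field_simps)
      then have t: "0 < t"
        using GF by (simp add: t_def)
      have "t * (G + F) \<le> t * (G + F + 1)"
        using t by simp
      also have "\<dots> = 2 * pi * P\<^sub>2 - G"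
        using GF by (simp add: t_def)
      finally have "(1 + t) * G + t * F \<le> 2 * pi * P\<^sub>2"
        by (simp add: algebra_simps)
      moreover have "(\<integral>x. inflated t x \<partial>freq) = (1 + t) * G + t * F"
        unfolding inflated_def G_def F_def using f_integrable g_integrable by simp
      ultimately have "inflated t \<in> ?D"
        using inflated_spectral_density[OF t] by (simp add: noise_class_def field_simps)
      then have "extremal_functional a f (inflated t) \<le> extremal_functional a f g\<^sub>0"
        using assms(10) admissible_inflated[OF t] by (simp add: solves_extremal_problem_def)
      then have h0: "AE x in freq. h x = 0"
        by (rule opt_char_eq_0[OF t])
      have "(\<integral>\<^sup>+x. ennreal ((cmod (h x))\<^sup>2 * g x) \<partial>freq) = (\<integral>\<^sup>+x. 0 \<partial>freq)"
        by (rule nn_integral_cong_AE) (use h0 in \<open>eventually_elim, auto\<close>)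
      then show ?thesis by simp
    qed
  qed
  then have saddle: "mse a h f g \<le> mse a h f g\<^sub>0" if "g \<in> ?D" for g
    using that by (intro mse_noise_mono)
  have "least_favorable a f ?D g\<^sub>0"
    unfolding least_favorable_def
  proof (intro conjI ballI impI assms(5,6))
    fix g assume g: "g \<in> ?D" "admissible_pair f g"
    interpret G: filtering_pair a f g
      by unfold_locales (use g assms(1,3) in \<open>simp_all add: noise_class_def\<close>)
    show "mse a (opt_char a f g) f g \<le> mse a h f g\<^sub>0"
      unfolding G.mse_opt_char mse_opt_char
      using assms(10) g by (intro ennreal_leI) (simp add: solves_extremal_problem_def)
  qed
  moreover have "minimax_robust a f ?D h"
    unfolding minimax_robust_def
  proof
    have "AE x in freq. cmod (h x) \<le> \<alpha>\<^sub>2"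
      using modulus by eventually_elim simp
    then have "h \<in> L2_past (\<lambda>x. f x + g x)" if "g \<in> ?D" for g
      using that f_integrable f_nonneg
      by (intro bounded_in_L2_past[OF h_measurable _ fcoeff_h])
         (auto simp: noise_class_def spectral_density_def)
    then show robust: "h \<in> robust_chars f ?D"
      by (simp add: robust_chars_def)
    have sup: "(SUP g\<in>?D. mse a h f g) = mse a h f g\<^sub>0"
      using saddle assms(5) by (intro antisym SUP_least SUP_upper)
    show "(INF h\<in>robust_chars f ?D. SUP g\<in>?D. mse a h f g) = (SUP g\<in>?D. mse a h f g)"
    proof (rule antisym)
      show "(INF h\<in>robust_chars f ?D. SUP g\<in>?D. mse a h f g) \<le> (SUP g\<in>?D. mse a h f g)"
        by (rule INF_lower[OF robust])
      show "(SUP g\<in>?D. mse a h f g) \<le> (INF h\<in>robust_chars f ?D. SUP g\<in>?D. mse a h f g)"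
        unfolding sup
      proof (rule INF_greatest)
        fix h' assume "h' \<in> robust_chars f ?D"
        then have "h' \<in> L2_past (\<lambda>x. f x + g\<^sub>0 x)"
          using assms(5) by (simp add: robust_chars_def)
        then have "mse a h f g\<^sub>0 \<le> mse a h' f g\<^sub>0"
          by (intro mse_opt_char_le) (simp add: w_def[abs_def])
        also have "\<dots> \<le> (SUP g\<in>?D. mse a h' f g)"
          by (rule SUP_upper[OF assms(5)])
        finally show "mse a h f g\<^sub>0 \<le> (SUP g\<in>?D. mse a h' f g)" .
      qed
    qed
  qed
  ultimately show ?thesis ..
qed

end
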